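(* Let $s, t \in \mathbb{N}^+$ and $s' \in \mathbb{N}$, and assume that $t \ge s^3 - 1$ whenever $s - s' \ge 2$. If the rooted tree $F := T_{s,t,s'}$ is balanced, then for every $p \in \mathbb{N}^+$ we have $\operatorname{ex}(n, F^p) = O(n^{2-1/\rho_F})$ as $n \to \infty$ (the implied constant depending on $s,t,s',p$), where $\rho_F = (st + t + s')/(t + 1)$.
   Context: A rooted graph is a graph $F$ together with a subset $R(F)$ of its vertices, called roots. For integers $s \ge 1$, $t \ge 0$, $s' \ge 0$, the rooted tree $T_{s,t,s'}$ consists of a vertex $v_0$; $t$ vertices $q_1,\dots,q_t$ each adjacent to $v_0$; for each $j$, $s$ further vertices adjacent only to $q_j$; and $s'$ further vertices adjacent only to $v_0$. Its root set consists of these $ts + s'$ leaves (so $v_0, q_1, \dots, q_t$ are the non-roots; for $t=0$ it is the star $K_{1,s'}$ with its leaves as roots). For a rooted graph $F$, its $p$th power $F^p$ is obtained by taking $p$ disjoint copies of $F$ and identifying the copies of each root (reducing multiple edges between roots). The density of a rooted graph $F$ is $\rho_F = e(F)/(v(F) - |R(F)|)$. $F$ is balanced if $\rho_F > 1$ and for every subset $S \subseteq V(F)\setminus R(F)$ the number of edges of $F$ with at least one endpoint in $S$ is at least $\rho_F |S|$. For a graph $H$, $\operatorname{ex}(n,H)$ is the maximum number of edges in an $n$-vertex graph containing no subgraph isomorphic to $H$. *)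

theory Defs
  imports "HOL-Library.Landau_Symbols"
begin

record 'a graph =
  vertices :: "'a set"
  edges :: "'a set set"

record 'a rooted_graph = "'a graph" +
  roots :: "'a set"

definition simple_graph :: "('a, 'm) graph_scheme \<Rightarrow> bool" where
  "simple_graph G \<longleftrightarrow>
     finite (vertices G) \<and> (\<forall>e\<in>edges G. e \<subseteq> vertices G \<and> card e = 2)"

definition subgraph :: "('a, 'm) graph_scheme \<Rightarrow> ('a, 'n) graph_scheme \<Rightarrow> bool" where
  "subgraph K G \<longleftrightarrow>
     simple_graph K \<and> vertices K \<subseteq> vertices G \<and> edges K \<subseteq> edges G"

definition isomorphic :: "('a, 'm) graph_scheme \<Rightarrow> ('b, 'n) graph_scheme \<Rightarrow> bool" where
  "isomorphic G H \<longleftrightarrow>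
     (\<exists>f. bij_betw f (vertices G) (vertices H) \<and> edges H = (\<lambda>e. f ` e) ` edges G)"

definition contains_copy :: "'a graph \<Rightarrow> 'b graph \<Rightarrow> bool" where
  "contains_copy G H \<longleftrightarrow> (\<exists>K :: 'a graph. subgraph K G \<and> isomorphic K H)"

text \<open>Every finite graph is isomorphic to one whose vertices are natural numbers, so the host
  graphs may be taken over the type \<open>nat\<close>. The maximum is over a nonempty set as soon as \<open>H\<close> has
  an edge (see the lemmas below).\<close>

definition extremal_number :: "nat \<Rightarrow> 'a graph \<Rightarrow> nat" where
  "extremal_number n H = Max {card (edges G) | G :: nat graph.
     simple_graph G \<and> card (vertices G) = n \<and> \<not> contains_copy G H}"

lemma finite_extremal_set:
  "finite {card (edges G) | G :: nat graph.
     simple_graph G \<and> card (vertices G) = n \<and> \<not> contains_copy G H}"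
proof (rule finite_subset)
  show "{card (edges G) | G :: nat graph.
     simple_graph G \<and> card (vertices G) = n \<and> \<not> contains_copy G H} \<subseteq> {..2 ^ n}"
  proof clarsimp
    fix G :: "nat graph"
    assume G: "simple_graph G" "n = card (vertices G)"
    then have "edges G \<subseteq> Pow (vertices G)" "finite (vertices G)"
      by (auto simp: simple_graph_def)
    then show "card (edges G) \<le> 2 ^ card (vertices G)"
      by (metis card_Pow card_mono finite_Pow_iff)
  qed
qed simp

lemma extremal_set_nonempty:
  assumes "edges H \<noteq> {}"
  shows "{card (edges G) | G :: nat graph.
     simple_graph G \<and> card (vertices G) = n \<and> \<not> contains_copy G H} \<noteq> {}"
proof -
  let ?G = "\<lparr>vertices = {..<n}, edges = {}\<rparr> :: nat graph"
  have "simple_graph ?G" "card (vertices ?G) = n" "\<not> contains_copy ?G H"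
    using assms by (auto simp: simple_graph_def contains_copy_def subgraph_def isomorphic_def)
  then show ?thesis by blast
qed

text \<open>In the \<open>p\<close>th power a root \<open>v\<close> becomes the single vertex \<open>Inl v\<close>, while the \<open>i\<close>th copy of a
  non-root \<open>v\<close> is \<open>Inr (v, i)\<close>. As edges are sets of vertices, multiple edges between
  roots are merged.\<close>

definition copy_vertex :: "('a, 'm) rooted_graph_scheme \<Rightarrow> nat \<Rightarrow> 'a \<Rightarrow> 'a + 'a \<times> nat" where
  "copy_vertex F i v = (if v \<in> roots F then Inl v else Inr (v, i))"

definition rooted_power :: "('a, 'm) rooted_graph_scheme \<Rightarrow> nat \<Rightarrow> ('a + 'a \<times> nat) graph" where
  "rooted_power F p =
     \<lparr>vertices = (\<Union>i<p. copy_vertex F i ` vertices F),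
      edges = (\<Union>i<p. (\<lambda>e. copy_vertex F i ` e) ` edges F)\<rparr>"

definition rooted_density :: "('a, 'm) rooted_graph_scheme \<Rightarrow> real" where
  "rooted_density F =
     real (card (edges F)) / (real (card (vertices F)) - real (card (roots F)))"

definition balanced_rooted :: "('a, 'm) rooted_graph_scheme \<Rightarrow> bool" where
  "balanced_rooted F \<longleftrightarrow> rooted_density F > 1 \<and>
     (\<forall>S \<subseteq> vertices F - roots F.
        real (card {e \<in> edges F. e \<inter> S \<noteq> {}}) \<ge> rooted_density F * real (card S))"

text \<open>\<open>Nbr j\<close> is the neighbour \<open>q\<^sub>j\<close> of the centre, \<open>NbrLeaf j i\<close> is the \<open>i\<close>th leaf at
  \<open>q\<^sub>j\<close>, and \<open>CentreLeaf i\<close> is the \<open>i\<close>th leaf at the centre.\<close>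

datatype tree_vertex = Centre | Nbr nat | NbrLeaf nat nat | CentreLeaf nat

definition T_tree :: "nat \<Rightarrow> nat \<Rightarrow> nat \<Rightarrow> tree_vertex rooted_graph" where
  "T_tree s t s' =
     \<lparr>vertices = {Centre} \<union> {Nbr j | j. j \<in> {1..t}}
        \<union> {NbrLeaf j i | j i. j \<in> {1..t} \<and> i \<in> {1..s}} \<union> {CentreLeaf i | i. i \<in> {1..s'}},
      edges = {{Centre, Nbr j} | j. j \<in> {1..t}}
        \<union> {{Nbr j, NbrLeaf j i} | j i. j \<in> {1..t} \<and> i \<in> {1..s}}
        \<union> {{Centre, CentreLeaf i} | i. i \<in> {1..s'}},
      roots = {NbrLeaf j i | j i. j \<in> {1..t} \<and> i \<in> {1..s}} \<union> {CentreLeaf i | i. i \<in> {1..s'}}\<rparr>"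

end

theory Submission
  imports Defs "HOL-Library.FuncSet"
begin

text \<open>A host graph with more than \<open>C n\<^bsup>2-1/\<rho>\<^esup>\<close> edges contains a subgraph on \<open>N\<close> vertices
  with all degrees between \<open>d\<close> and \<open>K d\<close>, where \<open>d\<close> is a large multiple of \<open>N\<^bsup>1-1/\<rho>\<^esup>\<close>. It has so many
  embeddings of the tree \<open>F\<close> that some choice of the roots extends to many embeddings. If no \<open>p\<close> of
  them are disjoint off the roots, many of them share a vertex. Sharing \<open>v\<^sub>0\<close>, or \<open>s + 1\<close> neighbours of
  \<open>v\<^sub>0\<close>, produces stars with \<open>s + 1\<close> leaves whose leaf sets have many common neighbours; if these were
  not rare, the neighbourhood of a single vertex would already contain a copy of \<open>F\<^sup>p\<close>.

  If \<open>s \<le> s' + 1\<close>, the only other possibility is that a single \<open>q\<^sub>j\<close> is shared. Then one keeps the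
  image of \<open>v\<^sub>0\<close>, varies \<open>q\<^sub>j\<close> instead and lets the old \<open>v\<^sub>0\<close> be a leaf of all the new \<open>q\<^sub>j\<close>.

  If \<open>s \<ge> s' + 2\<close>, count pairs \<open>(v, w)\<close> of images of \<open>v\<^sub>0\<close> with common roots. Writing \<open>L\<close> for the number of
  leaf tuples of a \<open>q\<^sub>j\<close> common to \<open>v\<close> and \<open>w\<close>, this is a sum of \<open>L\<^sup>t\<close>, and the number of pairs sharing
  some \<open>q\<^sub>j\<close> is a sum of \<open>L\<^bsup>t-1\<^esup>\<close> times the codegree and \<open>d\<^sup>s\<close>. As the latter must be comparable to the former, the
  codegrees have a large moment of order \<open>t + s'\<close>, which is at least \<open>2 s + 3\<close>, and dependent random
  choice inside the neighbourhood of one vertex finds \<open>F\<^sup>p\<close>.\<close>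

section \<open>Sunflowers of embeddings and counting homomorphisms of trees\<close>

text \<open>From \<open>d >= C * N powr (1 - 1/\<rho>)\<close> one gets
  \<open>C * N^(x-1) <= d^x\<close> as soon as \<open>x <= \<rho>\<close>. Balance supplies this for
  \<open>x = s\<close> and \<open>x = max 1 s'\<close>, the two places where a shared structure must
  be rare. With \<open>b = s*t + t + s'\<close> edges, \<open>b / \<rho> = t + 1\<close> gives
  \<open>d^b >= C * N^(s*t+s'-1)\<close>: on average a placement of the roots extends to a large
  constant number of embeddings, and no power of \<open>N\<close> is guaranteed beyond that. Hence
  every exceptional family must be a small proportion of \<open>N * d^b\<close>, and every fibre
  over the roots must be bounded by a constant. What separates the cases is a shared
  \<open>q_j\<close>. If \<open>s <= s'\<close>, it forms with \<open>s\<close> centre leaves a star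
  with \<open>s + 1\<close> leaves; if \<open>s = s' + 1\<close>, one leaf is missing and can be
  replaced; beyond that too many are missing, and a second moment takes over. The cubic hypothesis
  enters as \<open>t >= 4\<close> and \<open>t + s' >= 2*s + 3\<close>: the first, with
  \<open>N <= d^2\<close>, makes an error term harmless, the second beats the at most
  \<open>(K*d)^(2*s+2)\<close> sets of size \<open>s + 1\<close> within two steps of a
  vertex.\<close>

lemma exists_large_fibre:
  fixes c :: real
  assumes "finite Z" "f ` A \<subseteq> Z" "finite A" "real (card Z) * c < real (card A)"
  shows "\<exists>z\<in>Z. c < real (card {a \<in> A. f a = z})"
proof (rule ccontr)
  assume "\<not> ?thesis"
  then have le: "real (card {a \<in> A. f a = z}) \<le> c" if "z \<in> Z" for z
    using that by force
  have "card A = card (\<Union>z\<in>Z. {a \<in> A. f a = z})"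
    using assms by (intro arg_cong[where f=card]) auto
  also have "\<dots> \<le> (\<Sum>z\<in>Z. card {a \<in> A. f a = z})"
    using assms by (intro card_UN_le)
  finally have "real (card A) \<le> (\<Sum>z\<in>Z. real (card {a \<in> A. f a = z}))"
    using of_nat_mono by fastforce
  also have "\<dots> \<le> real (card Z) * c"
    using sum_bounded_above[of Z "\<lambda>z. real (card {a \<in> A. f a = z})" c] le by simp
  finally show False using assms by simp
qed

lemma card_le_fibres:
  fixes c :: real
  assumes "finite Z" "f ` A \<subseteq> Z" "finite A" "\<And>z. z \<in> Z \<Longrightarrow> real (card {a \<in> A. f a = z}) \<le> c"
  shows "real (card A) \<le> real (card Z) * c"
  using exists_large_fibre[OF assms(1-3), of c] assms(4) by force

text \<open>The maps are extensional, so that each homomorphism is counted once and finite hosts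
  give finite sets. In the hosts below edges have two elements, so adjacent vertices get distinct
  images.\<close>

definition homs :: "'v set \<Rightarrow> 'v set set \<Rightarrow> 'i set \<Rightarrow> 'i set set \<Rightarrow> ('i \<Rightarrow> 'v) set" where
  "homs V E I D = {f \<in> I \<rightarrow>\<^sub>E V. \<forall>e\<in>D. f ` e \<in> E}"

lemma homs_upd:
  assumes "f \<in> homs V E I D" "x \<notin> I" "\<forall>e\<in>D. e \<subseteq> I" "w \<in> V"
  shows "f(x := w) \<in> homs V E (insert x I) D"
proof -
  have eq: "(f(x := w)) ` e = f ` e" if "e \<in> D" for e
    using that assms(2,3) by (intro image_cong) auto
  have "f \<in> I \<rightarrow>\<^sub>E V" "\<forall>e\<in>D. f ` e \<in> E" using assms(1) by (auto simp: homs_def)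
  then show ?thesis
    using eq PiE_fun_upd[of w "\<lambda>_. V" x f I] assms(4) by (simp add: homs_def del: fun_upd_apply)
qed

lemma homs_restrict:
  assumes "f \<in> homs V E I D" "J \<subseteq> I" "D' \<subseteq> D" "\<forall>e\<in>D'. e \<subseteq> J"
  shows "restrict f J \<in> homs V E J D'"
proof -
  have "restrict f J ` e = f ` e" if "e \<in> D'" for e
    using that assms(4) by (intro image_cong) auto
  then show ?thesis using assms by (auto simp: homs_def)
qed

definition emb :: "'v set \<Rightarrow> 'v set set \<Rightarrow> 'i set \<Rightarrow> 'i set set \<Rightarrow> ('i \<Rightarrow> 'v) set" where
  "emb V E I D = {f \<in> homs V E I D. inj_on f I}"

text \<open>The members of \<open>P\<close> together form a \<open>p\<close>th power whose roots are
  placed by \<open>\<xi>\<close>; only the values of \<open>\<xi>\<close> on \<open>R\<close>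
  matter. The kernel \<open>R\<close> is a parameter because it is later enlarged by a non-root
  \<open>Nbr j\<close>.\<close>

definition sunflower_at ::
  "'v set \<Rightarrow> 'v set set \<Rightarrow> 'i set \<Rightarrow> 'i set set \<Rightarrow> 'i set \<Rightarrow> nat \<Rightarrow> ('i \<Rightarrow> 'v) \<Rightarrow> bool" where
  "sunflower_at V E I D R p \<xi> \<longleftrightarrow> (\<exists>P. finite P \<and> card P = p \<and> P \<subseteq> emb V E I D \<and>
     (\<forall>f\<in>P. \<forall>r\<in>R. f r = \<xi> r) \<and>
     (\<forall>f\<in>P. \<forall>g\<in>P. f \<noteq> g \<longrightarrow> f ` (I - R) \<inter> g ` (I - R) = {}))"

text \<open>Greedy: the next embedding avoids the set \<open>W\<close> of non-root images used so
  far. Since \<open>I - R\<close> is nonempty, avoiding \<open>W\<close> also makes it different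
  from its predecessors.\<close>

lemma sunflower_atI:
  assumes "finite I" "I - R \<noteq> {}"
    and avoid: "\<And>W. finite W \<Longrightarrow> card W \<le> p * card (I - R) \<Longrightarrow>
       \<exists>f\<in>emb V E I D. (\<forall>r\<in>R. f r = \<xi> r) \<and> f ` (I - R) \<inter> W = {}"
  shows "sunflower_at V E I D R p \<xi>"
proof -
  have "\<exists>P. finite P \<and> card P = k \<and> P \<subseteq> emb V E I D \<and> (\<forall>f\<in>P. \<forall>r\<in>R. f r = \<xi> r) \<and>
     (\<forall>f\<in>P. \<forall>g\<in>P. f \<noteq> g \<longrightarrow> f ` (I - R) \<inter> g ` (I - R) = {})" if "k \<le> p" for k
    using that
  proof (induction k)
    case (Suc k)
    then obtain P where P: "finite P" "card P = k" "P \<subseteq> emb V E I D" "\<forall>f\<in>P. \<forall>r\<in>R. f r = \<xi> r"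
      "\<forall>f\<in>P. \<forall>g\<in>P. f \<noteq> g \<longrightarrow> f ` (I - R) \<inter> g ` (I - R) = {}" by auto
    define W where "W = (\<Union>f\<in>P. f ` (I - R))"
    have "card W \<le> (\<Sum>f\<in>P. card (f ` (I - R)))"
      unfolding W_def by (intro card_UN_le P)
    also have "\<dots> \<le> card P * card (I - R)"
      using sum_bounded_above[of P "\<lambda>f. card (f ` (I - R))" "card (I - R)"] assms(1)
      by (simp add: card_image_le)
    also have "\<dots> \<le> p * card (I - R)" using P(2) Suc.prems by simp
    finally have "card W \<le> p * card (I - R)" .
    moreover have "finite W" using P(1) assms(1) by (auto simp: W_def)
    ultimately obtain f where f: "f \<in> emb V E I D" "\<forall>r\<in>R. f r = \<xi> r" "f ` (I - R) \<inter> W = {}"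
      using avoid by blast
    have dis: "f ` (I - R) \<inter> g ` (I - R) = {}" if "g \<in> P" for g
      using f(3) that unfolding W_def by blast
    then have "f \<notin> P" using assms(2) by blast
    with P f dis show ?case
      by (intro exI[of _ "insert f P"]) (auto simp: Int_commute)
  qed auto
  from this[OF order_refl] obtain P where P: "finite P" "card P = p" "P \<subseteq> emb V E I D"
      "\<forall>f\<in>P. \<forall>r\<in>R. f r = \<xi> r"
      "\<forall>f\<in>P. \<forall>g\<in>P. f \<noteq> g \<longrightarrow> f ` (I - R) \<inter> g ` (I - R) = {}"
    by (elim exE conjE)
  then show ?thesis unfolding sunflower_at_def by (intro exI[of _ P] conjI)
qed

text \<open>Contrapositive of the greedy construction: without a sunflower, a set of bounded size
  meets all embeddings over \<open>\<xi>\<close>.\<close>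

lemma cover_if_no_sunflower:
  assumes "finite I" "I - R \<noteq> {}" "\<not> sunflower_at V E I D R p \<xi>"
  obtains W where "finite W" "card W \<le> p * card (I - R)"
    "\<And>f. f \<in> emb V E I D \<Longrightarrow> (\<And>r. r \<in> R \<Longrightarrow> f r = \<xi> r) \<Longrightarrow> f ` (I - R) \<inter> W \<noteq> {}"
proof -
  have "\<exists>W. finite W \<and> card W \<le> p * card (I - R) \<and>
    (\<forall>f\<in>emb V E I D. (\<forall>r\<in>R. f r = \<xi> r) \<longrightarrow> f ` (I - R) \<inter> W \<noteq> {})"
  proof (rule ccontr)
    assume *: "\<not> ?thesis"
    have "sunflower_at V E I D R p \<xi>"
    proof (rule sunflower_atI[OF assms(1,2)])
      fix W :: "'b set" assume "finite W" "card W \<le> p * card (I - R)"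
      with * show "\<exists>f\<in>emb V E I D. (\<forall>r\<in>R. f r = \<xi> r) \<and> f ` (I - R) \<inter> W = {}"
        by simp
    qed
    with assms(3) show False ..
  qed
  then show thesis using that by (elim exE conjE) simp
qed

lemma contains_copyI:
  fixes G :: "'a graph" and H :: "'b graph"
  assumes "simple_graph G" "finite (vertices H)" "inj_on f (vertices H)"
    "f ` vertices H \<subseteq> vertices G" "\<And>e. e \<in> edges H \<Longrightarrow> e \<subseteq> vertices H"
    "\<And>e. e \<in> edges H \<Longrightarrow> f ` e \<in> edges G"
  shows "contains_copy G H"
proof -
  let ?K = "\<lparr>vertices = f ` vertices H, edges = (\<lambda>e. f ` e) ` edges H\<rparr> :: 'a graph"
  let ?g = "inv_into (vertices H) f"
  have "simple_graph ?K"
    unfolding simple_graph_def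
  proof (intro conjI ballI)
    show "finite (vertices ?K)" using assms(2) by simp
    fix e assume "e \<in> edges ?K"
    then obtain e' where e': "e' \<in> edges H" "e = f ` e'" by auto
    show "e \<subseteq> vertices ?K" using assms(5)[OF e'(1)] e'(2) by auto
    show "card e = 2"
      using assms(6)[OF e'(1)] assms(1) e'(2) by (simp add: simple_graph_def)
  qed
  then have "subgraph ?K G"
    using assms(4,6) unfolding subgraph_def by auto
  moreover have "isomorphic ?K H"
    unfolding isomorphic_def
  proof (intro exI conjI)
    show "bij_betw ?g (vertices ?K) (vertices H)"
      using assms(3) by (simp add: bij_betw_inv_into inj_on_imp_bij_betw)
    have "?g ` f ` e = e" if "e \<in> edges H" for e
      using assms(3,5) that inv_into_image_cancel by metis
    then show "edges H = (\<lambda>e. ?g ` e) ` edges ?K"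
      by (simp add: image_image cong: image_cong)
  qed
  ultimately show ?thesis unfolding contains_copy_def by blast
qed

lemma contains_rooted_power_if_sunflower:
  fixes F :: "('i, 'm) rooted_graph_scheme" and G :: "'v graph"
  assumes "simple_graph G" "simple_graph F" "roots F \<subseteq> vertices F" "p \<ge> 1"
    and "sunflower_at (vertices G) (edges G) (vertices F) (edges F) (roots F) p \<xi>"
  shows "contains_copy G (rooted_power F p)"
proof -
  let ?I = "vertices F" let ?R = "roots F"
  obtain P where P: "finite P" "card P = p" "P \<subseteq> emb (vertices G) (edges G) ?I (edges F)"
     "\<forall>f\<in>P. \<forall>r\<in>?R. f r = \<xi> r"
     "\<forall>f\<in>P. \<forall>g\<in>P. f \<noteq> g \<longrightarrow> f ` (?I - ?R) \<inter> g ` (?I - ?R) = {}"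
    using assms(5) unfolding sunflower_at_def by (elim exE conjE)
  have agree: "\<forall>f\<in>P. \<forall>g\<in>P. \<forall>r\<in>?R. f r = g r" using P(4) by metis
  obtain h where h: "bij_betw h {0..<p} P"
    using ex_bij_betw_nat_finite[OF P(1)] P(2) by auto
  have hP: "h i \<in> P" if "i < p" for i
    using h that by (auto simp: bij_betw_def)
  have hinj: "inj_on (h i) ?I" and hhom: "h i \<in> ?I \<rightarrow>\<^sub>E vertices G"
    "\<And>e. e \<in> edges F \<Longrightarrow> h i ` e \<in> edges G" if "i < p" for i
    using hP[OF that] P(3) by (auto simp: emb_def homs_def)
  have dis: "h i ` (?I - ?R) \<inter> h j ` (?I - ?R) = {}" if "i < p" "j < p" "i \<noteq> j" for i j
  proof -
    have "h i \<noteq> h j" using h that by (auto simp: bij_betw_def inj_on_def)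
    then show ?thesis using P(5) hP that by blast
  qed
  \<comment> \<open>All members of \<open>P\<close> agree on the roots, so copy 0 may place them; it
    exists because \<open>p >= 1\<close>.\<close>
  define f where "f = (\<lambda>x. case x of Inl r \<Rightarrow> h 0 r | Inr (v, i) \<Rightarrow> h i v)"
  have f_copy: "f (copy_vertex F i v) = h i v" if "i < p" for i v
    using agree hP assms(4) that by (auto simp: f_def copy_vertex_def)
  show ?thesis
  proof (rule contains_copyI[where f = f])
    show "simple_graph G" by fact
    show "finite (vertices (rooted_power F p))"
      using assms(2) unfolding rooted_power_def simple_graph_def by simp
    show "inj_on f (vertices (rooted_power F p))"
    proof (rule inj_onI)
      fix x y assume "x \<in> vertices (rooted_power F p)" "y \<in> vertices (rooted_power F p)" "f x = f y"
      then obtain i v j w where ij: "i < p" "v \<in> ?I" "x = copy_vertex F i v" "j < p" "w \<in> ?I"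
        "y = copy_vertex F j w" "h i v = h j w" by (auto simp: rooted_power_def f_copy)
      show "x = y"
      proof (cases "v \<in> ?R")
        case True
        then have "h j v = h j w" using agree hP ij by metis
        then have "v = w" using hinj[OF ij(4)] ij by (auto simp: inj_on_def)
        then show ?thesis using True ij by (simp add: copy_vertex_def)
      next
        case vR: False
        show ?thesis
        proof (cases "w \<in> ?R")
          case True
          then have "h i v = h i w" using agree hP ij by metis
          then have "v = w" using hinj[OF ij(1)] ij by (auto simp: inj_on_def)
          then show ?thesis using True vR by simp
        next
          case False
          have "h i v \<in> h i ` (?I - ?R)" using ij(2) vR by simp
          moreover have "h i v \<in> h j ` (?I - ?R)" using ij(5,7) False by simp
          ultimately have "i = j"
            using dis[OF ij(1,4)] by blast
          then have "v = w" using ij hinj[OF ij(1)] by (auto simp: inj_on_def)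
          then show ?thesis using \<open>i = j\<close> ij by simp
        qed
      qed
    qed
    show "f ` vertices (rooted_power F p) \<subseteq> vertices G"
    proof
      fix y assume "y \<in> f ` vertices (rooted_power F p)"
      then obtain i v where iv: "i < p" "v \<in> ?I" "y = h i v"
        by (auto simp: rooted_power_def f_copy)
      show "y \<in> vertices G" using PiE_mem[OF hhom(1)[OF iv(1)] iv(2)] iv(3) by simp
    qed
    show "e \<subseteq> vertices (rooted_power F p)" if e: "e \<in> edges (rooted_power F p)" for e
    proof -
      obtain i e' where "i < p" "e' \<in> edges F" "e = copy_vertex F i ` e'"
        using e unfolding rooted_power_def by auto
      then show ?thesis using assms(2) unfolding rooted_power_def simple_graph_def by auto
    qed
    show "f ` e \<in> edges G" if e: "e \<in> edges (rooted_power F p)" for e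
    proof -
      obtain i e' where "i < p" "e' \<in> edges F" "e = copy_vertex F i ` e'"
        using e unfolding rooted_power_def by auto
      moreover from this have "f ` e = h i ` e'"
        by (simp add: image_image f_copy)
      ultimately show ?thesis using hhom(2) by simp
    qed
  qed
qed

section \<open>Neighbourhoods and counts of homomorphisms of forests\<close>

definition nb :: "'v set set \<Rightarrow> 'v \<Rightarrow> 'v set" where
  "nb E x = {y. {x, y} \<in> E}"

text \<open>For \<open>Z = {}\<close> this is the whole type, hence the premises
  \<open>Z \<noteq> {}\<close> in the finiteness lemmas.\<close>

definition common_nb :: "'v set set \<Rightarrow> 'v set \<Rightarrow> 'v set" where
  "common_nb E Z = {y. \<forall>z\<in>Z. {z, y} \<in> E}"

lemma nb_sym: "y \<in> nb E x \<longleftrightarrow> x \<in> nb E y"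
  by (simp add: nb_def insert_commute)

lemma common_nb_iff: "y \<in> common_nb E Z \<longleftrightarrow> Z \<subseteq> nb E y"
  by (auto simp: common_nb_def nb_def insert_commute)

text \<open>\<open>a\<close> counts added isolated vertices and \<open>b\<close> added pendant
  edges. In an almost regular host the former multiply the number of homomorphisms by
  \<open>N\<close>, the latter by a factor between \<open>d\<close> and \<open>K * d\<close>.
  Starting from an arbitrary \<open>(I0, D0)\<close> makes it possible to count extensions of a
  prescribed family.\<close>

inductive build :: "'i set \<Rightarrow> 'i set set \<Rightarrow> 'i set \<Rightarrow> 'i set set \<Rightarrow> nat \<Rightarrow> nat \<Rightarrow> bool"
  for I0 D0 where
  start: "build I0 D0 I0 D0 0 0"
| free: "build I0 D0 I D a b \<Longrightarrow> x \<notin> I \<Longrightarrow> build I0 D0 (insert x I) D (Suc a) b"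
| leaf: "build I0 D0 I D a b \<Longrightarrow> x \<notin> I \<Longrightarrow> y \<in> I \<Longrightarrow>
    build I0 D0 (insert x I) (insert {x, y} D) a (Suc b)"

lemma build_free_set:
  assumes "build I0 D0 I D a b" "finite X" "X \<inter> I = {}"
  shows "build I0 D0 (X \<union> I) D (card X + a) b"
  using assms(2,3,1) by (induction X) (auto intro: build.free)

lemma build_leaf_set:
  assumes "build I0 D0 I D a b" "finite X" "X \<inter> I = {}" "att ` X \<subseteq> I"
  shows "build I0 D0 (X \<union> I) ((\<lambda>x. {x, att x}) ` X \<union> D) a (card X + b)"
  using assms(2,3,4,1) by (induction X) (auto intro: build.leaf)

lemma build_invariants:
  assumes "build I0 D0 I D a b"
  shows "I0 \<subseteq> I" "D0 \<subseteq> D" "finite I0 \<Longrightarrow> finite I" "(\<forall>e\<in>D0. e \<subseteq> I0) \<Longrightarrow> (\<forall>e\<in>D. e \<subseteq> I)"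
  using assms by (induction) auto

lemma fun_upd_eq_iff:
  assumes "f x = c" "g x = c"
  shows "f(x := a) = g(x := b) \<longleftrightarrow> f = g \<and> a = b"
proof
  assume *: "f(x := a) = g(x := b)"
  have "f y = g y" for y
    using fun_cong[OF *, of y] assms by (cases "y = x") auto
  moreover have "a = b" using fun_cong[OF *, of x] by simp
  ultimately show "f = g \<and> a = b" by auto
qed simp

text \<open>If every \<open>S f\<close> met \<open>Z\<close>, disjointness would give each
  \<open>f\<close> its own element of \<open>Z\<close>.\<close>

lemma disjoint_family_avoids:
  assumes "finite Z" "card Z < card P" "\<And>f g. f \<in> P \<Longrightarrow> g \<in> P \<Longrightarrow> f \<noteq> g \<Longrightarrow> S f \<inter> S g = {}"
  shows "\<exists>f\<in>P. S f \<inter> Z = {}"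
proof (rule ccontr)
  assume "\<not> ?thesis"
  then have "\<forall>f\<in>P. \<exists>z. z \<in> S f \<inter> Z" by blast
  then obtain z where z: "\<And>f. f \<in> P \<Longrightarrow> z f \<in> S f \<inter> Z" by metis
  have "inj_on z P"
  proof (rule inj_onI, rule ccontr)
    fix f g assume fg: "f \<in> P" "g \<in> P" "z f = z g" "f \<noteq> g"
    then have "z f \<in> S f \<inter> S g" using z[of f] z[of g] by simp
    then show False using assms(3)[OF fg(1,2,4)] by simp
  qed
  then have "card P \<le> card Z" using z assms(1) by (intro card_inj_on_le[of z]) auto
  then show False using assms(2) by simp
qed

locale almost_regular =
  fixes V :: "'v set" and E :: "'v set set" and K d :: real
  assumes finite_V: "finite V" and V_nonempty: "V \<noteq> {}"
    and edges_V: "\<And>e. e \<in> E \<Longrightarrow> e \<subseteq> V \<and> card e = 2"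
    and K_ge_1: "K \<ge> 1" and d_ge_1: "d \<ge> 1"
    and min_deg: "\<And>x. x \<in> V \<Longrightarrow> d \<le> real (card (nb E x))"
    and max_deg: "\<And>x. x \<in> V \<Longrightarrow> real (card (nb E x)) \<le> K * d"
begin

abbreviation N :: real where "N \<equiv> real (card V)"
abbreviation hom where "hom I D \<equiv> homs V E I D"

lemma nb_V: "y \<in> nb E x \<Longrightarrow> y \<in> V \<and> x \<in> V \<and> y \<noteq> x"
  using edges_V by (force simp: nb_def)

lemma nb_subset: "nb E x \<subseteq> V" using nb_V by blast

lemma finite_nb: "finite (nb E x)"
  using nb_subset finite_V finite_subset by blast

lemma common_nb_V: "Z \<noteq> {} \<Longrightarrow> common_nb E Z \<subseteq> V"
  using nb_V by (fastforce simp: common_nb_def nb_def)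

lemma finite_common_nb: "Z \<noteq> {} \<Longrightarrow> finite (common_nb E Z)"
  using common_nb_V finite_V finite_subset by metis

lemma d_le_N: "d \<le> N"
proof -
  obtain x where "x \<in> V" using V_nonempty by blast
  then have "d \<le> real (card (nb E x))" by (rule min_deg)
  also have "\<dots> \<le> N" using nb_subset finite_V by (simp add: card_mono)
  finally show ?thesis .
qed

lemma N_ge_1: "1 \<le> N" using d_le_N d_ge_1 by linarith

lemma Kd_ge_1: "1 \<le> K * d"
  using K_ge_1 d_ge_1 by (metis mult_mono' mult_1 zero_le_one)

lemma finite_hom: "finite I \<Longrightarrow> finite (hom I D)"
  using finite_PiE[of I "\<lambda>_. V"] finite_V unfolding homs_def by (rule_tac finite_subset[of _ "I \<rightarrow>\<^sub>E V"]) auto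

text \<open>The filter on \<open>restrict f I0\<close> is carried along so that the recursion counts
  the extensions of any set \<open>B\<close> of partial homomorphisms.\<close>

lemma card_hom_free:
  assumes "finite I" "x \<notin> I" "I0 \<subseteq> I" "\<forall>e\<in>D. e \<subseteq> I"
  shows "card {f \<in> hom (insert x I) D. restrict f I0 \<in> B}
       = card {f \<in> hom I D. restrict f I0 \<in> B} * card V"
proof -
  let ?H = "{f \<in> hom I D. restrict f I0 \<in> B}"
  have res: "restrict (f(x := w)) I0 = restrict f I0" for f :: "_ \<Rightarrow> 'v" and w
    using assms(2,3) by (auto simp: restrict_def fun_eq_iff)
  have "bij_betw (\<lambda>(f, w). f(x := w)) (?H \<times> V) {f \<in> hom (insert x I) D. restrict f I0 \<in> B}"
  proof (rule bij_betwI')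
    show "((case a of (f, w) \<Rightarrow> f(x := w)) = (case b of (f, w) \<Rightarrow> f(x := w))) = (a = b)"
      if "a \<in> ?H \<times> V" "b \<in> ?H \<times> V" for a b
    proof -
      obtain f w g z where ab: "a = (f, w)" "b = (g, z)" by fastforce
      have "f x = undefined" "g x = undefined"
        using that assms(2) by (auto simp: ab homs_def PiE_def extensional_def)
      then show ?thesis
        unfolding ab prod.case by (simp add: fun_upd_eq_iff)
    qed
    show "(case a of (f, w) \<Rightarrow> f(x := w)) \<in> {f \<in> hom (insert x I) D. restrict f I0 \<in> B}"
      if "a \<in> ?H \<times> V" for a
      using that homs_upd[OF _ assms(2,4)] by (auto simp: res)
    show "\<exists>a\<in>?H \<times> V. g = (case a of (f, w) \<Rightarrow> f(x := w))"
      if "g \<in> {f \<in> hom (insert x I) D. restrict f I0 \<in> B}" for g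
    proof -
      have "restrict g I \<in> hom I D"
        using that assms(4) by (intro homs_restrict[of g V E "insert x I" D]) auto
      moreover have "g \<in> insert x I \<rightarrow>\<^sub>E V" using that by (simp add: homs_def)
      then have "g = (restrict g I)(x := g x)" "g x \<in> V"
        by (auto simp: fun_eq_iff PiE_def extensional_def)
      moreover have "restrict (restrict g I) I0 = restrict g I0"
        using assms(3) by (auto simp: fun_eq_iff)
      moreover have "restrict g I0 \<in> B" using that by simp
      ultimately show ?thesis
        by (intro bexI[of _ "(restrict g I, g x)"]) (simp_all del: restrict_apply)
    qed
  qed
  from bij_betw_same_card[OF this] show ?thesis by (simp only: card_cartesian_product)
qed

lemma card_hom_leaf:
  assumes "finite I" "x \<notin> I" "y \<in> I" "I0 \<subseteq> I" "\<forall>e\<in>D. e \<subseteq> I"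
  shows "card {f \<in> hom (insert x I) (insert {x, y} D). restrict f I0 \<in> B}
       = (\<Sum>f \<in> {f \<in> hom I D. restrict f I0 \<in> B}. card (nb E (f y)))"
proof -
  let ?H = "{f \<in> hom I D. restrict f I0 \<in> B}"
  let ?S = "Sigma ?H (\<lambda>f. nb E (f y))"
  have xy: "x \<noteq> y" using assms by auto
  have res: "restrict (f(x := w)) I0 = restrict f I0" for f :: "_ \<Rightarrow> 'v" and w
    using assms(2,4) by (auto simp: restrict_def fun_eq_iff)
  have "bij_betw (\<lambda>(f, w). f(x := w)) ?S
     {f \<in> hom (insert x I) (insert {x, y} D). restrict f I0 \<in> B}"
  proof (rule bij_betwI')
    show "((case a of (f, w) \<Rightarrow> f(x := w)) = (case b of (f, w) \<Rightarrow> f(x := w))) = (a = b)"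
      if "a \<in> ?S" "b \<in> ?S" for a b
    proof -
      obtain f w g z where ab: "a = (f, w)" "b = (g, z)" by fastforce
      have "f x = undefined" "g x = undefined"
        using that assms(2) by (auto simp: ab homs_def PiE_def extensional_def)
      then show ?thesis
        unfolding ab prod.case by (simp add: fun_upd_eq_iff)
    qed
    show "(case a of (f, w) \<Rightarrow> f(x := w)) \<in>
        {f \<in> hom (insert x I) (insert {x, y} D). restrict f I0 \<in> B}"
      if aS: "a \<in> ?S" for a
    proof -
      obtain f w where a: "a = (f, w)" "f \<in> hom I D" "restrict f I0 \<in> B" "w \<in> nb E (f y)"
        using aS by auto
      have "f(x := w) \<in> hom (insert x I) D"
        using homs_upd[OF a(2) assms(2,5)] nb_V[OF a(4)] by simp
      then show ?thesis
        using a res xy by (auto simp: homs_def nb_def insert_commute)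
    qed
    show "\<exists>a\<in>?S. g = (case a of (f, w) \<Rightarrow> f(x := w))"
      if "g \<in> {f \<in> hom (insert x I) (insert {x, y} D). restrict f I0 \<in> B}" for g
    proof -
      have "restrict g I \<in> hom I D"
        using that assms(5) by (intro homs_restrict[of g V E "insert x I" "insert {x, y} D"]) auto
      moreover have "g \<in> insert x I \<rightarrow>\<^sub>E V" "{g x, g y} \<in> E" using that by (auto simp: homs_def)
      then have "g = (restrict g I)(x := g x)" "g x \<in> nb E (restrict g I y)"
        using assms(3) by (auto simp: fun_eq_iff PiE_def extensional_def nb_def insert_commute)
      moreover have "restrict (restrict g I) I0 = restrict g I0"
        using assms(4) by (auto simp: fun_eq_iff)
      moreover have "restrict g I0 \<in> B" using that by simp
      ultimately show ?thesis
        by (intro bexI[of _ "(restrict g I, g x)"]) (simp_all del: restrict_apply)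
    qed
  qed
  from bij_betw_same_card[OF this]
  have "card {f \<in> hom (insert x I) (insert {x, y} D). restrict f I0 \<in> B} = card ?S" ..
  also have "\<dots> = (\<Sum>f \<in> ?H. card (nb E (f y)))"
    using finite_hom[OF assms(1)] finite_nb by (intro card_SigmaI) auto
  finally show ?thesis .
qed

lemma card_hom_build:
  assumes "build I0 D0 I D a b" "finite I0" "\<forall>e\<in>D0. e \<subseteq> I0" "B \<subseteq> hom I0 D0"
  shows "card B * N ^ a * d ^ b \<le> card {f \<in> hom I D. restrict f I0 \<in> B} \<and>
     card {f \<in> hom I D. restrict f I0 \<in> B} \<le> card B * N ^ a * (K * d) ^ b"
  using assms
proof (induction rule: build.induct)
  case start
  have "{f \<in> hom I0 D0. restrict f I0 \<in> B} = B"
    using start by (force simp: homs_def)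
  then show ?case by (simp del: restrict_apply)
next
  case (free I D a b x)
  have "finite I" "I0 \<subseteq> I" "\<forall>e\<in>D. e \<subseteq> I"
    using build_invariants[OF free.hyps(1)] free.prems by auto
  note eq = card_hom_free[OF this(1) free.hyps(2) this(2,3), of B]
  let ?c = "real (card {f \<in> hom I D. restrict f I0 \<in> B})"
  have "card B * N ^ Suc a * d ^ b = (card B * N ^ a * d ^ b) * N"
       "card B * N ^ Suc a * (K * d) ^ b = (card B * N ^ a * (K * d) ^ b) * N"
    by (simp_all add: mult_ac)
  moreover have "(card B * N ^ a * d ^ b) * N \<le> ?c * N" "?c * N \<le> (card B * N ^ a * (K * d) ^ b) * N"
    using free by (intro mult_right_mono; simp del: restrict_apply)+
  ultimately show ?case unfolding eq of_nat_mult by linarith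
next
  case (leaf I D a b x y)
  let ?H = "{f \<in> hom I D. restrict f I0 \<in> B}"
  have inv: "finite I" "I0 \<subseteq> I" "\<forall>e\<in>D. e \<subseteq> I"
    using build_invariants[OF leaf.hyps(1)] leaf.prems by auto
  have IH: "card B * N ^ a * d ^ b \<le> card ?H" "card ?H \<le> card B * N ^ a * (K * d) ^ b"
    using leaf.IH[OF leaf.prems] by (simp_all only:)
  have deg: "d \<le> card (nb E (f y)) \<and> card (nb E (f y)) \<le> K * d" if "f \<in> ?H" for f
    using that leaf.hyps min_deg max_deg by (auto simp: homs_def)
  have eq: "real (card {f \<in> hom (insert x I) (insert {x, y} D). restrict f I0 \<in> B})
      = (\<Sum>f \<in> ?H. real (card (nb E (f y))))"
    using card_hom_leaf[OF inv(1) leaf.hyps(2,3) inv(2,3), of B] by simp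
  have "real (card B) * N ^ a * d ^ Suc b = (real (card B) * N ^ a * d ^ b) * d" by simp
  also have "\<dots> \<le> real (card ?H) * d"
    using IH(1) d_ge_1 by (intro mult_right_mono) simp_all
  also have "\<dots> \<le> (\<Sum>f \<in> ?H. real (card (nb E (f y))))"
    using sum_bounded_below[of ?H d "\<lambda>f. real (card (nb E (f y)))"] deg by (simp add: mult.commute)
  finally have lo: "real (card B) * N ^ a * d ^ Suc b \<le> (\<Sum>f \<in> ?H. real (card (nb E (f y))))" .
  have "(\<Sum>f \<in> ?H. real (card (nb E (f y)))) \<le> real (card ?H) * (K * d)"
    using sum_bounded_above[of ?H "\<lambda>f. real (card (nb E (f y)))" "K * d"] deg by simp
  also have "\<dots> \<le> (real (card B) * N ^ a * (K * d) ^ b) * (K * d)"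
    using IH(2) Kd_ge_1 by (intro mult_right_mono) simp_all
  finally have "(\<Sum>f \<in> ?H. real (card (nb E (f y)))) \<le> card B * N ^ a * (K * d) ^ Suc b"
    by (simp add: mult_ac)
  then show ?case using lo unfolding eq by blast
qed

lemma card_hom_tree:
  assumes "build {} {} I D a b"
  shows "N ^ a * d ^ b \<le> card (hom I D)" "card (hom I D) \<le> N ^ a * (K * d) ^ b"
proof -
  have *: "hom {} {} = {\<lambda>_. undefined}" by (auto simp: homs_def)
  show "N ^ a * d ^ b \<le> card (hom I D)" "card (hom I D) \<le> N ^ a * (K * d) ^ b"
    using card_hom_build[OF assms, of "hom {} {}"] unfolding * by (auto simp: restrict_def)
qed

text \<open>Whichever of \<open>i\<close>, \<open>j\<close> is added later has its image forced by
  the other, so its factor \<open>N\<close> or \<open>K * d\<close> is lost from the upper bound;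
  both are at least \<open>d\<close>.\<close>

lemma card_hom_eq_pair:
  assumes "build {} {} I D a b" "i \<in> I" "j \<in> I" "i \<noteq> j"
  shows "card {f \<in> hom I D. f i = f j} * d \<le> N ^ a * (K * d) ^ b"
proof -
  \<comment> \<open>Forgetting \<open>x\<close> is injective here, as \<open>f x\<close> is
    recovered from \<open>f u = f v\<close>.\<close>
  have inj: "card {f \<in> hom (insert x I) D'. f u = f v} \<le> card (hom I D)"
    if "x \<notin> I" "finite I" "D \<subseteq> D'" "\<forall>e\<in>D. e \<subseteq> I" "u = x \<and> v \<in> I \<or> v = x \<and> u \<in> I"
    for x I D D' and u v :: 'i
  proof (rule card_inj_on_le)
    let ?A = "{f \<in> hom (insert x I) D'. f u = f v}"
    show "inj_on (\<lambda>f. restrict f I) ?A"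
    proof (rule inj_onI)
      fix f g assume fg: "f \<in> ?A" "g \<in> ?A" "restrict f I = restrict g I"
      have eq: "f y = g y" if "y \<in> I" for y using fun_cong[OF fg(3), of y] that by simp
      show "f = g"
      proof (rule PiE_ext)
        show "f \<in> insert x I \<rightarrow>\<^sub>E V" "g \<in> insert x I \<rightarrow>\<^sub>E V" using fg by (auto simp: homs_def)
        fix y assume "y \<in> insert x I"
        then show "f y = g y" using that(5) eq fg(1,2) by auto
      qed
    qed
    show "(\<lambda>f. restrict f I) ` ?A \<subseteq> hom I D"
    proof
      fix g assume "g \<in> (\<lambda>f. restrict f I) ` ?A"
      then obtain f where f: "f \<in> hom (insert x I) D'" "g = restrict f I" by auto
      have "g ` e = f ` e" if "e \<in> D" for e
        using that \<open>\<forall>e\<in>D. e \<subseteq> I\<close> f(2) by (intro image_cong) auto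
      then show "g \<in> hom I D" using f \<open>D \<subseteq> D'\<close> by (auto simp: homs_def)
    qed
    show "finite (hom I D)" using that finite_hom by blast
  qed
  show ?thesis
    using assms
  proof (induction rule: build.induct)
    case (free I D a b x)
    have inv: "finite I" "\<forall>e\<in>D. e \<subseteq> I" using build_invariants[OF free.hyps(1)] by auto
    let ?A = "{f \<in> hom (insert x I) D. f i = f j}"
    show ?case
    proof (cases "i = x \<or> j = x")
      case True
      then have "card ?A \<le> card (hom I D)"
        using free inv by (intro inj) auto
      then have "card ?A * d \<le> (N ^ a * (K * d) ^ b) * N"
        using card_hom_tree(2)[OF free.hyps(1)] d_le_N d_ge_1 by (intro mult_mono) auto
      then show ?thesis by (simp add: mult_ac)
    next
      case False
      have "?A = {f \<in> hom (insert x I) D. restrict f {i, j} \<in> {g. g i = g j}}" by auto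
      also have "card \<dots> = card {f \<in> hom I D. restrict f {i, j} \<in> {g. g i = g j}} * card V"
        using free False inv by (intro card_hom_free) auto
      also have "{f \<in> hom I D. restrict f {i, j} \<in> {g. g i = g j}} = {f \<in> hom I D. f i = f j}" by auto
      finally have "card ?A * d = (card {f \<in> hom I D. f i = f j} * d) * N" by simp
      also have "\<dots> \<le> (N ^ a * (K * d) ^ b) * N"
        using free False by (intro mult_right_mono) auto
      finally show ?thesis by (simp add: mult_ac)
    qed
  next
    case (leaf I D a b x y)
    have inv: "finite I" "\<forall>e\<in>D. e \<subseteq> I" using build_invariants[OF leaf.hyps(1)] by auto
    let ?A = "{f \<in> hom (insert x I) (insert {x, y} D). f i = f j}"
    show ?case
    proof (cases "i = x \<or> j = x")
      case True
      then have "card ?A \<le> card (hom I D)"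
        using leaf inv by (intro inj) auto
      then have "card ?A * d \<le> (N ^ a * (K * d) ^ b) * (K * d)"
        using card_hom_tree(2)[OF leaf.hyps(1)] d_ge_1 K_ge_1 by (intro mult_mono) auto
      then show ?thesis by (simp add: mult_ac)
    next
      case False
      let ?H = "{f \<in> hom I D. restrict f {i, j} \<in> {g. g i = g j}}"
      have eq: "?H = {f \<in> hom I D. f i = f j}" by auto
      have "?A = {f \<in> hom (insert x I) (insert {x, y} D). restrict f {i, j} \<in> {g. g i = g j}}" by auto
      also have "card \<dots> = (\<Sum>f \<in> ?H. card (nb E (f y)))"
        using leaf False inv by (intro card_hom_leaf) auto
      finally have "real (card ?A) = (\<Sum>f \<in> ?H. real (card (nb E (f y))))" by simp
      also have "\<dots> \<le> card ?H * (K * d)"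
        using sum_bounded_above[of ?H "\<lambda>f. real (card (nb E (f y)))" "K * d"] max_deg leaf.hyps(3)
        by (auto simp: homs_def)
      finally have "card ?A * d \<le> (card ?H * d) * (K * d)"
        using d_ge_1 by (simp add: mult_right_mono mult_ac)
      also have "\<dots> \<le> (N ^ a * (K * d) ^ b) * (K * d)"
        using leaf False Kd_ge_1 unfolding eq by (intro mult_right_mono) auto
      finally show ?thesis by (simp add: mult_ac)
    qed
  qed simp
qed

text \<open>Summing over the pairs \<open>i\<close>, \<open>j\<close> shows that the non-injective
  maps are a proportion of order \<open>1 / d\<close>.\<close>

lemma card_hom_noninj:
  assumes "build {} {} I D a b"
  shows "card {f \<in> hom I D. \<not> inj_on f I} * d \<le> (card I)^2 * (N ^ a * (K * d) ^ b)"
proof -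
  have fin: "finite I" using build_invariants(3)[OF assms] by simp
  let ?P = "{(i, j) \<in> I \<times> I. i \<noteq> j}"
  have finP: "finite ?P" using fin by (auto intro: finite_subset[of _ "I \<times> I"])
  have "{f \<in> hom I D. \<not> inj_on f I} = (\<Union>(i, j)\<in>?P. {f \<in> hom I D. f i = f j})"
    by (auto simp: inj_on_def)
  then have "card {f \<in> hom I D. \<not> inj_on f I} \<le> (\<Sum>(i, j)\<in>?P. card {f \<in> hom I D. f i = f j})"
    using card_UN_le[OF finP, of "\<lambda>(i, j). {f \<in> hom I D. f i = f j}"] by (simp add: case_prod_unfold)
  then have "real (card {f \<in> hom I D. \<not> inj_on f I})
     \<le> (\<Sum>(i, j)\<in>?P. real (card {f \<in> hom I D. f i = f j}))"
    by (simp add: case_prod_unfold flip: of_nat_sum)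
  then have "card {f \<in> hom I D. \<not> inj_on f I} * d
     \<le> (\<Sum>(i, j)\<in>?P. card {f \<in> hom I D. f i = f j}) * d"
    using d_ge_1 by (intro mult_right_mono) (auto simp: case_prod_unfold)
  also have "\<dots> = (\<Sum>(i, j)\<in>?P. card {f \<in> hom I D. f i = f j} * d)"
    by (simp add: case_prod_unfold sum_distrib_right)
  also have "\<dots> \<le> (\<Sum>(i, j)\<in>?P. N ^ a * (K * d) ^ b)"
    using card_hom_eq_pair[OF assms] by (intro sum_mono) auto
  also have "\<dots> = card ?P * (N ^ a * (K * d) ^ b)" by (simp add: case_prod_unfold)
  also have "\<dots> \<le> (card I)^2 * (N ^ a * (K * d) ^ b)"
  proof (rule mult_right_mono)
    have "card ?P \<le> card (I \<times> I)" using fin by (intro card_mono) auto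
    then show "real (card ?P) \<le> real ((card I)^2)"
      by (simp add: card_cartesian_product power2_eq_square flip: of_nat_mult)
  qed (use Kd_ge_1 in auto)
  finally show ?thesis by simp
qed

end

section \<open>The tree and its ample stars\<close>

text \<open>The parent map of the tree hung from \<open>Centre\<close>. Its value at
  \<open>Centre\<close> is a convention, and \<open>att_edges\<close> leaves this vertex
  out.\<close>

primrec att :: "tree_vertex \<Rightarrow> tree_vertex" where
  "att Centre = Centre"
| "att (Nbr j) = Centre"
| "att (NbrLeaf j i) = Nbr j"
| "att (CentreLeaf i) = Centre"

definition att_edges :: "tree_vertex set \<Rightarrow> tree_vertex set set" where
  "att_edges I = (\<lambda>x. {x, att x}) ` (I - {Centre})"

definition nbr_leaves :: "nat \<Rightarrow> nat \<Rightarrow> tree_vertex set" where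
  "nbr_leaves s t = (\<lambda>(j, i). NbrLeaf j i) ` ({1..t} \<times> {1..s})"

definition T_vs :: "nat \<Rightarrow> nat \<Rightarrow> nat \<Rightarrow> tree_vertex set" where
  "T_vs s t s' = insert Centre (Nbr ` {1..t}) \<union> (nbr_leaves s t \<union> CentreLeaf ` {1..s'})"

definition T_roots :: "nat \<Rightarrow> nat \<Rightarrow> nat \<Rightarrow> tree_vertex set" where
  "T_roots s t s' = nbr_leaves s t \<union> CentreLeaf ` {1..s'}"

lemma nbr_leaves_iff: "x \<in> nbr_leaves s t \<longleftrightarrow> (\<exists>j\<in>{1..t}. \<exists>i\<in>{1..s}. x = NbrLeaf j i)"
  by (auto simp: nbr_leaves_def)

lemma T_tree_simps:
  "vertices (T_tree s t s') = T_vs s t s'"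
  "edges (T_tree s t s') = att_edges (T_vs s t s')"
  "roots (T_tree s t s') = T_roots s t s'"
proof -
  show "vertices (T_tree s t s') = T_vs s t s'"
    by (auto simp: T_tree_def T_vs_def nbr_leaves_iff)
  show "roots (T_tree s t s') = T_roots s t s'"
    by (auto simp: T_tree_def T_roots_def nbr_leaves_iff)
  have eq: "T_vs s t s' - {Centre} = Nbr ` {1..t} \<union> nbr_leaves s t \<union> CentreLeaf ` {1..s'}"
    by (auto simp: T_vs_def nbr_leaves_iff)
  have "(\<lambda>x. {x, att x}) ` nbr_leaves s t = {{Nbr j, NbrLeaf j i} | j i. j \<in> {1..t} \<and> i \<in> {1..s}}"
    unfolding nbr_leaves_def image_image by (auto simp: image_iff doubleton_eq_iff)
  then show "edges (T_tree s t s') = att_edges (T_vs s t s')"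
    unfolding att_edges_def eq image_Un image_image att.simps
    by (auto simp: T_tree_def insert_commute)
qed

lemma card_nbr_leaves: "finite (nbr_leaves s t)" "card (nbr_leaves s t) = s * t"
proof -
  show "finite (nbr_leaves s t)" by (simp add: nbr_leaves_def)
  have "inj_on (\<lambda>(j, i). NbrLeaf j i) ({1..t} \<times> {1..s})" by (auto simp: inj_on_def)
  then show "card (nbr_leaves s t) = s * t"
    by (simp add: nbr_leaves_def card_image card_cartesian_product)
qed

lemma finite_T: "finite (T_vs s t s')" "finite (T_roots s t s')"
  by (simp_all add: T_vs_def T_roots_def card_nbr_leaves)

lemma T_nonroots: "T_vs s t s' - T_roots s t s' = insert Centre (Nbr ` {1..t})"
  by (auto simp: T_vs_def T_roots_def nbr_leaves_iff)

lemma T_roots_subset: "T_roots s t s' \<subseteq> T_vs s t s'"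
  by (auto simp: T_vs_def T_roots_def)

lemma card_T_nonroots: "card (T_vs s t s' - T_roots s t s') = t + 1"
proof -
  have "card (insert Centre (Nbr ` {1..t})) = Suc (card (Nbr ` {1..t}))"
    by (subst card_insert_disjoint) auto
  then show ?thesis unfolding T_nonroots by (simp add: card_image inj_on_def)
qed

lemma card_T_roots: "card (T_roots s t s') = s * t + s'"
proof -
  have "card (T_roots s t s') = card (nbr_leaves s t) + card (CentreLeaf ` {1..s'})"
    unfolding T_roots_def by (intro card_Un_disjoint) (auto simp: card_nbr_leaves nbr_leaves_iff)
  then show ?thesis by (simp add: card_nbr_leaves card_image inj_on_def)
qed

lemma card_T_vs: "card (T_vs s t s') = s * t + t + s' + 1"
  using card_T_nonroots[of s t s'] card_T_roots[of s t s'] T_roots_subset[of s t s']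
    card_Diff_subset[OF finite_T(2) T_roots_subset, of s t s']
    card_mono[OF finite_T(1) T_roots_subset, of s t s']
  by linarith

lemma card_T_edges: "card (att_edges (T_vs s t s')) = s * t + t + s'"
proof -
  have "inj_on (\<lambda>x. {x, att x}) (T_vs s t s' - {Centre})"
  proof (rule inj_onI)
    fix x y assume "x \<in> T_vs s t s' - {Centre}" "y \<in> T_vs s t s' - {Centre}" "{x, att x} = {y, att y}"
    then show "x = y" by (cases x; cases y) (auto simp: doubleton_eq_iff)
  qed
  then have "card (att_edges (T_vs s t s')) = card (T_vs s t s' - {Centre})"
    by (simp add: att_edges_def card_image)
  moreover have "Centre \<in> T_vs s t s'" by (simp add: T_vs_def)
  ultimately show ?thesis using card_T_vs[of s t s'] by simp
qed

lemma simple_T_tree: "simple_graph (T_tree s t s')"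
proof -
  have "{x, att x} \<subseteq> T_vs s t s' \<and> card {x, att x} = 2" if "x \<in> T_vs s t s' - {Centre}" for x
    using that by (cases x) (auto simp: T_vs_def nbr_leaves_iff)
  then show ?thesis
    by (auto simp: simple_graph_def T_tree_simps finite_T att_edges_def)
qed

text \<open>The tree has height two, so two rounds suffice: first the missing \<open>Nbr\<close>
  vertices, then the leaves.\<close>

lemma build_T_extend:
  assumes "I0 \<subseteq> I1" "I1 \<subseteq> T_vs s t s'" "Centre \<in> I0" "\<And>x. x \<in> I1 - {Centre} \<Longrightarrow> att x \<in> I1"
  shows "build I0 (att_edges I0) I1 (att_edges I1) 0 (card I1 - card I0)"
proof -
  define X1 where "X1 = Nbr ` {1..t} \<inter> I1 - I0"
  define X2 where "X2 = I1 - (X1 \<union> I0)"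
  have "finite I1" using finite_T assms(2) finite_subset by blast
  then have fin: "finite X1" "finite X2" "finite I0"
    using finite_subset[OF assms(1)] by (auto simp: X1_def X2_def)
  have b1: "build I0 (att_edges I0) (X1 \<union> I0) ((\<lambda>x. {x, att x}) ` X1 \<union> att_edges I0) 0 (card X1 + 0)"
    using assms(3) fin by (intro build_leaf_set build.start) (auto simp: X1_def)
  have b2: "build I0 (att_edges I0) (X2 \<union> (X1 \<union> I0))
     ((\<lambda>x. {x, att x}) ` X2 \<union> ((\<lambda>x. {x, att x}) ` X1 \<union> att_edges I0)) 0 (card X2 + (card X1 + 0))"
  proof (rule build_leaf_set[OF b1])
    show "att ` X2 \<subseteq> X1 \<union> I0"
    proof
      fix y assume "y \<in> att ` X2"
      then obtain x where x: "x \<in> X2" "y = att x" by blast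
      then have "x \<in> I1" "x \<noteq> Centre" "x \<notin> Nbr ` {1..t}" using assms(3) by (auto simp: X2_def X1_def)
      moreover from this have "att x \<in> I1" "x \<in> T_vs s t s'" using assms(2,4) by auto
      ultimately show "y \<in> X1 \<union> I0"
        using assms(3) x(2) by (auto simp: T_vs_def nbr_leaves_iff X1_def)
    qed
  qed (use fin in \<open>auto simp: X2_def\<close>)
  have un: "X2 \<union> (X1 \<union> I0) = I1"
    using assms(1) by (auto simp: X2_def X1_def)
  have "I1 - {Centre} = X2 \<union> (X1 \<union> (I0 - {Centre}))"
    using assms(1,3) by (auto simp: X2_def X1_def)
  then have ed: "(\<lambda>x. {x, att x}) ` X2 \<union> ((\<lambda>x. {x, att x}) ` X1 \<union> att_edges I0) = att_edges I1"
    by (simp only: att_edges_def image_Un)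
  have "card I1 = card X2 + (card X1 + card I0)"
    using fin unfolding un[symmetric]
    by (subst card_Un_disjoint; (subst card_Un_disjoint)?) (auto simp: X1_def X2_def)
  then show ?thesis using b2 unfolding un ed by simp
qed

lemma build_trans:
  assumes "build I1 D1 I D a' b'" "build I0 D0 I1 D1 a b"
  shows "build I0 D0 I D (a' + a) (b' + b)"
  using assms by (induction rule: build.induct) (auto intro: build.intros)

lemma build_subtree:
  assumes "I1 \<subseteq> T_vs s t s'" "Centre \<in> I1" "\<And>x. x \<in> I1 - {Centre} \<Longrightarrow> att x \<in> I1"
  shows "build {} {} I1 (att_edges I1) 1 (card I1 - 1)"
proof -
  have "build {} {} {Centre} (att_edges {Centre}) 1 0"
    using build.free[OF build.start, of Centre "{}" "{}"] by (simp add: att_edges_def)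
  moreover have "build {Centre} (att_edges {Centre}) I1 (att_edges I1) 0 (card I1 - card {Centre})"
    using assms by (intro build_T_extend) auto
  ultimately show ?thesis
    using build_trans by fastforce
qed

lemma att_in_T: "x \<in> T_vs s t s' \<Longrightarrow> att x \<in> T_vs s t s'"
  by (auto simp: T_vs_def nbr_leaves_iff)

lemma build_T: "build {} {} (T_vs s t s') (att_edges (T_vs s t s')) 1 (s * t + t + s')"
  using build_subtree[OF subset_refl, of s t s'] att_in_T[of _ s t s']
  by (simp add: card_T_vs) (simp add: T_vs_def)

lemma homs_T_iff:
  "f \<in> homs V E (T_vs s t s') (att_edges (T_vs s t s')) \<longleftrightarrow> f \<in> T_vs s t s' \<rightarrow>\<^sub>E V \<and>
     (\<forall>j\<in>{1..t}. f (Nbr j) \<in> nb E (f Centre)) \<and>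
     (\<forall>j\<in>{1..t}. \<forall>i\<in>{1..s}. f (NbrLeaf j i) \<in> nb E (f (Nbr j))) \<and>
     (\<forall>i\<in>{1..s'}. f (CentreLeaf i) \<in> nb E (f Centre))"
proof -
  have eq: "T_vs s t s' - {Centre} = Nbr ` {1..t} \<union> (nbr_leaves s t \<union> CentreLeaf ` {1..s'})"
    by (auto simp: T_vs_def nbr_leaves_iff)
  show ?thesis
    unfolding homs_def att_edges_def eq
    by (auto simp: ball_Un nb_def insert_commute nbr_leaves_def)
qed

lemma PiE_eqI:
  assumes "f \<in> Pi\<^sub>E A S" "g \<in> Pi\<^sub>E A T" "\<And>x. x \<in> A \<Longrightarrow> f x = g x"
  shows "f = g"
  using assms by (intro extensionalityI[of f A g]) (auto simp: PiE_def)

text \<open>Greedy: \<open>W\<close> and the values already chosen cannot exhaust the next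
  \<open>S j\<close>.\<close>

lemma distinct_choice:
  assumes "finite T" "finite W" "\<And>j. j \<in> T \<Longrightarrow> card W + card T \<le> card (S j)"
  shows "\<exists>q. inj_on q T \<and> (\<forall>j\<in>T. q j \<in> S j - W)"
  using assms(1,3)
proof (induction T)
  case (insert x T)
  then obtain q where q: "inj_on q T" "\<forall>j\<in>T. q j \<in> S j - W" by force
  have "card (W \<union> q ` T) \<le> card W + card T"
    using card_Un_le[of W "q ` T"] card_image_le[of T q] insert.hyps(1) by linarith
  also have "\<dots> < card (S x)" using insert.prems[of x] insert.hyps by simp
  finally have "\<not> S x \<subseteq> W \<union> q ` T"
    using insert.hyps assms(2) by (meson card_mono finite_UnI finite_imageI leD)
  then obtain w where w: "w \<in> S x" "w \<notin> W" "w \<notin> q ` T" by blast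
  have ne: "j \<noteq> x" if "j \<in> T" for j using that insert.hyps by auto
  have "inj_on (q(x := w)) (insert x T)"
    using q(1) w(3) ne by (auto simp: inj_on_def)
  moreover have "\<forall>j\<in>insert x T. (q(x := w)) j \<in> S j - W" using q(2) w ne by auto
  ultimately show ?case by blast
qed simp

lemma le_threshold_plus_power:
  fixes a \<theta> :: real
  assumes "a \<ge> 0" "\<theta> > 0" "t \<ge> 1"
  shows "a \<le> \<theta> + a ^ t / \<theta> ^ (t - 1)"
proof (cases "a \<le> \<theta>")
  case True
  then show ?thesis using assms by (smt (verit) divide_nonneg_nonneg zero_le_power)
next
  case False
  have "a * \<theta> ^ (t - 1) \<le> a * a ^ (t - 1)"
    using False assms by (intro mult_left_mono power_mono) auto
  also have "\<dots> = a ^ t" using assms(3) by (metis Suc_diff_1 less_le_trans power_Suc zero_less_one)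
  finally have "a \<le> a ^ t / \<theta> ^ (t - 1)" using assms(2) by (simp add: field_simps)
  then show ?thesis using assms by linarith
qed

text \<open>A replacement for the power mean inequality with an explicit threshold: terms up to
  \<open>\<theta>\<close> make up at most half of the sum, and each larger one is at most
  \<open>a x ^ t / \<theta> ^ (t - 1)\<close>.\<close>

lemma sum_power_lower_bound:
  fixes a :: "'a \<Rightarrow> real" and \<theta> :: real
  assumes "finite P" "\<And>x. x \<in> P \<Longrightarrow> a x \<ge> 0" "\<theta> > 0" "t \<ge> 1" "2 * (card P * \<theta>) \<le> sum a P"
  shows "\<theta> ^ (t - 1) * sum a P \<le> 2 * (\<Sum>x\<in>P. a x ^ t)"
proof -
  have "sum a P \<le> (\<Sum>x\<in>P. \<theta> + a x ^ t / \<theta> ^ (t - 1))"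
    using assms le_threshold_plus_power by (intro sum_mono) auto
  also have "\<dots> = card P * \<theta> + (\<Sum>x\<in>P. a x ^ t) / \<theta> ^ (t - 1)"
    by (simp add: sum.distrib sum_divide_distrib)
  finally have "sum a P / 2 \<le> (\<Sum>x\<in>P. a x ^ t) / \<theta> ^ (t - 1)"
    using assms(5) by linarith
  then show ?thesis using assms(3) by (simp add: field_simps)
qed

section \<open>Hosts without the power, and the rarity of ample stars\<close>

locale power_free_host = almost_regular V E K d
  for V :: "'v set" and E :: "'v set set" and K d :: real +
  fixes s t s' p :: nat
  assumes t_pos: "t \<ge> 1"
    and no_sunflower:
      "\<not> sunflower_at V E (T_vs s t s') (att_edges (T_vs s t s')) (T_roots s t s') p \<xi>"
begin

abbreviation "VT \<equiv> T_vs s t s'"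
abbreviation "RT \<equiv> T_roots s t s'"
abbreviation "ET \<equiv> att_edges (T_vs s t s')"

lemma sunflower_contra:
  assumes "\<And>W. finite W \<Longrightarrow> card W \<le> p * (t + 1) \<Longrightarrow>
     \<exists>f\<in>emb V E VT ET. (\<forall>r\<in>RT. f r = \<xi> r) \<and> f ` insert Centre (Nbr ` {1..t}) \<inter> W = {}"
  shows False
proof -
  have "sunflower_at V E VT ET RT p \<xi>"
    using assms unfolding T_nonroots[of s t s', symmetric] card_T_nonroots[of s t s', symmetric]
    by (intro sunflower_atI) (auto simp: finite_T T_nonroots)
  then show False using no_sunflower by blast
qed

lemma root_cover:
  obtains W where "finite W" "card W \<le> p * (t + 1)"
    "\<forall>f\<in>emb V E VT ET. (\<forall>r\<in>RT. f r = \<xi> r) \<longrightarrow> f ` insert Centre (Nbr ` {1..t}) \<inter> W \<noteq> {}"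
proof -
  have "\<exists>W. finite W \<and> card W \<le> p * (t + 1) \<and> (\<forall>f\<in>emb V E VT ET. (\<forall>r\<in>RT. f r = \<xi> r) \<longrightarrow>
       f ` insert Centre (Nbr ` {1..t}) \<inter> W \<noteq> {})"
  proof (rule ccontr)
    assume *: "\<not> ?thesis"
    show False
    proof (rule sunflower_contra[of \<xi>])
      fix W :: "'v set" assume "finite W" "card W \<le> p * (t + 1)"
      with * show "\<exists>f\<in>emb V E VT ET. (\<forall>r\<in>RT. f r = \<xi> r) \<and> f ` insert Centre (Nbr ` {1..t}) \<inter> W = {}"
        by simp
    qed
  qed
  then show thesis using that by (elim exE conjE)
qed

lemma mk_emb:
  assumes \<rho>: "inj_on \<rho> RT" "\<rho> ` RT \<subseteq> V" and v: "v \<in> V" "v \<notin> \<rho> ` RT"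
    and q: "inj_on q {1..t}" "\<And>j. j \<in> {1..t} \<Longrightarrow> q j \<in> nb E v" "\<And>j. j \<in> {1..t} \<Longrightarrow> q j \<notin> \<rho> ` RT"
    and leaves: "\<And>j i. j \<in> {1..t} \<Longrightarrow> i \<in> {1..s} \<Longrightarrow> \<rho> (NbrLeaf j i) \<in> nb E (q j)"
      "\<And>i. i \<in> {1..s'} \<Longrightarrow> \<rho> (CentreLeaf i) \<in> nb E v"
  shows "\<exists>f\<in>emb V E VT ET. f Centre = v \<and> (\<forall>j\<in>{1..t}. f (Nbr j) = q j) \<and> (\<forall>r\<in>RT. f r = \<rho> r)"
proof -
  define h where "h = (\<lambda>x\<in>VT. case x of Centre \<Rightarrow> v | Nbr j \<Rightarrow> q j | _ \<Rightarrow> \<rho> x)"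
  have hC: "h Centre = v" by (simp add: h_def T_vs_def)
  have hq: "h (Nbr j) = q j" if "j \<in> {1..t}" for j using that by (simp add: h_def T_vs_def)
  have hr: "h x = \<rho> x" if "x \<in> RT" for x
    using that by (auto simp: h_def T_roots_def T_vs_def nbr_leaves_iff)
  have VT_cases: "x = Centre \<or> (\<exists>j\<in>{1..t}. x = Nbr j) \<or> x \<in> RT" if "x \<in> VT" for x
    using that by (auto simp: T_vs_def T_roots_def)
  have "h x \<in> V" if "x \<in> VT" for x
    using VT_cases[OF that]
  proof (elim disjE bexE)
    show "h x \<in> V" if "x = Centre" using v(1) hC that by simp
    show "h x \<in> V" if "j \<in> {1..t}" "x = Nbr j" for j using q(2)[OF that(1)] nb_V hq that by auto
    show "h x \<in> V" if "x \<in> RT" using \<rho>(2) hr[OF that] that by auto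
  qed
  then have "h \<in> VT \<rightarrow>\<^sub>E V" by (auto simp: h_def PiE_def extensional_def)
  moreover have "h (NbrLeaf j i) \<in> nb E (h (Nbr j))" if "j \<in> {1..t}" "i \<in> {1..s}" for i j
    using that leaves(1)[of j i] hq[of j] hr[of "NbrLeaf j i"] by (auto simp: T_roots_def nbr_leaves_iff)
  moreover have "h (CentreLeaf i) \<in> nb E (h Centre)" if "i \<in> {1..s'}" for i
    using that leaves(2)[of i] hr[of "CentreLeaf i"] by (auto simp: T_roots_def hC)
  ultimately have "h \<in> hom VT ET"
    using q(2) hC hq by (auto simp: homs_T_iff)
  moreover have "inj_on h VT"
  proof -
    have VT_eq: "VT = RT \<union> insert Centre (Nbr ` {1..t})" by (auto simp: T_vs_def T_roots_def)
    have inj1: "inj_on h RT" using \<rho>(1) hr by (simp cong: inj_on_cong)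
    have inj2: "inj_on h (insert Centre (Nbr ` {1..t}))"
    proof -
      have "inj_on h (Nbr ` {1..t})"
      proof (rule inj_onI)
        fix x y assume "x \<in> Nbr ` {1..t}" "y \<in> Nbr ` {1..t}" "h x = h y"
        then obtain j k where "j \<in> {1..t}" "k \<in> {1..t}" "x = Nbr j" "y = Nbr k" "q j = q k"
          using hq by auto
        then show "x = y" using inj_onD[OF q(1), of j k] by simp
      qed
      moreover have "v \<noteq> q j" if "j \<in> {1..t}" for j using q(2)[OF that] nb_V by blast
      then have "h Centre \<notin> h ` Nbr ` {1..t}" using hC hq by (auto simp: image_iff)
      ultimately show ?thesis by (auto simp: inj_on_insert)
    qed
    have ne: "h x \<noteq> h y" if "x \<in> RT" "y \<in> insert Centre (Nbr ` {1..t})" for x y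
    proof -
      note y = that(2)
      have "h x \<in> \<rho> ` RT" using hr that(1) by auto
      moreover have "h y \<notin> \<rho> ` RT"
      proof (cases "y = Centre")
        case False
        then obtain j where "j \<in> {1..t}" "y = Nbr j" using y by blast
        then show ?thesis using q(3)[of j] hq[of j] by simp
      qed (use hC v(2) in simp)
      ultimately show ?thesis by metis
    qed
    show ?thesis
    proof (intro inj_onI)
      fix x y assume xy: "x \<in> VT" "y \<in> VT" "h x = h y"
      consider "x \<in> RT" "y \<in> RT" | "x \<in> RT" "y \<in> insert Centre (Nbr ` {1..t})"
        | "x \<in> insert Centre (Nbr ` {1..t})" "y \<in> RT"
        | "x \<in> insert Centre (Nbr ` {1..t})" "y \<in> insert Centre (Nbr ` {1..t})"
        using xy(1,2) unfolding VT_eq by (auto simp only: Un_iff)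
      then show "x = y"
      proof cases
        case 1 then show ?thesis using inj1 xy(3) by (auto dest: inj_onD)
      next
        case 2 then show ?thesis using ne[of x y] xy(3) by simp
      next
        case 3 then show ?thesis using ne[of y x] xy(3) by simp
      next
        case 4 then show ?thesis using inj_onD[OF inj2 xy(3)] by simp
      qed
    qed
  qed
  ultimately have "h \<in> emb V E VT ET" by (simp add: emb_def)
  then show ?thesis using hC hq hr by blast
qed

text \<open>Only the \<open>q_j\<close> remain to be chosen. The size required of \<open>S j\<close>
  leaves room for \<open>W\<close>, for the \<open>s * t + s'\<close> roots and for the other
  \<open>q_j\<close>.\<close>

lemma exists_emb_avoiding:
  assumes \<rho>: "inj_on \<rho> RT" "\<rho> ` RT \<subseteq> V" and v: "v \<in> V" "v \<notin> \<rho> ` RT" "v \<notin> W" and W: "finite W"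
    and leaves: "\<And>i. i \<in> {1..s'} \<Longrightarrow> \<rho> (CentreLeaf i) \<in> nb E v"
    and S: "\<And>j. j \<in> {1..t} \<Longrightarrow> card W + (s * t + s') + t \<le> card (S j)"
      "\<And>j. j \<in> {1..t} \<Longrightarrow> S j \<subseteq> common_nb E (insert v ((\<lambda>i. \<rho> (NbrLeaf j i)) ` {1..s}))"
  shows "\<exists>f\<in>emb V E VT ET. (\<forall>r\<in>RT. f r = \<rho> r) \<and> f ` insert Centre (Nbr ` {1..t}) \<inter> W = {}"
proof -
  have "card (W \<union> \<rho> ` RT) \<le> card W + (s * t + s')"
    using card_Un_le[of W "\<rho> ` RT"] card_image_le[OF finite_T(2), of \<rho> s t s'] card_T_roots[of s t s']
    by linarith
  then have "card (W \<union> \<rho> ` RT) + card {1..t} \<le> card (S j)" if "j \<in> {1..t}" for j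
    using S(1)[OF that] by simp
  then have "\<exists>q. inj_on q {1..t} \<and> (\<forall>j\<in>{1..t}. q j \<in> S j - (W \<union> \<rho> ` RT))"
    using W finite_T by (intro distinct_choice) simp_all
  then obtain q where q: "inj_on q {1..t}" "\<And>j. j \<in> {1..t} \<Longrightarrow> q j \<in> S j - (W \<union> \<rho> ` RT)"
    by blast
  have qn: "q j \<in> common_nb E (insert v ((\<lambda>i. \<rho> (NbrLeaf j i)) ` {1..s}))" if "j \<in> {1..t}" for j
    using q(2)[OF that] S(2)[OF that] by blast
  have qv: "q j \<in> nb E v" "i \<in> {1..s} \<Longrightarrow> \<rho> (NbrLeaf j i) \<in> nb E (q j)"
    if "j \<in> {1..t}" for i j
    using qn[OF that] by (auto simp: common_nb_def nb_def insert_commute)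
  have "\<exists>f\<in>emb V E VT ET. f Centre = v \<and> (\<forall>j\<in>{1..t}. f (Nbr j) = q j) \<and> (\<forall>r\<in>RT. f r = \<rho> r)"
  proof (rule mk_emb[OF \<rho> v(1,2) q(1) qv(1) _ qv(2) leaves])
    show "q j \<notin> \<rho> ` RT" if "j \<in> {1..t}" for j using q(2)[OF that] by simp
  qed
  then obtain f where f: "f \<in> emb V E VT ET" "f Centre = v" "\<forall>j\<in>{1..t}. f (Nbr j) = q j"
    "\<forall>r\<in>RT. f r = \<rho> r" by blast
  moreover have "f ` insert Centre (Nbr ` {1..t}) \<inter> W = {}"
    using f(2,3) v(3) q(2) by auto
  ultimately show ?thesis by blast
qed

text \<open>The trees counted here have a vertex \<open>u\<close>, stored at \<open>CentreLeaf 1\<close>, adjacent to \<open>v\<close>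
  and to all \<open>NbrLeaf j i\<close>, while the other \<open>CentreLeaf\<close>s hang from \<open>v\<close>. If many of them share
  everything but \<open>v\<close>, the ampleness supplies the vertices \<open>q\<^sub>j\<close> of a sunflower.\<close>

definition ample_leaves :: "nat \<Rightarrow> 'v \<Rightarrow> 'v \<Rightarrow> (nat \<Rightarrow> 'v) set" where
  "ample_leaves M u v = {y \<in> {1..s} \<rightarrow>\<^sub>E nb E u. M \<le> card (common_nb E (insert v (y ` {1..s})))}"

text \<open>\<open>\<sigma>\<close> is at least 1 since \<open>CentreLeaf 1\<close> must exist to
  hold \<open>u\<close> even when \<open>s' = 0\<close>. \<open>\<kappa>\<close> is what the power
  mean leaves when \<open>t\<close> ample tuples are attached to the same pair
  \<open>(u, v)\<close>. \<open>d1\<close> makes degenerate trees at most half of the total, and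
  \<open>d2\<close> makes some fibre over the position of all vertices but \<open>v\<close> exceed
  \<open>p * (t + 1)\<close>.\<close>

lemma few_ample_leaves:
  fixes M \<sigma> :: nat and \<epsilon> \<kappa> :: real
  defines "\<sigma> \<equiv> max 1 s'"
  defines "\<kappa> \<equiv> (\<epsilon> / (2 * K)) ^ t * K"
  assumes \<epsilon>: "\<epsilon> > 0"
    and M: "M \<ge> p * (t + 1) + (1 + \<sigma> + s * t) + t"
    and d1: "2 * (1 + \<sigma> + s * t)^2 * K ^ (\<sigma> + s * t) \<le> \<kappa> * d"
    and d2: "2 * (p * (t + 1)) * K ^ (s * t) * N ^ (\<sigma> - 1) < \<kappa> * d ^ \<sigma>"
  shows "(\<Sum>(u, v)\<in>{(u, v). v \<in> nb E u}. real (card (ample_leaves M u v))) \<le> \<epsilon> * N * d ^ (s + 1)"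
proof (rule ccontr)
  assume many: "\<not> ?thesis"
  define Pr where "Pr = {(u, v). v \<in> nb E u}"
  define a where "a = (\<lambda>(u, v). real (card (ample_leaves M u v)))"
  have \<sigma>1: "\<sigma> \<ge> 1" "\<sigma> \<ge> s'" by (auto simp: \<sigma>_def)
  have Kd: "K > 0" "d > 0" using K_ge_1 d_ge_1 by auto
  have \<kappa>: "\<kappa> > 0" using \<epsilon> Kd by (simp add: \<kappa>_def)
  have PrS: "Pr = Sigma V (nb E)" using nb_V by (auto simp: Pr_def)
  then have finPr: "finite Pr" using finite_V finite_nb by simp
  have "real (card Pr) = (\<Sum>u\<in>V. real (card (nb E u)))"
    unfolding PrS using finite_V finite_nb by simp
  also have "\<dots> \<le> (\<Sum>u\<in>V. K * d)" by (intro sum_mono max_deg)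
  finally have cardPr: "real (card Pr) \<le> N * (K * d)" by simp
  \<comment> \<open>Half of the average forced by \<open>many\<close>: there are at most
    \<open>N * (K * d)\<close> pairs, and
    \<open>2 * (N * (K * d) * \<theta>) = \<epsilon> * N * d ^ (s + 1)\<close>.\<close>
  define \<theta> where "\<theta> = \<epsilon> / (2 * K) * d ^ s"
  have \<theta>: "\<theta> > 0" using \<epsilon> Kd by (simp add: \<theta>_def)
  have suma: "sum a Pr > \<epsilon> * N * d ^ (s + 1)"
    using many by (simp add: Pr_def a_def case_prod_unfold)
  have "2 * (card Pr * \<theta>) \<le> 2 * (N * (K * d) * \<theta>)"
    using cardPr \<theta> by (intro mult_left_mono mult_right_mono) auto
  also have "\<dots> = \<epsilon> * N * d ^ (s + 1)" using Kd by (simp add: \<theta>_def field_simps)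
  finally have "2 * (card Pr * \<theta>) \<le> sum a Pr" using suma by linarith
  then have "\<theta> ^ (t - 1) * sum a Pr \<le> 2 * (\<Sum>x\<in>Pr. a x ^ t)"
    using finPr \<theta> t_pos by (intro sum_power_lower_bound) (auto simp: a_def)
  moreover have "\<theta> ^ (t - 1) * (\<epsilon> * N * d ^ (s + 1)) \<le> \<theta> ^ (t - 1) * sum a Pr"
    using suma \<theta> by (intro mult_left_mono) auto
  moreover have "\<theta> ^ (t - 1) * (\<epsilon> * N * d ^ (s + 1)) = 2 * (\<kappa> * N * d ^ (s * t + 1))"
  proof -
    have "\<epsilon> * N * d ^ (s + 1) = \<theta> * (2 * K * N * d)" using Kd by (simp add: \<theta>_def field_simps)
    then have "\<theta> ^ (t - 1) * (\<epsilon> * N * d ^ (s + 1)) = \<theta> ^ (t - 1) * \<theta> * (2 * K * N * d)" by simp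
    also have "\<theta> ^ (t - 1) * \<theta> = \<theta> ^ t" using t_pos by (intro power_minus_mult) simp
    also have "\<theta> ^ t = (\<epsilon> / (2 * K)) ^ t * d ^ (s * t)"
      by (simp only: \<theta>_def power_mult_distrib power_mult)
    also have "\<dots> * (2 * K * N * d) = 2 * (\<kappa> * N * d ^ (s * t + 1))"
      by (simp add: \<kappa>_def mult_ac)
    finally show ?thesis .
  qed
  ultimately have sumat: "\<kappa> * N * d ^ (s * t + 1) \<le> (\<Sum>x\<in>Pr. a x ^ t)" by linarith

  \<comment> \<open>The auxiliary tree hangs from \<open>CentreLeaf 1\<close>, to which
    \<open>Centre\<close> and all \<open>NbrLeaf\<close>s are attached; the other
    \<open>CentreLeaf\<close>s are attached to \<open>Centre\<close>.\<close>
  define att' where "att' = (\<lambda>x. case x of CentreLeaf i \<Rightarrow> Centre | _ \<Rightarrow> CentreLeaf 1)"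
  define J where "J = nbr_leaves s t \<union> CentreLeaf ` {1..\<sigma>}"
  define I where "I = insert Centre J"
  define D where "D = (\<lambda>x. {x, att' x}) ` (I - {CentreLeaf 1})"
  define DJ where "DJ = (\<lambda>x. {x, CentreLeaf 1}) ` nbr_leaves s t"
  have finJ: "finite J" "finite I" by (auto simp: J_def I_def card_nbr_leaves)
  have cl1: "CentreLeaf 1 \<in> J" using \<sigma>1 by (auto simp: J_def)
  \<comment> \<open>Without \<open>Centre\<close> there remain a star at \<open>CentreLeaf 1\<close>
    and \<open>\<sigma> - 1\<close> isolated vertices, hence \<open>\<sigma>\<close>
    components.\<close>
  have bJ: "build {} {} J DJ \<sigma> (s * t)"
  proof -
    have "build {} {} (CentreLeaf ` {1..\<sigma>} \<union> {}) {} (card (CentreLeaf ` {1..\<sigma>}) + 0) 0"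
      by (intro build_free_set build.start) auto
    then have "build {} {} (nbr_leaves s t \<union> (CentreLeaf ` {1..\<sigma>} \<union> {}))
        ((\<lambda>x. {x, CentreLeaf 1}) ` nbr_leaves s t \<union> {}) (card (CentreLeaf ` {1..\<sigma>}) + 0)
        (card (nbr_leaves s t) + 0)"
      using \<sigma>1 by (intro build_leaf_set) (auto simp: card_nbr_leaves nbr_leaves_iff)
    then show ?thesis
      by (simp add: J_def DJ_def card_nbr_leaves card_image inj_on_def)
  qed
  have bI: "build {} {} I D 1 (\<sigma> + s * t)"
  proof -
    have b0: "build {} {} {CentreLeaf 1} {} 1 0"
      using build.free[OF build.start, of "CentreLeaf 1" "{}" "{}"] by simp
    have b1: "build {} {} {Centre, CentreLeaf 1} {{Centre, CentreLeaf 1}} 1 1"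
      using build.leaf[OF b0, of Centre "CentreLeaf 1"] by simp
    let ?X = "nbr_leaves s t \<union> CentreLeaf ` {2..\<sigma>}"
    have "build {} {} (?X \<union> {Centre, CentreLeaf 1}) ((\<lambda>x. {x, att' x}) ` ?X \<union> {{Centre, CentreLeaf 1}})
       1 (card ?X + 1)"
      by (intro build_leaf_set[OF b1]) (auto simp: card_nbr_leaves nbr_leaves_iff att'_def)
    moreover have "?X \<union> {Centre, CentreLeaf 1} = I"
      using \<sigma>1 by (auto simp: I_def J_def image_iff)
    moreover have "I - {CentreLeaf 1} = ?X \<union> {Centre}"
      using \<sigma>1 by (auto simp: I_def J_def nbr_leaves_iff image_iff)
    then have "(\<lambda>x. {x, att' x}) ` ?X \<union> {{Centre, CentreLeaf 1}} = D"
      unfolding D_def by (simp add: image_Un att'_def)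
    moreover have "card ?X + 1 = \<sigma> + s * t"
    proof -
      have "card ?X = card (nbr_leaves s t) + card (CentreLeaf ` {2..\<sigma>})"
        by (intro card_Un_disjoint) (auto simp: card_nbr_leaves nbr_leaves_iff)
      then show ?thesis using \<sigma>1 by (simp add: card_nbr_leaves card_image inj_on_def)
    qed
    ultimately show ?thesis by simp
  qed
  have cardI: "card I = 1 + \<sigma> + s * t"
  proof -
    have "card J = card (nbr_leaves s t) + card (CentreLeaf ` {1..\<sigma>})"
      unfolding J_def by (intro card_Un_disjoint) (auto simp: card_nbr_leaves nbr_leaves_iff)
    moreover have "Centre \<notin> J" by (auto simp: J_def nbr_leaves_iff)
    ultimately show ?thesis using finJ by (simp add: I_def card_nbr_leaves card_image inj_on_def)
  qed
  define \<Theta> where "\<Theta> = {f \<in> hom I D. \<forall>j\<in>{1..t}.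
     M \<le> card (common_nb E (insert (f Centre) ((\<lambda>i. f (NbrLeaf j i)) ` {1..s})))}"
  have fin\<Theta>: "finite \<Theta>" using finite_hom[OF finJ(2)] by (simp add: \<Theta>_def)
  define Dom where "Dom = Sigma Pr (\<lambda>(u, v). ({1..t} \<rightarrow>\<^sub>E ample_leaves M u v) \<times> ({2..\<sigma>} \<rightarrow>\<^sub>E nb E v))"
  \<comment> \<open>An injection from the counted data \<open>(u, v, Y, U)\<close> to homomorphisms
    of the auxiliary tree. The value at \<open>Nbr j\<close> is a dummy, since \<open>Nbr j\<close>
    lies outside \<open>I\<close>.\<close>
  define mk where "mk = (\<lambda>((u, v), (Y, U)). \<lambda>x\<in>I. case x of Centre \<Rightarrow> v | Nbr j \<Rightarrow> v
     | NbrLeaf j i \<Rightarrow> Y j i | CentreLeaf i \<Rightarrow> if i = 1 then u else (U i :: 'v))"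
  have fin_al: "finite (ample_leaves M u v)" for u v
    unfolding ample_leaves_def
    by (rule finite_subset[of _ "{1..s} \<rightarrow>\<^sub>E nb E u"]) (auto simp: finite_nb intro!: finite_PiE)
  have finDom: "finite (({1..t} \<rightarrow>\<^sub>E ample_leaves M u v) \<times> ({2..\<sigma>} \<rightarrow>\<^sub>E nb E v))" for u v
    using fin_al finite_nb by (intro finite_cartesian_product finite_PiE) auto
  have "real (card Dom) = (\<Sum>(u, v)\<in>Pr. a (u, v) ^ t * real (card (nb E v)) ^ (\<sigma> - 1))"
    unfolding Dom_def using finPr finDom
    by (subst card_SigmaI) (auto simp: card_cartesian_product card_PiE a_def case_prod_unfold)
  moreover have "(\<Sum>(u, v)\<in>Pr. a (u, v) ^ t * d ^ (\<sigma> - 1)) \<le>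
      (\<Sum>(u, v)\<in>Pr. a (u, v) ^ t * real (card (nb E v)) ^ (\<sigma> - 1))"
  proof (rule sum_mono)
    fix uv assume "uv \<in> Pr"
    then obtain u v where "uv = (u, v)" "v \<in> V" using nb_V by (auto simp: Pr_def)
    then show "(case uv of (u, v) \<Rightarrow> a (u, v) ^ t * d ^ (\<sigma> - 1)) \<le>
       (case uv of (u, v) \<Rightarrow> a (u, v) ^ t * real (card (nb E v)) ^ (\<sigma> - 1))"
      using min_deg Kd by (auto intro!: mult_left_mono power_mono simp: a_def)
  qed
  moreover have "(\<Sum>(u, v)\<in>Pr. a (u, v) ^ t * d ^ (\<sigma> - 1)) = (\<Sum>x\<in>Pr. a x ^ t) * d ^ (\<sigma> - 1)"
    by (simp add: sum_distrib_right case_prod_unfold)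
  moreover have "\<kappa> * N * d ^ (s * t + 1) * d ^ (\<sigma> - 1) \<le> (\<Sum>x\<in>Pr. a x ^ t) * d ^ (\<sigma> - 1)"
    using sumat Kd by (intro mult_right_mono) auto
  moreover have "\<kappa> * N * d ^ (s * t + 1) * d ^ (\<sigma> - 1) = \<kappa> * N * d ^ (s * t + \<sigma>)"
  proof -
    have "s * t + \<sigma> = (s * t + 1) + (\<sigma> - 1)" using \<sigma>1 by simp
    then show ?thesis by (simp only: power_add mult.assoc)
  qed
  ultimately have Dom_large: "\<kappa> * N * d ^ (s * t + \<sigma>) \<le> card Dom" by linarith
  have "card Dom \<le> card \<Theta>"
  proof (rule card_inj_on_le[OF _ _ fin\<Theta>])
    show "inj_on mk Dom"
    proof (rule inj_onI)
      fix x x' assume xx: "x \<in> Dom" "x' \<in> Dom" "mk x = mk x'"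
      obtain u v Y U u' v' Y' U' where x: "x = ((u, v), (Y, U))" and x': "x' = ((u', v'), (Y', U'))"
        by (metis surj_pair)
      have eq: "mk x z = mk x' z" for z using xx(3) by simp
      have "v = v'" using eq[of Centre] by (simp add: mk_def x x' I_def)
      moreover have "u = u'" using eq[of "CentreLeaf 1"] cl1 by (simp add: mk_def x x' I_def)
      moreover have "U = U'"
      proof (rule PiE_eqI)
        show "U i = U' i" if "i \<in> {2..\<sigma>}" for i
          using eq[of "CentreLeaf i"] that by (simp add: mk_def x x' I_def J_def image_iff)
      qed (use xx x x' in \<open>auto simp: Dom_def\<close>)
      moreover have "Y = Y'"
      proof (rule PiE_eqI)
        show Y: "Y \<in> {1..t} \<rightarrow>\<^sub>E ample_leaves M u v" "Y' \<in> {1..t} \<rightarrow>\<^sub>E ample_leaves M u' v'"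
          using xx x x' by (auto simp: Dom_def)
        fix j assume j: "j \<in> {1..t}"
        show "Y j = Y' j"
        proof (rule PiE_eqI)
          show "Y j \<in> {1..s} \<rightarrow>\<^sub>E nb E u" "Y' j \<in> {1..s} \<rightarrow>\<^sub>E nb E u'"
            using PiE_mem[OF Y(1) j] PiE_mem[OF Y(2) j] by (auto simp: ample_leaves_def)
          show "Y j i = Y' j i" if "i \<in> {1..s}" for i
            using eq[of "NbrLeaf j i"] that j by (simp add: mk_def x x' I_def J_def nbr_leaves_iff)
        qed
      qed
      ultimately show "x = x'" by (simp add: x x')
    qed
    show "mk ` Dom \<subseteq> \<Theta>"
    proof
      fix f assume "f \<in> mk ` Dom"
      then obtain u v Y U where f: "f = mk ((u, v), (Y, U))" and uv: "v \<in> nb E u"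
        and Y: "Y \<in> {1..t} \<rightarrow>\<^sub>E ample_leaves M u v" and U: "U \<in> {2..\<sigma>} \<rightarrow>\<^sub>E nb E v"
        by (auto simp: Dom_def Pr_def)
      have fC: "f Centre = v" by (simp add: f mk_def I_def)
      have f1: "f (CentreLeaf 1) = u" using cl1 by (simp add: f mk_def I_def)
      have fU: "f (CentreLeaf i) = U i" if "i \<in> {2..\<sigma>}" for i
        using that by (simp add: f mk_def I_def J_def image_iff)
      have fY: "f (NbrLeaf j i) = Y j i" if "j \<in> {1..t}" "i \<in> {1..s}" for i j
        using that by (simp add: f mk_def I_def J_def nbr_leaves_iff)
      have Ya: "Y j \<in> ample_leaves M u v" if "j \<in> {1..t}" for j using PiE_mem[OF Y that] .
      have Yn: "Y j i \<in> nb E u" if "j \<in> {1..t}" "i \<in> {1..s}" for i j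
        using Ya[OF that(1)] that(2) by (auto simp: ample_leaves_def)
      have Un: "U i \<in> nb E v" if "i \<in> {2..\<sigma>}" for i using PiE_mem[OF U that] .
      have Icases: "x = Centre \<or> x = CentreLeaf 1 \<or> (\<exists>i\<in>{2..\<sigma>}. x = CentreLeaf i)
          \<or> (\<exists>j\<in>{1..t}. \<exists>i\<in>{1..s}. x = NbrLeaf j i)" if "x \<in> I" for x
        using that by (force simp: I_def J_def nbr_leaves_iff)
      have "f x \<in> V" if "x \<in> I" for x
        using Icases[OF that] uv nb_V Yn Un fC f1 fU fY by metis
      then have "f \<in> I \<rightarrow>\<^sub>E V" by (auto simp: f mk_def PiE_def extensional_def)
      moreover have "f ` e \<in> E" if "e \<in> D" for e
      proof -
        obtain x where x: "x \<in> I" "x \<noteq> CentreLeaf 1" "e = {x, att' x}" using \<open>e \<in> D\<close> by (auto simp: D_def)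
        have "{f x, f (att' x)} \<in> E"
          using Icases[OF x(1)] x(2)
        proof (elim disjE bexE)
          assume "x = Centre"
          then show ?thesis using uv by (simp add: att'_def fC f1[simplified] nb_def insert_commute)
        next
          fix i assume "i \<in> {2..\<sigma>}" "x = CentreLeaf i"
          then show ?thesis using Un[of i] by (simp add: att'_def fC fU nb_def insert_commute)
        next
          fix j i assume "j \<in> {1..t}" "i \<in> {1..s}" "x = NbrLeaf j i"
          then show ?thesis
            using Yn[of j i] f1 fY[of j i] by (simp add: att'_def nb_def insert_commute)
        qed blast
        then show ?thesis by (simp add: x(3))
      qed
      ultimately have "f \<in> hom I D" by (simp add: homs_def)
      moreover have "(\<lambda>i. f (NbrLeaf j i)) ` {1..s} = Y j ` {1..s}" if "j \<in> {1..t}" for j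
        using fY that by (intro image_cong) auto
      ultimately show "f \<in> \<Theta>" using Ya by (simp add: \<Theta>_def fC ample_leaves_def)
    qed
  qed
  then have \<Theta>_large: "\<kappa> * N * d ^ (s * t + \<sigma>) \<le> card \<Theta>" using Dom_large by linarith
  define \<Theta>i where "\<Theta>i = {f \<in> \<Theta>. inj_on f I}"
  have "card \<Theta> \<le> card (\<Theta>i \<union> {f \<in> hom I D. \<not> inj_on f I})"
    using finite_hom[OF finJ(2)] fin\<Theta> by (intro card_mono) (auto simp: \<Theta>i_def \<Theta>_def)
  also have "\<dots> \<le> card \<Theta>i + card {f \<in> hom I D. \<not> inj_on f I}" by (rule card_Un_le)
  finally have split: "card \<Theta> \<le> card \<Theta>i + card {f \<in> hom I D. \<not> inj_on f I}" .
  have "2 * (card {f \<in> hom I D. \<not> inj_on f I} * d) \<le> 2 * ((card I)^2 * (N ^ 1 * (K * d) ^ (\<sigma> + s * t)))"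
    using card_hom_noninj[OF bI] by simp
  also have "\<dots> = (2 * (1 + \<sigma> + s * t)^2 * K ^ (\<sigma> + s * t)) * (N * d ^ (\<sigma> + s * t))"
    by (simp add: cardI power_mult_distrib)
  also have "\<dots> \<le> (\<kappa> * d) * (N * d ^ (\<sigma> + s * t))"
    using d1 Kd by (intro mult_right_mono) auto
  also have "\<dots> = (\<kappa> * N * d ^ (s * t + \<sigma>)) * d" by (simp add: mult_ac add.commute)
  finally have "(2 * card {f \<in> hom I D. \<not> inj_on f I}) * d \<le> (\<kappa> * N * d ^ (s * t + \<sigma>)) * d" by simp
  then have "2 * card {f \<in> hom I D. \<not> inj_on f I} \<le> \<kappa> * N * d ^ (s * t + \<sigma>)"
    using Kd by simp
  then have \<Theta>i_large: "\<kappa> * N * d ^ (s * t + \<sigma>) \<le> 2 * real (card \<Theta>i)"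
    using \<Theta>_large split by linarith
  \<comment> \<open>Members of one fibre differ only at \<open>Centre\<close>, so a large fibre
    offers many centres over the same roots.\<close>
  have "\<exists>g\<in>hom J DJ. real (p * (t + 1)) < real (card {f \<in> \<Theta>i. restrict f J = g})"
  proof (rule exists_large_fibre)
    show "finite (hom J DJ)" using finite_hom finJ by blast
    show "finite \<Theta>i" using fin\<Theta> by (simp add: \<Theta>i_def)
    show "(\<lambda>f. restrict f J) ` \<Theta>i \<subseteq> hom J DJ"
    proof
      fix g assume "g \<in> (\<lambda>f. restrict f J) ` \<Theta>i"
      then obtain f where f: "f \<in> hom I D" "g = restrict f J" by (auto simp: \<Theta>i_def \<Theta>_def)
      have "DJ \<subseteq> D"
      proof
        fix e assume "e \<in> DJ"
        then obtain x where x: "x \<in> nbr_leaves s t" "e = {x, CentreLeaf 1}" by (auto simp: DJ_def)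
        then have "att' x = CentreLeaf 1" "x \<in> I - {CentreLeaf 1}"
          by (auto simp: nbr_leaves_iff att'_def I_def J_def)
        then show "e \<in> D" unfolding D_def x(2) by (intro image_eqI[of _ _ x]) simp_all
      qed
      moreover have "\<forall>e\<in>DJ. e \<subseteq> J" using cl1 by (auto simp: DJ_def J_def)
      ultimately show "g \<in> hom J DJ"
        unfolding f(2) by (intro homs_restrict[OF f(1)]) (auto simp: I_def)
    qed
    have "2 * (real (card (hom J DJ)) * real (p * (t + 1)))
      \<le> 2 * ((N ^ \<sigma> * (K * d) ^ (s * t)) * real (p * (t + 1)))"
      using card_hom_tree(2)[OF bJ] by (intro mult_left_mono mult_right_mono) auto
    also have "\<dots> = (2 * (p * (t + 1)) * K ^ (s * t) * N ^ (\<sigma> - 1)) * (N * d ^ (s * t))"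
    proof -
      have "N ^ \<sigma> = N * N ^ (\<sigma> - 1)" using \<sigma>1 by (cases \<sigma>) simp_all
      then show ?thesis by (simp add: power_mult_distrib mult_ac)
    qed
    also have "\<dots> < (\<kappa> * d ^ \<sigma>) * (N * d ^ (s * t))"
      using d2 Kd N_ge_1 by (intro mult_strict_right_mono) auto
    also have "\<dots> = \<kappa> * N * d ^ (s * t + \<sigma>)" by (simp add: power_add mult_ac)
    finally show "real (card (hom J DJ)) * real (p * (t + 1)) < real (card \<Theta>i)"
      using \<Theta>i_large by linarith
  qed
  then obtain g where "real (p * (t + 1)) < real (card {f \<in> \<Theta>i. restrict f J = g})" by blast
  then have g: "p * (t + 1) < card {f \<in> \<Theta>i. restrict f J = g}" by (simp only: of_nat_less_iff)
  show False
  proof (rule sunflower_contra[of g])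
    fix W :: "'v set" assume W: "finite W" "card W \<le> p * (t + 1)"
    let ?Fg = "{f \<in> \<Theta>i. restrict f J = g}"
    have "inj_on (\<lambda>f. f Centre) ?Fg"
    proof (rule inj_onI)
      fix f f' assume ff: "f \<in> ?Fg" "f' \<in> ?Fg" "f Centre = f' Centre"
      then have ex: "f \<in> I \<rightarrow>\<^sub>E V" "f' \<in> I \<rightarrow>\<^sub>E V" by (auto simp: \<Theta>i_def \<Theta>_def homs_def)
      have req: "restrict f J = restrict f' J" using ff by simp
      have "f x = f' x" if "x \<in> J" for x using fun_cong[OF req, of x] that by simp
      then show "f = f'" using ff(3) by (intro PiE_eqI[OF ex]) (auto simp: I_def)
    qed
    then have "card ((\<lambda>f. f Centre) ` ?Fg) = card ?Fg" by (rule card_image)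
    then have "card W < card ((\<lambda>f. f Centre) ` ?Fg)" using g W(2) by linarith
    then have "\<not> (\<lambda>f. f Centre) ` ?Fg \<subseteq> W" using card_mono[OF W(1)] by (meson leD)
    then obtain f where f: "f \<in> \<Theta>i" "restrict f J = g" "f Centre \<notin> W" by auto
    have fi: "inj_on f I" and fh: "f \<in> I \<rightarrow>\<^sub>E V" "\<And>e. e \<in> D \<Longrightarrow> f ` e \<in> E"
      and fa: "\<And>j. j \<in> {1..t} \<Longrightarrow> M \<le> card (common_nb E (insert (f Centre) ((\<lambda>i. f (NbrLeaf j i)) ` {1..s})))"
      using f(1) by (auto simp: \<Theta>i_def \<Theta>_def homs_def)
    have RJ: "RT \<subseteq> J" using \<sigma>1 by (auto simp: T_roots_def J_def)
    have clE: "f (CentreLeaf i) \<in> nb E (f Centre)" if "i \<in> {1..s'}" for i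
    proof -
      have "{CentreLeaf i, Centre} \<in> D"
      proof (cases "i = 1")
        case True
        then show ?thesis by (auto simp: D_def I_def att'_def insert_commute intro!: image_eqI[of _ _ Centre])
      next
        case False
        then show ?thesis using that \<sigma>1
          by (auto simp: D_def I_def J_def att'_def intro!: image_eqI[of _ _ "CentreLeaf i"])
      qed
      from fh(2)[OF this] show ?thesis by (simp add: nb_def insert_commute)
    qed
    have "Centre \<notin> RT" by (auto simp: T_roots_def nbr_leaves_iff)
    then have fC: "f Centre \<notin> f ` RT" using fi RJ by (auto simp: I_def inj_on_def)
    have "\<exists>h\<in>emb V E VT ET. (\<forall>r\<in>RT. h r = f r) \<and> h ` insert Centre (Nbr ` {1..t}) \<inter> W = {}"
    proof (rule exists_emb_avoiding[OF _ _ _ fC f(3) W(1) clE _ subset_refl])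
      show "inj_on f RT" by (rule inj_on_subset[OF fi]) (use RJ I_def in auto)
      show "f ` RT \<subseteq> V" "f Centre \<in> V" using fh(1) RJ by (auto simp: I_def)
      show "card W + (s * t + s') + t \<le> card (common_nb E (insert (f Centre) ((\<lambda>i. f (NbrLeaf j i)) ` {1..s})))"
        if "j \<in> {1..t}" for j
        using fa[OF that] M W(2) \<sigma>1 by linarith
    qed
    then obtain h where "h \<in> emb V E VT ET" "\<forall>r\<in>RT. h r = f r" "h ` insert Centre (Nbr ` {1..t}) \<inter> W = {}"
      by blast
    moreover from this have "\<forall>r\<in>RT. h r = g r" using f(2) RJ by auto
    ultimately show "\<exists>h\<in>emb V E VT ET. (\<forall>r\<in>RT. h r = g r) \<and> h ` insert Centre (Nbr ` {1..t}) \<inter> W = {}"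
      by blast
  qed
qed

end

section \<open>Trees with \<open>s \<le> s' + 1\<close>\<close>

text \<open>The neighbourhood of \<open>Nbr j\<close> in the tree. If its image is not ample, few
  vertices can serve as \<open>q_j\<close>.\<close>

definition nbr_star :: "nat \<Rightarrow> nat \<Rightarrow> tree_vertex set" where
  "nbr_star s j = insert Centre (NbrLeaf j ` {1..s})"

context power_free_host
begin

abbreviation b :: nat where "b \<equiv> s * t + t + s'"

text \<open>Translates the count of triples \<open>(u, v, y)\<close> to stars of any shape: the
  star's centre is \<open>u\<close>, one distinguished leaf is \<open>v\<close>, and the other
  \<open>s\<close> leaves, enumerated by \<open>e\<close>, form \<open>y\<close>.\<close>

lemma card_ample_stars:
  fixes c :: 'i and A :: "'i set" and \<epsilon> :: real
  assumes "c \<notin> A" "finite A" "card A = s + 1"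
    and few: "(\<Sum>(u, v)\<in>{(u, v). v \<in> nb E u}. real (card (ample_leaves M u v))) \<le> \<epsilon> * N * d ^ (s + 1)"
  shows "real (card {f \<in> hom (insert c A) ((\<lambda>a. {c, a}) ` A). M \<le> card (common_nb E (f ` A))})
    \<le> \<epsilon> * N * d ^ (s + 1)"
proof -
  let ?B = "{f \<in> hom (insert c A) ((\<lambda>a. {c, a}) ` A). M \<le> card (common_nb E (f ` A))}"
  define Pr where "Pr = {(u, v). v \<in> nb E u}"
  have PrS: "Pr = Sigma V (nb E)" using nb_V by (auto simp: Pr_def)
  then have finPr: "finite Pr" using finite_V finite_nb by simp
  have fin_al: "finite (ample_leaves M u v)" for u v
    unfolding ample_leaves_def
    by (rule finite_subset[of _ "{1..s} \<rightarrow>\<^sub>E nb E u"]) (auto simp: finite_nb intro!: finite_PiE)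
  obtain a0 where a0: "a0 \<in> A" using assms(3) by fastforce
  have "card (A - {a0}) = s" using assms(2,3) a0 by simp
  then obtain e where e: "bij_betw e {1..s} (A - {a0})"
    using ex_bij_betw_nat_finite_1[of "A - {a0}"] assms(2) by auto
  then have eA: "e ` {1..s} = A - {a0}" by (simp add: bij_betw_def)
  have A_eq: "A = insert a0 (e ` {1..s})" using a0 eA by auto
  define Z where "Z = Sigma Pr (\<lambda>(u, v). ample_leaves M u v)"
  define \<phi> where "\<phi> = (\<lambda>f :: 'i \<Rightarrow> 'v. ((f c, f a0), \<lambda>i\<in>{1..s}. f (e i)))"
  have "card ?B \<le> card Z"
  proof (rule card_inj_on_le)
    show "finite Z" unfolding Z_def using finPr fin_al by auto
    show "inj_on \<phi> ?B"
    proof (rule inj_onI)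
      fix f g assume fg: "f \<in> ?B" "g \<in> ?B" "\<phi> f = \<phi> g"
      have "f (e i) = g (e i)" if "i \<in> {1..s}" for i
      proof -
        have "(\<lambda>i\<in>{1..s}. f (e i)) = (\<lambda>i\<in>{1..s}. g (e i))" using fg(3) by (simp add: \<phi>_def)
        from fun_cong[OF this, of i] show ?thesis using that by simp
      qed
      moreover have "f c = g c" "f a0 = g a0" using fg(3) by (auto simp: \<phi>_def)
      ultimately have "f x = g x" if "x \<in> insert c A" for x
        using that unfolding A_eq by blast
      then show "f = g" using fg(1,2) by (intro PiE_eqI[of f "insert c A" "\<lambda>_. V" g]) (auto simp: homs_def)
    qed
    show "\<phi> ` ?B \<subseteq> Z"
    proof
      fix z assume "z \<in> \<phi> ` ?B"
      then obtain f where f: "f \<in> ?B" "z = \<phi> f" by blast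
      have fn: "f a \<in> nb E (f c)" if "a \<in> A" for a
        using f(1) that by (auto simp: homs_def nb_def)
      have "insert (f a0) ((\<lambda>i\<in>{1..s}. f (e i)) ` {1..s}) = f ` A"
        unfolding A_eq by (simp add: image_image)
      moreover have "f (e i) \<in> nb E (f c)" if "i \<in> {1..s}" for i
        using fn[of "e i"] imageI[OF that, of e] eA by simp
      ultimately have "(\<lambda>i\<in>{1..s}. f (e i)) \<in> ample_leaves M (f c) (f a0)"
        using f(1) by (auto simp: ample_leaves_def)
      then show "z \<in> Z" using fn[OF a0] by (simp add: Z_def f(2) \<phi>_def Pr_def)
    qed
  qed
  also have "card Z = (\<Sum>(u, v)\<in>Pr. card (ample_leaves M u v))"
    unfolding Z_def using finPr fin_al by (subst card_SigmaI) (auto simp: case_prod_unfold)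
  finally have "real (card ?B) \<le> (\<Sum>(u, v)\<in>Pr. real (card (ample_leaves M u v)))"
    by (simp add: case_prod_unfold flip: of_nat_sum)
  then show ?thesis using few by (simp add: Pr_def)
qed

text \<open>A star that is ample stays rare after extension to the whole tree, because each of the
  remaining \<open>b - (s + 1)\<close> edges contributes a factor of at most \<open>K * d\<close>.
  It serves for stars at \<open>Nbr j\<close> as well as at \<open>Centre\<close>.\<close>

lemma card_ample_T_homs:
  fixes \<epsilon> :: real
  assumes "c \<notin> A" "card A = s + 1" "insert c A \<subseteq> VT" "Centre \<in> insert c A"
    and edges: "att_edges (insert c A) = (\<lambda>a. {c, a}) ` A"
    and few: "(\<Sum>(u, v)\<in>{(u, v). v \<in> nb E u}. real (card (ample_leaves M u v))) \<le> \<epsilon> * N * d ^ (s + 1)"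
  shows "real (card {f \<in> hom VT ET. M \<le> card (common_nb E (f ` A))}) \<le> \<epsilon> * K ^ b * (N * d ^ b)"
proof -
  let ?I0 = "insert c A"
  let ?B = "{f \<in> hom ?I0 (att_edges ?I0). M \<le> card (common_nb E (f ` A))}"
  have "A \<subseteq> VT" using assms(3) by simp
  then have finA: "finite A" by (rule finite_subset[OF _ finite_T(1)])
  have cardI0: "card ?I0 = s + 2" using assms(1,2) finA by simp
  have leb: "s + 1 \<le> b"
    using card_mono[OF finite_T(1) assms(3)] cardI0 card_T_vs[of s t s'] by simp
  have bd: "build ?I0 (att_edges ?I0) VT ET 0 (card VT - card ?I0)"
    using assms(3,4) att_in_T by (intro build_T_extend) auto
  have "{f \<in> hom VT ET. M \<le> card (common_nb E (f ` A))} \<subseteq> {f \<in> hom VT ET. restrict f ?I0 \<in> ?B}"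
  proof safe
    fix f assume f: "f \<in> hom VT ET" "M \<le> card (common_nb E (f ` A))"
    have "att_edges ?I0 \<subseteq> ET" using assms(3) by (auto simp: att_edges_def)
    moreover have "\<forall>e\<in>att_edges ?I0. e \<subseteq> ?I0" unfolding edges by auto
    ultimately show "restrict f ?I0 \<in> hom ?I0 (att_edges ?I0)"
      by (intro homs_restrict[OF f(1) assms(3)])
    show "M \<le> card (common_nb E (restrict f ?I0 ` A))"
      using f(2) by (simp add: image_restrict_eq Int_absorb1 subset_insertI)
  qed
  then have "card {f \<in> hom VT ET. M \<le> card (common_nb E (f ` A))}
     \<le> card {f \<in> hom VT ET. restrict f ?I0 \<in> ?B}"
    using finite_hom[OF finite_T(1)] by (intro card_mono) auto
  also have "real \<dots> \<le> card ?B * N ^ 0 * (K * d) ^ (card VT - card ?I0)"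
  proof (rule conjunct2[OF card_hom_build[OF bd]])
    show "\<forall>e\<in>att_edges ?I0. e \<subseteq> ?I0" unfolding edges by auto
  qed (use finA in auto)
  also have "\<dots> \<le> (\<epsilon> * N * d ^ (s + 1)) * (K * d) ^ (card VT - card ?I0)"
    using card_ample_stars[OF assms(1) finA assms(2) few] Kd_ge_1 unfolding edges
    by (intro mult_right_mono) auto
  also have "\<dots> = (\<epsilon> * N * d ^ b) * K ^ (b - (s + 1))"
  proof -
    have "card VT - card ?I0 = b - (s + 1)" using cardI0 card_T_vs[of s t s'] by simp
    moreover have "d ^ b = d ^ ((s + 1) + (b - (s + 1)))"
      by (rule arg_cong[where f = "\<lambda>x. d ^ x", OF le_add_diff_inverse[OF leb, symmetric]])
    then have "d ^ b = d ^ (s + 1) * d ^ (b - (s + 1))" by (simp only: power_add)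
    ultimately show ?thesis by (simp add: power_mult_distrib)
  qed
  also have "\<dots> \<le> (\<epsilon> * N * d ^ b) * K ^ b"
  proof (rule mult_left_mono)
    show "K ^ (b - (s + 1)) \<le> K ^ b" using K_ge_1 by (intro power_increasing) auto
    \<comment> \<open>The sign of \<open>\<epsilon>\<close> is read off \<open>few\<close>, whose
      left side is a sum of cardinalities.\<close>
    have "0 \<le> (\<Sum>(u, v)\<in>{(u, v). v \<in> nb E u}. real (card (ample_leaves M u v)))"
      by (intro sum_nonneg) auto
    then have "0 \<le> \<epsilon> * (N * d ^ (s + 1))" using few by (simp add: mult.assoc)
    moreover have "0 < N * d ^ (s + 1)" using N_ge_1 d_ge_1 by simp
    ultimately have "0 \<le> \<epsilon>" by (simp only: zero_le_mult_iff) linarith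
    then show "0 \<le> \<epsilon> * N * d ^ b" using d_ge_1 by simp
  qed
  finally show ?thesis by (simp add: mult_ac)
qed

lemma nbr_star_props:
  assumes "j \<in> {1..t}"
  shows "Nbr j \<notin> nbr_star s j" "card (nbr_star s j) = s + 1" "insert (Nbr j) (nbr_star s j) \<subseteq> VT"
    "Centre \<in> insert (Nbr j) (nbr_star s j)"
    "att_edges (insert (Nbr j) (nbr_star s j)) = (\<lambda>a. {Nbr j, a}) ` nbr_star s j"
proof -
  show "card (nbr_star s j) = s + 1"
    unfolding nbr_star_def by (subst card_insert_disjoint) (auto simp: card_image inj_on_def)
  have "insert (Nbr j) (nbr_star s j) - {Centre} = insert (Nbr j) (NbrLeaf j ` {1..s})"
    by (auto simp: nbr_star_def)
  then show "att_edges (insert (Nbr j) (nbr_star s j)) = (\<lambda>a. {Nbr j, a}) ` nbr_star s j"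
    unfolding att_edges_def by (auto simp: nbr_star_def image_image insert_commute)
qed (use assms in \<open>auto simp: nbr_star_def T_vs_def nbr_leaves_iff\<close>)

lemma centre_star_props:
  assumes "A \<subseteq> Nbr ` {1..t} \<union> CentreLeaf ` {1..s'}"
  shows "Centre \<notin> A" "insert Centre A \<subseteq> VT" "Centre \<in> insert Centre A"
    "att_edges (insert Centre A) = (\<lambda>a. {Centre, a}) ` A"
proof -
  have "{x, att x} = {Centre, x}" if "x \<in> A" for x
    using that assms by (auto simp: insert_commute)
  moreover show "Centre \<notin> A" using assms by auto
  ultimately show "att_edges (insert Centre A) = (\<lambda>a. {Centre, a}) ` A"
    unfolding att_edges_def by (auto cong: image_cong)
qed (use assms in \<open>auto simp: T_vs_def\<close>)

text \<open>Given many embeddings that extend to \<open>M1\<close> embeddings with the same roots and the same \<open>q\<^sub>j\<close>,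
  fix everything except \<open>q\<^sub>j\<close> and its first leaf. The image of the centre, being adjacent to all
  the \<open>q\<^sub>j\<close> that occur, takes the role of that leaf.\<close>

lemma few_ample_at_nbr:
  fixes \<epsilon> :: real
  assumes j: "j \<in> {1..t}" and s: "s \<ge> 1" and M1: "M1 > p * (t + 1) + 1"
    and d1: "p * (t + 1) * K ^ b * N ^ (s - 1) < \<epsilon> * d ^ s"
  shows "real (card {f \<in> emb V E VT ET. sunflower_at V E VT ET (insert (Nbr j) RT) M1 f})
    \<le> \<epsilon> * (N * d ^ b)"
proof (rule ccontr)
  define \<Omega> where "\<Omega> = {f \<in> emb V E VT ET. sunflower_at V E VT ET (insert (Nbr j) RT) M1 f}"
  assume "\<not> real (card {f \<in> emb V E VT ET. sunflower_at V E VT ET (insert (Nbr j) RT) M1 f})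
    \<le> \<epsilon> * (N * d ^ b)"
  then have large: "real (card \<Omega>) > \<epsilon> * (N * d ^ b)" by (simp add: \<Omega>_def)
  have \<Omega>h: "f \<in> hom VT ET" "inj_on f VT" if "f \<in> \<Omega>" for f using that by (auto simp: \<Omega>_def emb_def)
  have fin\<Omega>: "finite \<Omega>"
    using finite_hom[OF finite_T(1)] \<Omega>h(1) by (meson finite_subset subsetI)
  define S where "S = insert (Nbr j) (NbrLeaf j ` {1..s})"
  \<comment> \<open>Without \<open>Nbr j\<close> and its first leaf, the other \<open>s - 1\<close>
    leaves at \<open>Nbr j\<close> become isolated. So \<open>J\<close> has \<open>s\<close>
    components, which explains the factor \<open>N ^ s\<close>.\<close>
  define J where "J = VT - {Nbr j, NbrLeaf j 1}"
  define DJ where "DJ = att_edges (VT - S)"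
  have SV: "S \<subseteq> VT" using j by (auto simp: S_def T_vs_def nbr_leaves_iff)
  have cardS: "card S = s + 1"
    unfolding S_def by (subst card_insert_disjoint) (auto simp: card_image inj_on_def)
  have cardVS: "card (VT - S) = b - s"
    using cardS SV card_T_vs[of s t s'] finite_subset[OF SV finite_T(1)] by (simp add: card_Diff_subset)
  have attVS: "att x \<in> VT - S" if "x \<in> VT - S - {Centre}" for x
    using that att_in_T[of x s t s'] by (cases x) (auto simp: S_def T_vs_def nbr_leaves_iff)
  have "Centre \<in> VT - S" by (auto simp: S_def T_vs_def)
  then have b1: "build {} {} (VT - S) DJ 1 (b - s - 1)"
    using build_subtree[of "VT - S" s t s'] attVS cardVS by (auto simp: DJ_def)
  have "build {} {} (NbrLeaf j ` {2..s} \<union> (VT - S)) DJ (card (NbrLeaf j ` {2..s}) + 1) (b - s - 1)"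
    by (rule build_free_set[OF b1]) (auto simp: S_def)
  moreover have "NbrLeaf j ` {2..s} \<union> (VT - S) = J"
    using j by (auto simp: J_def S_def T_vs_def nbr_leaves_iff image_iff)
  moreover have "card (NbrLeaf j ` {2..s}) + 1 = s" using s by (simp add: card_image inj_on_def)
  ultimately have bJ: "build {} {} J DJ s (b - s - 1)" by simp
  have finJ: "finite J" using finite_T by (simp add: J_def)
  have leb: "s + 1 \<le> b" using t_pos mult_le_mono2[OF t_pos, of s] by linarith
  have "\<exists>g\<in>hom J DJ. real (p * (t + 1)) * (K * d) < real (card {f \<in> \<Omega>. restrict f J = g})"
  proof (rule exists_large_fibre[OF finite_hom[OF finJ] _ fin\<Omega>])
    show "(\<lambda>f. restrict f J) ` \<Omega> \<subseteq> hom J DJ"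
    proof
      fix g assume "g \<in> (\<lambda>f. restrict f J) ` \<Omega>"
      then obtain f where f: "f \<in> \<Omega>" "g = restrict f J" by auto
      have "DJ \<subseteq> ET" by (auto simp: DJ_def att_edges_def)
      moreover have "\<forall>e\<in>DJ. e \<subseteq> J"
      proof
        fix e assume "e \<in> DJ"
        then obtain x where "x \<in> VT - S - {Centre}" "e = {x, att x}" by (auto simp: DJ_def att_edges_def)
        then have "e \<subseteq> VT - S" using attVS[of x] by auto
        also have "\<dots> \<subseteq> J" using s by (auto simp: J_def S_def)
        finally show "e \<subseteq> J" .
      qed
      ultimately show "g \<in> hom J DJ"
        unfolding f(2) by (intro homs_restrict[OF \<Omega>h(1)[OF f(1)]]) (auto simp: J_def)
    qed
    have "real (card (hom J DJ)) * (real (p * (t + 1)) * (K * d))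
      \<le> (N ^ s * (K * d) ^ (b - s - 1)) * (real (p * (t + 1)) * (K * d))"
      using card_hom_tree(2)[OF bJ] Kd_ge_1 by (intro mult_right_mono) auto
    also have "\<dots> = real (p * (t + 1)) * K ^ (b - s) * (N ^ s * d ^ (b - s))"
    proof -
      have "b - s = Suc (b - s - 1)" using leb by simp
      then have "(K * d) ^ (b - s - 1) * (K * d) = K ^ (b - s) * d ^ (b - s)"
        by (metis power_Suc2 power_mult_distrib)
      then show ?thesis by (simp add: mult_ac)
    qed
    also have "\<dots> \<le> real (p * (t + 1)) * K ^ b * (N ^ s * d ^ (b - s))"
      using K_ge_1 d_ge_1 by (intro mult_right_mono mult_left_mono power_increasing) auto
    also have "\<dots> = (p * (t + 1) * K ^ b * N ^ (s - 1)) * (N * d ^ (b - s))"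
    proof -
      have "N ^ s = N ^ (s - 1) * N" using s by (intro power_minus_mult[symmetric]) simp
      then show ?thesis by (simp add: mult_ac)
    qed
    also have "\<dots> < (\<epsilon> * d ^ s) * (N * d ^ (b - s))"
      using d1 N_ge_1 d_ge_1 by (intro mult_strict_right_mono) auto
    also have "\<dots> = \<epsilon> * (N * d ^ b)"
      using leb by (simp add: mult_ac flip: power_add)
    finally show "real (card (hom J DJ)) * (real (p * (t + 1)) * (K * d)) < real (card \<Omega>)"
      using large by linarith
  qed
  then obtain g where g: "g \<in> hom J DJ"
    and glarge: "real (p * (t + 1)) * (K * d) < real (card {f \<in> \<Omega>. restrict f J = g})" by blast
  define Fg where "Fg = {f \<in> \<Omega>. restrict f J = g}"
  have finFg: "finite Fg" using fin\<Omega> by (simp add: Fg_def)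
  have Fg_eq: "f x = g x" if "f \<in> Fg" "x \<in> J" for f x
    using that by (auto simp: Fg_def)
  have VT_J: "VT = insert (Nbr j) (insert (NbrLeaf j 1) J)"
    using j s by (auto simp: J_def T_vs_def nbr_leaves_iff)
  \<comment> \<open>Within the fibre, a value of \<open>Nbr j\<close> leaves only its first leaf
    free, at most \<open>K * d\<close> choices. Hence more than \<open>p * (t + 1)\<close> values of
    \<open>Nbr j\<close> occur.\<close>
  have "card Fg \<le> card ((\<lambda>f. f (Nbr j)) ` Fg) * (K * d)"
  proof (rule card_le_fibres[OF finite_imageI[OF finFg] subset_refl finFg])
    fix x assume x: "x \<in> (\<lambda>f. f (Nbr j)) ` Fg"
    then have "x \<in> V" using \<Omega>h(1) VT_J by (auto simp: Fg_def homs_def)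
    have "card {f \<in> Fg. f (Nbr j) = x} \<le> card (nb E x)"
    proof (rule card_inj_on_le[of "\<lambda>f. f (NbrLeaf j 1)"])
      show "inj_on (\<lambda>f. f (NbrLeaf j 1)) {f \<in> Fg. f (Nbr j) = x}"
      proof (rule inj_onI)
        fix f f' assume ff: "f \<in> {f \<in> Fg. f (Nbr j) = x}" "f' \<in> {f \<in> Fg. f (Nbr j) = x}"
          "f (NbrLeaf j 1) = f' (NbrLeaf j 1)"
        show "f = f'"
        proof (rule PiE_eqI[of f VT "\<lambda>_. V" f' "\<lambda>_. V"])
          show "f \<in> VT \<rightarrow>\<^sub>E V" "f' \<in> VT \<rightarrow>\<^sub>E V" using ff \<Omega>h(1) by (auto simp: Fg_def homs_def)
          show "f y = f' y" if "y \<in> VT" for y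
            using that ff(1,2,3) Fg_eq[of f y] Fg_eq[of f' y] unfolding VT_J by auto
        qed
      qed
      show "(\<lambda>f. f (NbrLeaf j 1)) ` {f \<in> Fg. f (Nbr j) = x} \<subseteq> nb E x"
        using \<Omega>h(1) j s by (auto simp: Fg_def homs_T_iff)
      show "finite (nb E x)" by (rule finite_nb)
    qed
    then show "real (card {f \<in> Fg. f (Nbr j) = x}) \<le> K * d"
      using max_deg[OF \<open>x \<in> V\<close>] by linarith
  qed
  then have "real (p * (t + 1)) * (K * d) < real (card ((\<lambda>f. f (Nbr j)) ` Fg)) * (K * d)"
    using glarge by (simp add: Fg_def)
  then have Xlarge: "p * (t + 1) < card ((\<lambda>f. f (Nbr j)) ` Fg)"
    using Kd_ge_1 by (simp only: mult_less_cancel_right of_nat_less_iff)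
  \<comment> \<open>All members of the fibre have the same centre \<open>g Centre\<close>, adjacent
    to each of their \<open>q_j\<close>; it becomes a root.\<close>
  define \<xi> where "\<xi> = g(NbrLeaf j 1 := g Centre)"
  show False
  proof (rule sunflower_contra[of \<xi>])
    fix W :: "'v set" assume W: "finite W" "card W \<le> p * (t + 1)"
    have "\<not> (\<lambda>f. f (Nbr j)) ` Fg \<subseteq> W" using card_mono[OF W(1)] W(2) Xlarge by (meson leD le_trans)
    then obtain f where f: "f \<in> Fg" "f (Nbr j) \<notin> W" by blast
    then have f\<Omega>: "f \<in> \<Omega>" by (simp add: Fg_def)
    obtain P where P: "card P = M1" "P \<subseteq> emb V E VT ET"
       "\<forall>h\<in>P. \<forall>r\<in>insert (Nbr j) RT. h r = f r"
       "\<forall>f\<in>P. \<forall>g\<in>P. f \<noteq> g \<longrightarrow> f ` (VT - insert (Nbr j) RT) \<inter> g ` (VT - insert (Nbr j) RT) = {}"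
      using f\<Omega> by (auto simp: \<Omega>_def sunflower_at_def)
    \<comment> \<open>The member to be chosen must avoid \<open>W\<close> and also
      \<open>f Centre\<close>, which is now a leaf. This accounts for the \<open>+ 1\<close> in the
      bound on \<open>M1\<close>.\<close>
    have "card (insert (f Centre) W) < card P"
      using W M1 P(1) card_insert_if[OF W(1), of "f Centre"] by (simp split: if_splits)
    from disjoint_family_avoids[OF _ this, of "\<lambda>h. h ` (VT - insert (Nbr j) RT)"]
    obtain h where h: "h \<in> P" "h ` (VT - insert (Nbr j) RT) \<inter> insert (f Centre) W = {}"
      using P(4) W(1) by blast
    have hh: "h \<in> hom VT ET" "inj_on h VT" using P(2) h(1) by (auto simp: emb_def)
    have hf: "h r = f r" if "r \<in> insert (Nbr j) RT" for r using P(3) h(1) that by blast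
    have l1: "NbrLeaf j 1 \<in> RT" "NbrLeaf j 1 \<in> VT" "Nbr j \<in> VT" "Centre \<in> VT"
      using j s by (auto simp: T_roots_def T_vs_def nbr_leaves_iff)
    have RV: "RT \<subseteq> VT" by (rule T_roots_subset)
    define k where "k = h(NbrLeaf j 1 := f Centre)"
    have k2: "k x = h x" if "x \<noteq> NbrLeaf j 1" for x
      using that by (auto simp: k_def)
    have fC: "f Centre \<noteq> h x" if "x \<in> VT" for x
    proof (cases "x \<in> insert (Nbr j) RT")
      case True
      moreover have "x \<noteq> Centre" using True by (auto simp: T_roots_def nbr_leaves_iff)
      ultimately show ?thesis
        using hf[OF True] \<Omega>h(2)[OF f\<Omega>] that l1(4) by (metis inj_onD)
    next
      case False
      then show ?thesis using h(2) that by blast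
    qed
    have "f (Nbr j) \<in> nb E (f Centre)"
      using \<Omega>h(1)[OF f\<Omega>] j by (simp add: homs_T_iff)
    moreover from this have "f Centre \<in> V" using nb_V by blast
    ultimately have "k \<in> hom VT ET"
      using hh(1) l1(2) hf[of "Nbr j"] nb_sym[of "f Centre" E "f (Nbr j)"]
      by (auto simp: homs_T_iff k_def PiE_def extensional_def)
    moreover have "inj_on k VT"
      using hh(2) fC unfolding k_def by (intro inj_on_fun_updI) (auto simp: image_iff)
    ultimately have "k \<in> emb V E VT ET" by (simp add: emb_def)
    moreover have "\<forall>r\<in>RT. k r = \<xi> r"
    proof
      fix r assume r: "r \<in> RT"
      show "k r = \<xi> r"
      proof (cases "r = NbrLeaf j 1")
        case True
        have "Centre \<in> J" by (auto simp: J_def T_vs_def)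
        then show ?thesis using True Fg_eq[OF f(1), of Centre] by (simp add: k_def \<xi>_def)
      next
        case False
        moreover have "r \<in> VT" using RV r by blast
        moreover have "r \<noteq> Nbr j" using r by (auto simp: T_roots_def nbr_leaves_iff)
        ultimately have "r \<in> J" by (simp add: J_def)
        then show ?thesis using False hf[of r] r Fg_eq[OF f(1), of r] by (simp add: k_def \<xi>_def)
      qed
    qed
    moreover have "k x \<notin> W" if "x \<in> insert Centre (Nbr ` {1..t})" for x
    proof (cases "x = Nbr j")
      case True
      then show ?thesis using f(2) hf[of "Nbr j"] k2[of x] by simp
    next
      case False
      then have "x \<in> VT - insert (Nbr j) RT"
        using that T_nonroots[of s t s'] by auto
      then show ?thesis using h(2) k2[of x] that by auto
    qed
    ultimately show "\<exists>k\<in>emb V E VT ET. (\<forall>r\<in>RT. k r = \<xi> r) \<and> k ` insert Centre (Nbr ` {1..t}) \<inter> W = {}"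
      by blast
  qed
qed

text \<open>Once roots and centre are fixed, so are the images of all \<open>nbr_star s j\<close>,
  and each \<open>q_j\<close> has fewer than \<open>M\<close> candidates.\<close>

lemma card_through_centre:
  assumes \<Phi>: "\<Phi> \<subseteq> emb V E VT ET"
    and nbr: "\<And>f j. f \<in> \<Phi> \<Longrightarrow> j \<in> {1..t} \<Longrightarrow> card (common_nb E (f ` nbr_star s j)) < M"
    and roots: "\<And>f g r. f \<in> \<Phi> \<Longrightarrow> g \<in> \<Phi> \<Longrightarrow> r \<in> RT \<Longrightarrow> f r = g r"
  shows "card {f \<in> \<Phi>. f Centre = v} \<le> M ^ t"
proof (cases "{f \<in> \<Phi>. f Centre = v} = {}")
  case True
  then show ?thesis by (simp only: card.empty le0)
next
  case False
  have Fh: "f \<in> hom VT ET" if "f \<in> \<Phi>" for f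
    using that \<Phi> by (auto simp: emb_def)
  have star_leaf: "NbrLeaf j i \<in> RT" if "j \<in> {1..t}" "i \<in> {1..s}" for j i
    using that by (auto simp: T_roots_def nbr_leaves_iff)
  from False obtain f0 where f0: "f0 \<in> \<Phi>" "f0 Centre = v" by blast
  define C where "C = (\<lambda>j. common_nb E (f0 ` nbr_star s j))"
  have finC: "finite (C j)" for j unfolding C_def by (rule finite_common_nb) (simp add: nbr_star_def)
  have "card {f \<in> \<Phi>. f Centre = v} \<le> card (Pi\<^sub>E {1..t} C)"
  proof (rule card_inj_on_le[of "\<lambda>f. \<lambda>j\<in>{1..t}. f (Nbr j)"])
    show "inj_on (\<lambda>f. \<lambda>j\<in>{1..t}. f (Nbr j)) {f \<in> \<Phi>. f Centre = v}"
    proof (rule inj_onI)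
      fix f g assume fg: "f \<in> {f \<in> \<Phi>. f Centre = v}" "g \<in> {f \<in> \<Phi>. f Centre = v}"
        "(\<lambda>j\<in>{1..t}. f (Nbr j)) = (\<lambda>j\<in>{1..t}. g (Nbr j))"
      have "f (Nbr j) = g (Nbr j)" if "j \<in> {1..t}" for j
        using fun_cong[OF fg(3), of j] that by simp
      then have "f x = g x" if "x \<in> VT" for x
        using that fg(1,2) roots[of f g x] unfolding T_vs_def T_roots_def by auto
      moreover have "f \<in> VT \<rightarrow>\<^sub>E V" "g \<in> VT \<rightarrow>\<^sub>E V" using fg(1,2) Fh by (auto simp: homs_def)
      ultimately show "f = g" by (intro PiE_eqI)
    qed
    show "(\<lambda>f. \<lambda>j\<in>{1..t}. f (Nbr j)) ` {f \<in> \<Phi>. f Centre = v} \<subseteq> Pi\<^sub>E {1..t} C"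
    proof
      fix q assume "q \<in> (\<lambda>f. \<lambda>j\<in>{1..t}. f (Nbr j)) ` {f \<in> \<Phi>. f Centre = v}"
      then obtain f where f: "f \<in> \<Phi>" "f Centre = v" "q = (\<lambda>j\<in>{1..t}. f (Nbr j))" by blast
      have "f (Nbr j) \<in> C j" if j: "j \<in> {1..t}" for j
      proof -
        have "f0 x \<in> nb E (f (Nbr j))" if x: "x \<in> nbr_star s j" for x
        proof -
          have "f0 x = f x"
            using x f(1,2) f0 roots[of f0 f x] star_leaf[OF j] by (auto simp: nbr_star_def)
          moreover have "f x \<in> nb E (f (Nbr j))"
            using x j Fh[OF f(1)] nb_sym[of "f Centre" E "f (Nbr j)"]
            by (auto simp: nbr_star_def homs_T_iff)
          ultimately show ?thesis by simp
        qed
        then show ?thesis by (auto simp: C_def common_nb_iff)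
      qed
      then show "q \<in> Pi\<^sub>E {1..t} C" by (simp add: f(3))
    qed
    show "finite (Pi\<^sub>E {1..t} C)" by (intro finite_PiE finC) simp
  qed
  also have "\<dots> = (\<Prod>j\<in>{1..t}. card (C j))" by (rule card_PiE) simp
  also have "\<dots> \<le> (\<Prod>j\<in>{1..t}. M)"
    using nbr f0 by (intro prod_mono) (auto simp: C_def intro: less_imp_le)
  finally show ?thesis by simp
qed

text \<open>A large family with the same roots and no disjoint members has a vertex shared by many of its
  members; the star and ampleness conditions bound the members through any fixed vertex.\<close>

lemma bounded_root_fibres:
  fixes M M1 :: nat
  assumes s: "s \<ge> 1" "s \<le> s' + 1" and \<Phi>: "\<Phi> \<subseteq> emb V E VT ET"
    and nbr: "\<And>f j. f \<in> \<Phi> \<Longrightarrow> j \<in> {1..t} \<Longrightarrow> card (common_nb E (f ` nbr_star s j)) < M"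
    and centre: "\<And>f A. f \<in> \<Phi> \<Longrightarrow> A \<subseteq> Nbr ` {1..t} \<union> CentreLeaf ` {1..s'} \<Longrightarrow> card A = s + 1 \<Longrightarrow>
       card (common_nb E (f ` A)) < M"
    and ample: "\<And>f j. f \<in> \<Phi> \<Longrightarrow> j \<in> {1..t} \<Longrightarrow> s' < s \<Longrightarrow>
       \<not> sunflower_at V E VT ET (insert (Nbr j) RT) M1 f"
  shows "card {f \<in> \<Phi>. restrict f RT = \<xi>} \<le>
    p * (t + 1) * (M ^ t + t * (M ^ (t + 1) + M1 * t * (M ^ t + t * M ^ (t + 1))))"
proof -
  define Fx where "Fx = {f \<in> \<Phi>. restrict f RT = \<xi>}"
  have Fx_roots: "f r = g r" if "f \<in> Fx" "g \<in> Fx" "r \<in> RT" for f g r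
  proof -
    have eq: "restrict f RT = restrict g RT" using that by (simp add: Fx_def)
    show ?thesis using fun_cong[OF eq, of r] that(3) by simp
  qed
  have Fh: "f \<in> hom VT ET" "f \<in> emb V E VT ET" if "f \<in> Fx" for f
    using that \<Phi> by (auto simp: Fx_def emb_def)
  have finFx: "finite Fx"
    using finite_hom[OF finite_T(1)] Fh(1) by (meson finite_subset subsetI)
  have through_centre: "card {f \<in> Fx. f Centre = v} \<le> M ^ t" for v
    using Fh(2) nbr Fx_roots by (intro card_through_centre) (auto simp: Fx_def)
  \<comment> \<open>Fixing \<open>s + 1\<close> neighbours of the centre leaves fewer than
    \<open>M\<close> centres, and each centre carries at most \<open>M ^ t\<close> members.\<close>
  have through_star: "card {f \<in> Fx. \<forall>a\<in>A. f a = \<eta> a} \<le> M ^ (t + 1)"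
    if A: "A \<subseteq> Nbr ` {1..t} \<union> CentreLeaf ` {1..s'}" "card A = s + 1" for A \<eta>
  proof (cases "{f \<in> Fx. \<forall>a\<in>A. f a = \<eta> a} = {}")
    case True
    then show ?thesis by (simp only: card.empty le0)
  next
    case False
    let ?G = "{f \<in> Fx. \<forall>a\<in>A. f a = \<eta> a}"
    obtain f0 where f0: "f0 \<in> ?G" using False by blast
    define C where "C = common_nb E (f0 ` A)"
    have "A \<noteq> {}" using A(2) by auto
    then have finC: "finite C" unfolding C_def by (intro finite_common_nb) simp
    have "real (card ?G) \<le> real (card C) * real (M ^ t)"
    proof (rule card_le_fibres[OF finC])
      show "(\<lambda>f. f Centre) ` ?G \<subseteq> C"
      proof
        fix v assume "v \<in> (\<lambda>f. f Centre) ` ?G"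
        then obtain f where f: "f \<in> ?G" "v = f Centre" by blast
        have "f0 a \<in> nb E v" if "a \<in> A" for a
        proof -
          have "a \<in> Nbr ` {1..t} \<union> CentreLeaf ` {1..s'}" using A(1) that by blast
          moreover have "f \<in> hom VT ET" using f(1) Fh(1) by simp
          ultimately have "f a \<in> nb E (f Centre)" by (auto simp: homs_T_iff)
          then show ?thesis using f f0 that by simp
        qed
        then show "v \<in> C" by (auto simp: C_def common_nb_iff)
      qed
      show "finite ?G" using finFx by simp
      fix v
      have "card {f \<in> ?G. f Centre = v} \<le> card {f \<in> Fx. f Centre = v}"
        using finFx by (intro card_mono) auto
      then show "real (card {f \<in> ?G. f Centre = v}) \<le> real (M ^ t)"
        using through_centre[of v] by linarith
    qed
    also have "\<dots> \<le> real M * real (M ^ t)"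
      using centre[of f0 A] f0 A by (intro mult_right_mono) (auto simp: C_def Fx_def)
    finally have "real (card ?G) \<le> real (M * M ^ t)" by simp
    then show ?thesis by (simp only: of_nat_le_iff) simp
  qed
  have through_nbr: "card {f \<in> Fx. f (Nbr j) = x} \<le>
      M ^ (t + 1) + M1 * t * (M ^ t + t * M ^ (t + 1))" if j: "j \<in> {1..t}" for j x
  proof (cases "{f \<in> Fx. f (Nbr j) = x} = {}")
    case True
    then show ?thesis by (simp only: card.empty le0)
  next
    case False
    let ?G = "{f \<in> Fx. f (Nbr j) = x}"
    obtain f0 where f0: "f0 \<in> ?G" using False by blast
    \<comment> \<open>If \<open>s <= s'\<close>, \<open>Nbr j\<close> and \<open>s\<close> of the
      \<open>CentreLeaf\<close>s form a star of \<open>s + 1\<close> fixed neighbours of the centre.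
      If \<open>s = s' + 1\<close> they are one short; then \<open>ample\<close> yields a small set
      meeting all members through \<open>x\<close>, which fixes either the centre or a further
      \<open>Nbr i\<close>.\<close>
    show ?thesis
    proof (cases "s \<le> s'")
      case True
      let ?A = "insert (Nbr j) (CentreLeaf ` {1..s})"
      have A: "?A \<subseteq> Nbr ` {1..t} \<union> CentreLeaf ` {1..s'}" "card ?A = s + 1"
        using True j by (auto simp: card_insert_if card_image inj_on_def)
      have "f a = f0 a" if "f \<in> ?G" "a \<in> ?A" for f a
        using that f0 Fx_roots[of f f0 a] True by (auto simp: T_roots_def)
      then have "card ?G \<le> card {f \<in> Fx. \<forall>a\<in>?A. f a = f0 a}"
        using finFx by (intro card_mono) auto
      then show ?thesis using through_star[OF A, of f0] by linarith
    next
      case False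
      then have s': "s' = s - 1" "s' < s" using s by auto
      have "\<not> sunflower_at V E VT ET (insert (Nbr j) RT) M1 f0"
        using ample[OF _ j s'(2)] f0 by (auto simp: Fx_def)
      moreover have nr: "VT - insert (Nbr j) RT = insert Centre (Nbr ` ({1..t} - {j}))"
        using T_nonroots[of s t s'] by auto
      ultimately obtain W where W: "finite W" "card W \<le> M1 * card (insert Centre (Nbr ` ({1..t} - {j})))"
        "\<And>f. f \<in> emb V E VT ET \<Longrightarrow> (\<And>r. r \<in> insert (Nbr j) RT \<Longrightarrow> f r = f0 r) \<Longrightarrow>
           f ` insert Centre (Nbr ` ({1..t} - {j})) \<inter> W \<noteq> {}"
        using cover_if_no_sunflower[of VT "insert (Nbr j) RT" V E ET M1 f0] finite_T
        by (metis empty_not_insert)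
      have cW: "card W \<le> M1 * t"
      proof -
        have "card (Nbr ` ({1..t} - {j})) = t - 1" using j by (simp add: card_image inj_on_def)
        moreover have "Centre \<notin> Nbr ` ({1..t} - {j})" by auto
        ultimately have "card (insert Centre (Nbr ` ({1..t} - {j}))) = t" using t_pos by simp
        then show ?thesis using W(2) by simp
      qed
      let ?Gw = "\<lambda>w. {f \<in> Fx. f Centre = w} \<union> (\<Union>i\<in>{1..t} - {j}. {f \<in> ?G. f (Nbr i) = w})"
      have "card ?G \<le> card (\<Union>w\<in>W. ?Gw w)"
      proof (rule card_mono)
        show "finite (\<Union>w\<in>W. ?Gw w)" using finFx W(1) by auto
        show "?G \<subseteq> (\<Union>w\<in>W. ?Gw w)"
        proof
          fix f assume f: "f \<in> ?G"
          have "f r = f0 r" if "r \<in> insert (Nbr j) RT" for r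
            using that f f0 Fx_roots[of f f0 r] by auto
          then have "f ` insert Centre (Nbr ` ({1..t} - {j})) \<inter> W \<noteq> {}"
            using W(3)[of f] Fh(2) f by blast
          then show "f \<in> (\<Union>w\<in>W. ?Gw w)" using f by blast
        qed
      qed
      also have "\<dots> \<le> (\<Sum>w\<in>W. card (?Gw w))" by (rule card_UN_le[OF W(1)])
      also have "\<dots> \<le> (\<Sum>w\<in>W. M ^ t + t * M ^ (t + 1))"
      proof (rule sum_mono)
        fix w
        have "card (\<Union>i\<in>{1..t} - {j}. {f \<in> ?G. f (Nbr i) = w})
            \<le> (\<Sum>i\<in>{1..t} - {j}. card {f \<in> ?G. f (Nbr i) = w})" by (rule card_UN_le) simp
        also have "\<dots> \<le> (\<Sum>i\<in>{1..t} - {j}. M ^ (t + 1))"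
        proof (rule sum_mono)
          fix i assume i: "i \<in> {1..t} - {j}"
          let ?A = "insert (Nbr i) (insert (Nbr j) (CentreLeaf ` {1..s'}))"
          define \<eta> where "\<eta> = (\<lambda>a. if a = Nbr i then w else f0 a)"
          have A: "?A \<subseteq> Nbr ` {1..t} \<union> CentreLeaf ` {1..s'}" "card ?A = s + 1"
            using i j s' s by (auto simp: card_insert_if card_image inj_on_def)
          have "f a = \<eta> a" if "f \<in> ?G" "f (Nbr i) = w" "a \<in> ?A" for f a
            using that f0 Fx_roots[of f f0 a] by (auto simp: T_roots_def \<eta>_def)
          then have "card {f \<in> ?G. f (Nbr i) = w} \<le> card {f \<in> Fx. \<forall>a\<in>?A. f a = \<eta> a}"
            using finFx by (intro card_mono) auto
          then show "card {f \<in> ?G. f (Nbr i) = w} \<le> M ^ (t + 1)"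
            using through_star[OF A, of \<eta>] by linarith
        qed
        also have "\<dots> \<le> t * M ^ (t + 1)" using j by simp
        finally show "card (?Gw w) \<le> M ^ t + t * M ^ (t + 1)"
          using card_Un_le[of "{f \<in> Fx. f Centre = w}" "\<Union>i\<in>{1..t} - {j}. {f \<in> ?G. f (Nbr i) = w}"]
            through_centre[of w] by linarith
      qed
      also have "\<dots> = card W * (M ^ t + t * M ^ (t + 1))" by simp
      also have "\<dots> \<le> M1 * t * (M ^ t + t * M ^ (t + 1))" by (rule mult_le_mono1[OF cW])
      finally show ?thesis by linarith
    qed
  qed
  \<comment> \<open>The same covering argument with the roots alone as kernel: every member passes
    through one of boundedly many vertices, at its centre or at some \<open>Nbr j\<close>.\<close>
  obtain W where W: "finite W" "card W \<le> p * (t + 1)"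
    "\<forall>f\<in>emb V E VT ET. (\<forall>r\<in>RT. f r = \<xi> r) \<longrightarrow> f ` insert Centre (Nbr ` {1..t}) \<inter> W \<noteq> {}"
    by (rule root_cover[of \<xi>])
  let ?c = "M ^ (t + 1) + M1 * t * (M ^ t + t * M ^ (t + 1))"
  let ?Gw = "\<lambda>w. {f \<in> Fx. f Centre = w} \<union> (\<Union>j\<in>{1..t}. {f \<in> Fx. f (Nbr j) = w})"
  have "card Fx \<le> card (\<Union>w\<in>W. ?Gw w)"
  proof (rule card_mono)
    show "finite (\<Union>w\<in>W. ?Gw w)" using finFx W(1) by auto
    show "Fx \<subseteq> (\<Union>w\<in>W. ?Gw w)"
    proof
      fix f assume f: "f \<in> Fx"
      have "f r = \<xi> r" if "r \<in> RT" for r using f that by (auto simp: Fx_def)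
      then have "f ` insert Centre (Nbr ` {1..t}) \<inter> W \<noteq> {}"
        using W(3) Fh(2)[OF f] by blast
      then show "f \<in> (\<Union>w\<in>W. ?Gw w)" using f by blast
    qed
  qed
  also have "\<dots> \<le> (\<Sum>w\<in>W. card (?Gw w))" by (rule card_UN_le[OF W(1)])
  also have "\<dots> \<le> (\<Sum>w\<in>W. M ^ t + t * ?c)"
  proof (rule sum_mono)
    fix w
    have "card (\<Union>j\<in>{1..t}. {f \<in> Fx. f (Nbr j) = w})
        \<le> (\<Sum>j\<in>{1..t}. card {f \<in> Fx. f (Nbr j) = w})" by (rule card_UN_le) simp
    also have "\<dots> \<le> (\<Sum>j\<in>{1..t}. ?c)" by (intro sum_mono through_nbr)
    also have "\<dots> = t * ?c" by simp
    finally show "card (?Gw w) \<le> M ^ t + t * ?c"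
      using card_Un_le[of "{f \<in> Fx. f Centre = w}" "\<Union>j\<in>{1..t}. {f \<in> Fx. f (Nbr j) = w}"]
        through_centre[of w] by linarith
  qed
  also have "\<dots> = card W * (M ^ t + t * ?c)" by simp
  also have "\<dots> \<le> p * (t + 1) * (M ^ t + t * ?c)" by (rule mult_le_mono1[OF W(2)])
  finally show ?thesis by (simp add: Fx_def)
qed

section \<open>Typical embeddings and the contradiction for \<open>s <= s' + 1\<close>\<close>

definition nbr_good :: "nat \<Rightarrow> (tree_vertex \<Rightarrow> 'v) set" where
  "nbr_good M = {f \<in> emb V E VT ET. \<forall>j\<in>{1..t}. card (common_nb E (f ` nbr_star s j)) < M}"

text \<open>Non-injective maps and ample stars at the \<open>Nbr j\<close> each cost at most one
  eighth of \<open>N * d ^ b\<close>. Both cases of the theorem start from here.\<close>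

lemma card_homs_minus_nbr_good:
  fixes \<epsilon> :: real
  assumes few: "(\<Sum>(u, v)\<in>{(u, v). v \<in> nb E u}. real (card (ample_leaves M u v))) \<le> \<epsilon> * N * d ^ (s + 1)"
    and d: "8 * (b + 1)^2 * K ^ b \<le> d" and \<epsilon>: "8 * t * (\<epsilon> * K ^ b) \<le> 1"
  shows "3 / 4 * (N * d ^ b) \<le> card (nbr_good M)"
proof -
  let ?Bad = "\<lambda>j. {f \<in> hom VT ET. M \<le> card (common_nb E (f ` nbr_star s j))}"
  let ?Non = "{f \<in> hom VT ET. \<not> inj_on f VT}"
  have fin: "finite (hom VT ET)" by (rule finite_hom[OF finite_T(1)])
  have "hom VT ET \<subseteq> nbr_good M \<union> (?Non \<union> (\<Union>j\<in>{1..t}. ?Bad j))"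
    by (auto simp: nbr_good_def emb_def not_le)
  then have "card (hom VT ET) \<le> card (nbr_good M \<union> (?Non \<union> (\<Union>j\<in>{1..t}. ?Bad j)))"
    using fin by (intro card_mono) (auto simp: nbr_good_def emb_def)
  also have "\<dots> \<le> card (nbr_good M) + (card ?Non + (\<Sum>j\<in>{1..t}. card (?Bad j)))"
    by (intro order.trans[OF card_Un_le] add_left_mono order.refl add_mono card_UN_le finite_atLeastAtMost)
  finally have "real (card (hom VT ET)) \<le> card (nbr_good M) + (card ?Non + (\<Sum>j\<in>{1..t}. real (card (?Bad j))))"
    by (simp only: flip: of_nat_sum of_nat_add of_nat_le_iff)
  moreover have "N * d ^ b \<le> card (hom VT ET)" using card_hom_tree(1)[OF build_T, of s t s'] by simp
  moreover have "8 * real (card ?Non) \<le> N * d ^ b"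
  proof -
    have "(8 * real (card ?Non)) * d = 8 * (real (card ?Non) * d)" by simp
    also have "\<dots> \<le> 8 * ((b + 1)^2 * (N ^ 1 * (K * d) ^ b))"
      using card_hom_noninj[OF build_T, of s t s'] by (simp add: card_T_vs)
    also have "\<dots> = (8 * (b + 1)^2 * K ^ b) * (N * d ^ b)" by (simp add: power_mult_distrib)
    also have "\<dots> \<le> d * (N * d ^ b)" using d d_ge_1 by (intro mult_right_mono) auto
    finally show ?thesis using d_ge_1 by (simp add: mult.commute)
  qed
  moreover have "8 * (\<Sum>j\<in>{1..t}. real (card (?Bad j))) \<le> N * d ^ b"
  proof -
    have "(\<Sum>j\<in>{1..t}. real (card (?Bad j))) \<le> (\<Sum>j\<in>{1..t}. \<epsilon> * K ^ b * (N * d ^ b))"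
      by (intro sum_mono card_ample_T_homs[OF nbr_star_props few]) auto
    then have "8 * (\<Sum>j\<in>{1..t}. real (card (?Bad j))) \<le> (8 * t * (\<epsilon> * K ^ b)) * (N * d ^ b)"
      by (simp add: mult_ac)
    also have "\<dots> \<le> 1 * (N * d ^ b)" using \<epsilon> d_ge_1 by (intro mult_right_mono) auto
    finally show ?thesis by simp
  qed
  ultimately show ?thesis by linarith
qed

text \<open>At least half of \<open>N * d ^ b\<close> maps survive the removal of all exceptional
  ones. They lie over only \<open>N ^ (s * t + s')\<close> placements of the roots, each carrying at
  most \<open>c\<close> of them, which \<open>d2\<close> rules out. The number
  \<open>2 ^ (t + s')\<close> bounds the choices of a star at the centre.\<close>

lemma no_host_if_many_centre_leaves:
  fixes M M1 :: nat and \<epsilon> :: real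
  defines "c \<equiv> p * (t + 1) * (M ^ t + t * (M ^ (t + 1) + M1 * t * (M ^ t + t * M ^ (t + 1))))"
  assumes s: "s \<ge> 1" "s \<le> s' + 1"
    and few: "(\<Sum>(u, v)\<in>{(u, v). v \<in> nb E u}. real (card (ample_leaves M u v))) \<le> \<epsilon> * N * d ^ (s + 1)"
    and \<epsilon>: "\<epsilon> > 0" "8 * (t + 2 ^ (t + s')) * (\<epsilon> * K ^ b) \<le> 1"
    and M1: "M1 > p * (t + 1) + 1"
    and d0: "8 * (b + 1)^2 * K ^ b \<le> d"
    and d1: "p * (t + 1) * K ^ b * N ^ (s - 1) < \<epsilon> * d ^ s"
    and d2: "4 * c * N ^ (s * t + s' - 1) < d ^ b"
  shows False
proof -
  let ?\<A> = "{A. A \<subseteq> Nbr ` {1..t} \<union> CentreLeaf ` {1..s'} \<and> card A = s + 1}"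
  let ?Star = "\<lambda>A. {f \<in> hom VT ET. M \<le> card (common_nb E (f ` A))}"
  let ?Amp = "\<lambda>j. {f \<in> emb V E VT ET. sunflower_at V E VT ET (insert (Nbr j) RT) M1 f}"
  define \<Phi> where "\<Phi> = nbr_good M - ((\<Union>A\<in>?\<A>. ?Star A) \<union> (\<Union>j\<in>{1..t}. ?Amp j))"
  have fin: "finite (hom VT ET)" by (rule finite_hom[OF finite_T(1)])
  have finA: "finite ?\<A>" by (rule finite_subset[of _ "Pow (Nbr ` {1..t} \<union> CentreLeaf ` {1..s'})"]) auto
  have cardA: "card ?\<A> \<le> 2 ^ (t + s')"
  proof -
    let ?U = "Nbr ` {1..t} \<union> CentreLeaf ` {1..s'}"
    have "card ?U = card (Nbr ` {1..t}) + card (CentreLeaf ` {1..s'})"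
      by (intro card_Un_disjoint) auto
    then have "card ?U = t + s'" by (simp add: card_image inj_on_def)
    moreover have "card ?\<A> \<le> card (Pow ?U)" by (intro card_mono) auto
    ultimately show ?thesis by (simp add: card_Pow)
  qed
  have Kb: "0 \<le> \<epsilon> * K ^ b" "\<epsilon> \<le> \<epsilon> * K ^ b"
    using \<epsilon>(1) K_ge_1 by (auto simp: one_le_power)
  have Nd: "0 \<le> N * d ^ b" using d_ge_1 by simp
  have "8 * t * (\<epsilon> * K ^ b) \<le> 8 * (t + 2 ^ (t + s')) * (\<epsilon> * K ^ b)"
    using Kb by (intro mult_right_mono) auto
  from order.trans[OF this \<epsilon>(2)] have good: "3 / 4 * (N * d ^ b) \<le> card (nbr_good M)"
    by (rule card_homs_minus_nbr_good[OF few d0])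
  have fing: "finite (nbr_good M)"
    by (rule finite_subset[OF _ fin]) (auto simp: nbr_good_def emb_def)
  have "card (nbr_good M) \<le> card (\<Phi> \<union> ((\<Union>A\<in>?\<A>. ?Star A) \<union> (\<Union>j\<in>{1..t}. ?Amp j)))"
  proof (rule card_mono)
    have "\<Phi> \<union> ((\<Union>A\<in>?\<A>. ?Star A) \<union> (\<Union>j\<in>{1..t}. ?Amp j)) \<subseteq> hom VT ET"
      by (auto simp: \<Phi>_def nbr_good_def emb_def)
    then show "finite (\<Phi> \<union> ((\<Union>A\<in>?\<A>. ?Star A) \<union> (\<Union>j\<in>{1..t}. ?Amp j)))"
      by (rule finite_subset[OF _ fin])
  qed (auto simp: \<Phi>_def)
  also have "\<dots> \<le> card \<Phi> + ((\<Sum>A\<in>?\<A>. card (?Star A)) + (\<Sum>j\<in>{1..t}. card (?Amp j)))"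
    by (intro order.trans[OF card_Un_le] add_left_mono order.refl add_mono card_UN_le finA finite_atLeastAtMost)
  finally have "real (card (nbr_good M)) \<le> real (card \<Phi>) +
      ((\<Sum>A\<in>?\<A>. real (card (?Star A))) + (\<Sum>j\<in>{1..t}. real (card (?Amp j))))"
    by (simp only: flip: of_nat_sum of_nat_add of_nat_le_iff)
  moreover have "(\<Sum>A\<in>?\<A>. real (card (?Star A))) \<le> 2 ^ (t + s') * (\<epsilon> * K ^ b) * (N * d ^ b)"
  proof -
    have "(\<Sum>A\<in>?\<A>. real (card (?Star A))) \<le> (\<Sum>A\<in>?\<A>. \<epsilon> * K ^ b * (N * d ^ b))"
    proof (rule sum_mono)
      fix A assume A: "A \<in> ?\<A>"
      then have A': "A \<subseteq> Nbr ` {1..t} \<union> CentreLeaf ` {1..s'}" "card A = s + 1" by auto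
      show "real (card (?Star A)) \<le> \<epsilon> * K ^ b * (N * d ^ b)"
        using centre_star_props[OF A'(1)] A'(2) few by (intro card_ample_T_homs[where c = Centre]) auto
    qed
    also have "\<dots> = real (card ?\<A>) * (\<epsilon> * K ^ b * (N * d ^ b))" by simp
    also have "\<dots> \<le> real (2 ^ (t + s')) * (\<epsilon> * K ^ b * (N * d ^ b))"
      using cardA Kb Nd by (intro mult_right_mono) (simp_all only: of_nat_le_iff mult_nonneg_nonneg)
    finally show ?thesis by (simp add: mult.assoc)
  qed
  moreover have "(\<Sum>j\<in>{1..t}. real (card (?Amp j))) \<le> t * (\<epsilon> * K ^ b) * (N * d ^ b)"
  proof -
    have "(\<Sum>j\<in>{1..t}. real (card (?Amp j))) \<le> (\<Sum>j\<in>{1..t}. \<epsilon> * (N * d ^ b))"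
      by (intro sum_mono few_ample_at_nbr s M1 d1)
    also have "\<dots> \<le> (\<Sum>j\<in>{1..t}. (\<epsilon> * K ^ b) * (N * d ^ b))"
      by (intro sum_mono mult_right_mono Kb Nd)
    finally show ?thesis by (simp add: mult.assoc)
  qed
  moreover have "2 ^ (t + s') * (\<epsilon> * K ^ b) * (N * d ^ b) + t * (\<epsilon> * K ^ b) * (N * d ^ b)
      \<le> 1 / 8 * (N * d ^ b)"
  proof -
    have "((t + 2 ^ (t + s')) * (\<epsilon> * K ^ b)) * (N * d ^ b) \<le> 1 / 8 * (N * d ^ b)"
    proof (rule mult_right_mono[OF _ Nd])
      have "8 * ((t + 2 ^ (t + s')) * (\<epsilon> * K ^ b)) \<le> 1" using \<epsilon>(2) by (simp only: mult.assoc)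
      then show "(t + 2 ^ (t + s')) * (\<epsilon> * K ^ b) \<le> 1 / 8" by linarith
    qed
    then show ?thesis by (simp add: algebra_simps)
  qed
  ultimately have \<Phi>_large: "1 / 2 * (N * d ^ b) \<le> card \<Phi>"
    using good Nd by linarith
  have \<Phi>_emb: "\<Phi> \<subseteq> emb V E VT ET" by (auto simp: \<Phi>_def nbr_good_def)
  have fin\<Phi>: "finite \<Phi>" using fing by (simp add: \<Phi>_def)
  have fibre: "card {f \<in> \<Phi>. restrict f RT = \<xi>} \<le> c" for \<xi>
    unfolding c_def using s \<Phi>_emb
  proof (rule bounded_root_fibres)
    fix f assume f: "f \<in> \<Phi>"
    then have fh: "f \<in> hom VT ET" "f \<in> emb V E VT ET" using \<Phi>_emb by (auto simp: emb_def)
    show "card (common_nb E (f ` nbr_star s j)) < M" if "j \<in> {1..t}" for j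
      using f that by (auto simp: \<Phi>_def nbr_good_def)
    show "card (common_nb E (f ` A)) < M"
      if "A \<subseteq> Nbr ` {1..t} \<union> CentreLeaf ` {1..s'}" "card A = s + 1" for A
      using f fh(1) that unfolding \<Phi>_def by (auto simp: not_le)
    show "\<not> sunflower_at V E VT ET (insert (Nbr j) RT) M1 f" if "j \<in> {1..t}" for j
      using f fh(2) that unfolding \<Phi>_def by auto
  qed
  have "real (card \<Phi>) \<le> real (card (RT \<rightarrow>\<^sub>E V)) * real c"
  proof (rule card_le_fibres[OF _ _ fin\<Phi>, of _ "\<lambda>f. restrict f RT"])
    show "finite (RT \<rightarrow>\<^sub>E V)" using finite_V finite_T by (intro finite_PiE) auto
    show "(\<lambda>f. restrict f RT) ` \<Phi> \<subseteq> RT \<rightarrow>\<^sub>E V"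
      using \<Phi>_emb T_roots_subset[of s t s'] by (fastforce simp: emb_def homs_def)
    show "real (card {f \<in> \<Phi>. restrict f RT = \<xi>}) \<le> real c" for \<xi>
      using fibre[of \<xi>] by (simp only: of_nat_le_iff)
  qed
  also have "card (RT \<rightarrow>\<^sub>E V) = card V ^ (s * t + s')"
    by (simp add: card_PiE finite_T card_T_roots)
  finally have "real (card \<Phi>) \<le> N ^ (s * t + s') * c" by simp
  then have "N * d ^ b \<le> N * (2 * c * N ^ (s * t + s' - 1))"
  proof -
    have "s * t + s' \<ge> 1" using s t_pos by (metis Suc_le_eq add_gr_0 nat_0_less_mult_iff One_nat_def)
    then have "N ^ (s * t + s') = N * N ^ (s * t + s' - 1)" by (metis One_nat_def Suc_le_eq power_eq_if less_not_refl)
    then show ?thesis using \<Phi>_large \<open>real (card \<Phi>) \<le> N ^ (s * t + s') * c\<close> by (simp add: mult_ac)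
  qed
  then have "d ^ b \<le> 2 * c * N ^ (s * t + s' - 1)" using N_ge_1 by simp
  moreover have "2 * real c * N ^ (s * t + s' - 1) \<le> 4 * real c * N ^ (s * t + s' - 1)"
    by (intro mult_right_mono) auto
  ultimately show False using d2 by linarith
qed

end

section \<open>Pairs of centres with common roots\<close>

text \<open>Cauchy-Schwarz, from expanding the sum of the squares of \<open>n * y i - S\<close>,
  where \<open>n\<close> is the number of terms and \<open>S\<close> their sum.\<close>

lemma square_sum_le:
  fixes y :: "'a \<Rightarrow> real"
  assumes "finite I"
  shows "(\<Sum>i\<in>I. y i)\<^sup>2 \<le> card I * (\<Sum>i\<in>I. (y i)\<^sup>2)"
proof (cases "I = {}")
  case False
  let ?n = "real (card I)" let ?S = "\<Sum>i\<in>I. y i"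
  have n: "?n > 0" using False assms by (simp add: card_gt_0_iff)
  have "0 \<le> (\<Sum>i\<in>I. (?n * y i - ?S)\<^sup>2)" by (intro sum_nonneg) simp
  also have "\<dots> = (\<Sum>i\<in>I. ?n\<^sup>2 * (y i)\<^sup>2 - 2 * ?n * ?S * y i + ?S\<^sup>2)"
    by (intro sum.cong) (simp_all add: power2_eq_square algebra_simps)
  also have "\<dots> = ?n\<^sup>2 * (\<Sum>i\<in>I. (y i)\<^sup>2) - 2 * ?n * ?S * ?S + ?n * ?S\<^sup>2"
    by (simp add: sum.distrib sum_subtractf sum_distrib_left)
  also have "\<dots> = ?n * (?n * (\<Sum>i\<in>I. (y i)\<^sup>2) - ?S\<^sup>2)"
    by (simp add: power2_eq_square algebra_simps)
  finally show ?thesis using n by (simp add: zero_le_mult_iff)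
qed simp

text \<open>If \<open>A <= \<tau> * x\<close>, the first term suffices; otherwise
  \<open>x < A / \<tau>\<close> and the second does. This is weighted AM-GM with crude
  constants.\<close>

lemma absorb_linear:
  fixes x A \<tau> :: real
  assumes "x \<ge> 0" "A \<ge> 0" "\<tau> > 0" "t \<ge> 1"
  shows "x ^ (t - 1) * A \<le> \<tau> * x ^ t + A ^ t / \<tau> ^ (t - 1)"
proof -
  obtain n where t: "t = Suc n" using assms(4) by (cases t) auto
  show ?thesis
  proof (cases "A \<le> \<tau> * x")
    case True
    then have "x ^ n * A \<le> x ^ n * (\<tau> * x)" using assms by (intro mult_left_mono) auto
    moreover have "0 \<le> A ^ t / \<tau> ^ n" using assms by simp
    ultimately show ?thesis by (simp add: t mult_ac)
  next
    case False
    then have "x \<le> A / \<tau>" using assms by (simp add: field_simps)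
    then have "x ^ n * A \<le> (A / \<tau>) ^ n * A"
      using assms by (intro mult_right_mono power_mono) auto
    moreover have "0 \<le> \<tau> * x ^ t" using assms by simp
    ultimately show ?thesis by (simp add: t power_divide mult_ac)
  qed
qed

text \<open>The same dichotomy for \<open>B\<close>; \<open>\<tau> <= 1\<close> serves to bound
  \<open>\<tau>^2\<close> by \<open>\<tau>\<close>.\<close>

lemma absorb_quadratic:
  fixes x B \<tau> :: real
  assumes "x \<ge> 0" "B \<ge> 0" "\<tau> > 0" "\<tau> \<le> 1" "t \<ge> 2"
  shows "x ^ (t - 2) * B\<^sup>2 \<le> \<tau> * x ^ t + B ^ t / \<tau> ^ (t - 2)"
proof -
  obtain n where t: "t = n + 2" using assms(5) by (metis add.commute le_Suc_ex)
  show ?thesis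
  proof (cases "B \<le> \<tau> * x")
    case True
    then have "B\<^sup>2 \<le> (\<tau> * x)\<^sup>2" using assms by (intro power_mono) auto
    also have "\<dots> \<le> \<tau> * x\<^sup>2"
      using assms mult_right_mono[of "\<tau> * \<tau>" \<tau> "x * x"] mult_left_le[of \<tau> \<tau>]
      by (simp add: power_mult_distrib power2_eq_square mult_ac)
    finally have "x ^ n * B\<^sup>2 \<le> x ^ n * (\<tau> * x\<^sup>2)" using assms by (intro mult_left_mono) auto
    moreover have "0 \<le> B ^ t / \<tau> ^ n" using assms by simp
    ultimately show ?thesis by (simp add: t mult_ac power_add power2_eq_square)
  next
    case False
    then have "x \<le> B / \<tau>" using assms by (simp add: field_simps)
    then have "x ^ n * B\<^sup>2 \<le> (B / \<tau>) ^ n * B\<^sup>2"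
      using assms by (intro mult_right_mono power_mono) auto
    moreover have "0 \<le> \<tau> * x ^ t" using assms by simp
    ultimately show ?thesis by (simp add: t power_divide mult_ac power_add power2_eq_square)
  qed
qed

lemma add_one_power_le:
  fixes x :: real
  assumes "x \<ge> 0"
  shows "(x + 1) ^ t \<le> 2 ^ t * (x ^ t + 1)"
proof -
  have "(x + 1) ^ t \<le> (2 * max x 1) ^ t" using assms by (intro power_mono) auto
  also have "\<dots> = 2 ^ t * (max x 1) ^ t" by (simp add: power_mult_distrib)
  also have "(max x 1) ^ t \<le> x ^ t + 1" using assms by (cases "x \<le> 1") auto
  finally show ?thesis by simp
qed

text \<open>The coordinates other than \<open>j\<close> are free; given them, \<open>R\<close>
  leaves at most \<open>B\<close> values for the last one.\<close>

lemma card_PiE_one_dependent: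
  assumes "finite T" "j \<in> T" "finite L" and B: "\<And>z. real (card {y \<in> L. R z y}) \<le> B"
  shows "real (card {Y \<in> T \<rightarrow>\<^sub>E L. R (restrict Y (T - {j})) (Y j)}) \<le> real (card L) ^ (card T - 1) * B"
proof -
  let ?A = "{Y \<in> T \<rightarrow>\<^sub>E L. R (restrict Y (T - {j})) (Y j)}"
  let ?Z = "(T - {j}) \<rightarrow>\<^sub>E L"
  have finA: "finite ?A" using finite_PiE[of T "\<lambda>_. L"] assms(1,3) by auto
  have "real (card ?A) \<le> real (card ?Z) * B"
  proof (rule card_le_fibres[OF _ _ finA, of _ "\<lambda>Y. restrict Y (T - {j})"])
    show "finite ?Z" using assms by (intro finite_PiE) auto
    show "(\<lambda>Y. restrict Y (T - {j})) ` ?A \<subseteq> ?Z"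
    proof
      fix z assume "z \<in> (\<lambda>Y. restrict Y (T - {j})) ` ?A"
      then obtain Y where Y: "Y \<in> T \<rightarrow>\<^sub>E L" "z = restrict Y (T - {j})" by blast
      have "Y i \<in> L" if "i \<in> T - {j}" for i using PiE_mem[OF Y(1), of i] that by simp
      then show "z \<in> ?Z" unfolding Y(2) by (simp only: restrict_PiE_iff) blast
    qed
    fix z
    have "card {Y \<in> ?A. restrict Y (T - {j}) = z} \<le> card {y \<in> L. R z y}"
    proof (rule card_inj_on_le[of "\<lambda>Y. Y j"])
      show "inj_on (\<lambda>Y. Y j) {Y \<in> ?A. restrict Y (T - {j}) = z}"
      proof (rule inj_onI)
        fix Y Y' assume *: "Y \<in> {Y \<in> ?A. restrict Y (T - {j}) = z}"
          "Y' \<in> {Y \<in> ?A. restrict Y (T - {j}) = z}" "Y j = Y' j"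
        then have eq: "restrict Y (T - {j}) = restrict Y' (T - {j})" by simp
        have "Y i = Y' i" if "i \<in> T" for i
          using fun_cong[OF eq, of i] *(3) that by (cases "i = j") auto
        then show "Y = Y'" using * by (intro PiE_eqI[of Y T "\<lambda>_. L" Y' "\<lambda>_. L"]) auto
      qed
    qed (use assms in auto)
    then show "real (card {Y \<in> ?A. restrict Y (T - {j}) = z}) \<le> B" using B[of z] by linarith
  qed
  also have "card ?Z = card L ^ (card T - 1)" using assms by (simp add: card_PiE)
  finally show ?thesis by (simp only: of_nat_power)
qed

lemma card_PiE_two_restricted:
  assumes "finite T" "i \<in> T" "j \<in> T" "i \<noteq> j" "finite L" "finite A"
  shows "card {Y \<in> T \<rightarrow>\<^sub>E L. Y i \<in> A \<and> Y j \<in> A} \<le> card L ^ (card T - 2) * card A ^ 2"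
proof -
  let ?F = "\<lambda>m. if m \<in> {i, j} then A else L"
  have "card {Y \<in> T \<rightarrow>\<^sub>E L. Y i \<in> A \<and> Y j \<in> A} \<le> card (Pi\<^sub>E T ?F)"
    using assms by (intro card_mono finite_PiE) auto
  also have "\<dots> = (\<Prod>m\<in>T. if m \<in> {i, j} then card A else card L)"
    using assms by (simp add: card_PiE if_distrib)
  also have "\<dots> = card A ^ card (T \<inter> {i, j}) * card L ^ card (T - {i, j})"
    using assms(1) by (subst prod.If_cases) (simp_all add: Diff_eq Collect_mem_eq del: insert_iff)
  also have "T \<inter> {i, j} = {i, j}" using assms by auto
  also have "card (T - {i, j}) = card T - 2" using assms by (simp add: card_Diff_subset)
  finally show ?thesis using assms(4) by (simp add: mult.commute power2_eq_square)
qed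

section \<open>Root placements, their possible centres, and the second moment\<close>

context power_free_host
begin

text \<open>The vertex \<open>q\<close> is quantified, not recorded: each branch then has the same
  set of tuples, and the placements common to \<open>v\<close> and \<open>w\<close> form a pure
  power. Injectivity excludes clashes within a branch only.\<close>

definition leaf_tuples :: "'v \<Rightarrow> (nat \<Rightarrow> 'v) set" where
  "leaf_tuples v = {y \<in> {1..s} \<rightarrow>\<^sub>E V. inj_on y {1..s} \<and> (\<exists>q\<in>nb E v. y ` {1..s} \<subseteq> nb E q)}"

definition centre_tuples :: "'v \<Rightarrow> (nat \<Rightarrow> 'v) set" where
  "centre_tuples v = {U \<in> {1..s'} \<rightarrow>\<^sub>E nb E v. inj_on U {1..s'}}"

definition root_space :: "((nat \<Rightarrow> 'v) \<times> (nat \<Rightarrow> nat \<Rightarrow> 'v)) set" where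
  "root_space = ({1..s'} \<rightarrow>\<^sub>E V) \<times> ({1..t} \<rightarrow>\<^sub>E ({1..s} \<rightarrow>\<^sub>E V))"

text \<open>Weaker than being the centre of an embedding: the \<open>q_j\<close> may coincide or hit
  a root, and roots of different branches may coincide. These degeneracies are paid for in the pair
  counts.\<close>

definition centres :: "(nat \<Rightarrow> 'v) \<times> (nat \<Rightarrow> nat \<Rightarrow> 'v) \<Rightarrow> 'v set" where
  "centres \<xi> = {v \<in> V. fst \<xi> \<in> centre_tuples v \<and> snd \<xi> \<in> {1..t} \<rightarrow>\<^sub>E leaf_tuples v}"

definition shared :: "'v \<Rightarrow> 'v \<Rightarrow> ((nat \<Rightarrow> 'v) \<times> (nat \<Rightarrow> nat \<Rightarrow> 'v)) set" where
  "shared v w = (centre_tuples v \<inter> centre_tuples w) \<times> ({1..t} \<rightarrow>\<^sub>E (leaf_tuples v \<inter> leaf_tuples w))"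

definition root_map :: "(nat \<Rightarrow> 'v) \<times> (nat \<Rightarrow> nat \<Rightarrow> 'v) \<Rightarrow> tree_vertex \<Rightarrow> 'v" where
  "root_map \<xi> x = (case x of NbrLeaf j i \<Rightarrow> snd \<xi> j i | CentreLeaf i \<Rightarrow> fst \<xi> i | _ \<Rightarrow> undefined)"

abbreviation "uu v w \<equiv> real (card (centre_tuples v \<inter> centre_tuples w))"
abbreviation "ll v w \<equiv> real (card (leaf_tuples v \<inter> leaf_tuples w))"
abbreviation "codeg v w \<equiv> real (card (nb E v \<inter> nb E w))"

lemma finite_leaf_tuples: "finite (leaf_tuples v)"
  unfolding leaf_tuples_def
  by (rule finite_subset[of _ "{1..s} \<rightarrow>\<^sub>E V"]) (auto intro!: finite_PiE simp: finite_V)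

lemma finite_centre_tuples: "finite (centre_tuples v)"
  unfolding centre_tuples_def
  by (rule finite_subset[of _ "{1..s'} \<rightarrow>\<^sub>E nb E v"]) (auto intro!: finite_PiE simp: finite_nb)

lemma finite_root_space: "finite root_space"
  unfolding root_space_def using finite_V by (intro finite_cartesian_product finite_PiE) auto

lemma card_root_space: "real (card root_space) = N ^ (s * t + s')"
  by (simp add: root_space_def card_cartesian_product card_PiE power_add power_mult mult.commute)

lemma finite_centres: "finite (centres \<xi>)"
  using finite_V by (simp add: centres_def)

lemma finite_shared: "finite (shared v w)"
  unfolding shared_def using finite_leaf_tuples finite_centre_tuples
  by (intro finite_cartesian_product finite_PiE) auto

lemma card_shared: "real (card (shared v w)) = uu v w * ll v w ^ t"
  by (simp add: shared_def card_cartesian_product card_PiE)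

lemma shared_eq:
  assumes "v \<in> V" "w \<in> V"
  shows "{\<xi> \<in> root_space. v \<in> centres \<xi> \<and> w \<in> centres \<xi>} = shared v w"
proof -
  have "centre_tuples v \<subseteq> {1..s'} \<rightarrow>\<^sub>E V"
  proof
    fix U assume "U \<in> centre_tuples v"
    then have "U \<in> {1..s'} \<rightarrow>\<^sub>E nb E v" by (simp add: centre_tuples_def)
    then show "U \<in> {1..s'} \<rightarrow>\<^sub>E V" using nb_subset by fastforce
  qed
  moreover have "leaf_tuples v \<subseteq> {1..s} \<rightarrow>\<^sub>E V" by (auto simp: leaf_tuples_def)
  moreover from this have "{1..t} \<rightarrow>\<^sub>E leaf_tuples v \<subseteq> {1..t} \<rightarrow>\<^sub>E ({1..s} \<rightarrow>\<^sub>E V)"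
    by (intro PiE_mono) auto
  moreover have "{1..t} \<rightarrow>\<^sub>E (leaf_tuples v \<inter> leaf_tuples w) =
      ({1..t} \<rightarrow>\<^sub>E leaf_tuples v) \<inter> ({1..t} \<rightarrow>\<^sub>E leaf_tuples w)"
    by (simp only: PiE_Int)
  ultimately show ?thesis
    using assms unfolding shared_def root_space_def centres_def by auto
qed

lemma sum_centres_pairs:
  fixes h :: "'v \<Rightarrow> 'v \<Rightarrow> (nat \<Rightarrow> 'v) \<times> (nat \<Rightarrow> nat \<Rightarrow> 'v) \<Rightarrow> real"
  shows "(\<Sum>\<xi>\<in>root_space. \<Sum>v\<in>centres \<xi>. \<Sum>w\<in>centres \<xi>. h v w \<xi>) = (\<Sum>v\<in>V. \<Sum>w\<in>V. \<Sum>\<xi>\<in>shared v w. h v w \<xi>)"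
proof -
  have "(\<Sum>v\<in>centres \<xi>. \<Sum>w\<in>centres \<xi>. h v w \<xi>) =
    (\<Sum>(v, w)\<in>{(v, w) \<in> V \<times> V. v \<in> centres \<xi> \<and> w \<in> centres \<xi>}. h v w \<xi>)" for \<xi>
  proof -
    have "{(v, w) \<in> V \<times> V. v \<in> centres \<xi> \<and> w \<in> centres \<xi>} = centres \<xi> \<times> centres \<xi>"
      by (auto simp: centres_def)
    then show ?thesis by (simp add: sum.cartesian_product)
  qed
  then have "(\<Sum>\<xi>\<in>root_space. \<Sum>v\<in>centres \<xi>. \<Sum>w\<in>centres \<xi>. h v w \<xi>) =
    (\<Sum>\<xi>\<in>root_space. \<Sum>vw\<in>{vw. vw \<in> V \<times> V \<and> fst vw \<in> centres \<xi> \<and> snd vw \<in> centres \<xi>}. h (fst vw) (snd vw) \<xi>)"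
    by (simp add: case_prod_unfold mem_Times_iff conj_assoc)
  also have "\<dots> = (\<Sum>vw\<in>V \<times> V. \<Sum>\<xi>\<in>{\<xi>. \<xi> \<in> root_space \<and> fst vw \<in> centres \<xi> \<and> snd vw \<in> centres \<xi>}. h (fst vw) (snd vw) \<xi>)"
    using finite_root_space finite_V by (intro sum.swap_restrict) auto
  also have "\<dots> = (\<Sum>vw\<in>V \<times> V. \<Sum>\<xi>\<in>shared (fst vw) (snd vw). h (fst vw) (snd vw) \<xi>)"
  proof (rule sum.cong[OF refl])
    fix vw assume "vw \<in> V \<times> V"
    then have "fst vw \<in> V" "snd vw \<in> V" by auto
    from shared_eq[OF this]
    show "(\<Sum>\<xi>\<in>{\<xi>. \<xi> \<in> root_space \<and> fst vw \<in> centres \<xi> \<and> snd vw \<in> centres \<xi>}. h (fst vw) (snd vw) \<xi>) =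
      (\<Sum>\<xi>\<in>shared (fst vw) (snd vw). h (fst vw) (snd vw) \<xi>)" by simp
  qed
  finally show ?thesis by (simp add: sum.cartesian_product case_prod_unfold)
qed

lemma sum_shared_eq_sum_square:
  "(\<Sum>v\<in>V. \<Sum>w\<in>V. uu v w * ll v w ^ t) = (\<Sum>\<xi>\<in>root_space. (real (card (centres \<xi>)))\<^sup>2)"
proof -
  have "(\<Sum>v\<in>V. \<Sum>w\<in>V. uu v w * ll v w ^ t) = (\<Sum>v\<in>V. \<Sum>w\<in>V. \<Sum>\<xi>\<in>shared v w. 1)"
    by (simp add: card_shared)
  also have "\<dots> = (\<Sum>\<xi>\<in>root_space. \<Sum>v\<in>centres \<xi>. \<Sum>w\<in>centres \<xi>. 1)"
    by (rule sum_centres_pairs[symmetric])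
  finally show ?thesis by (simp add: power2_eq_square)
qed

text \<open>The ways in which \<open>v\<close> and \<open>w\<close> can use the same vertex as
  \<open>q_j\<close>.\<close>

definition common_nbr_pairs :: "'v \<Rightarrow> 'v \<Rightarrow> (nat \<Rightarrow> nat \<Rightarrow> 'v) \<Rightarrow> (nat \<times> 'v) set" where
  "common_nbr_pairs v w Y = {(j, x) \<in> {1..t} \<times> (nb E v \<inter> nb E w). Y j ` {1..s} \<subseteq> nb E x}"

text \<open>The ways in which one vertex can serve \<open>v\<close> as both \<open>q_i\<close> and
  \<open>q_j\<close>, the obstruction to an injective choice of the \<open>q_j\<close>.\<close>

definition double_nbrs :: "'v \<Rightarrow> (nat \<Rightarrow> nat \<Rightarrow> 'v) \<Rightarrow> ((nat \<times> nat) \<times> 'v) set" where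
  "double_nbrs v Y = {((i, j), x) \<in> {(i, j) \<in> {1..t} \<times> {1..t}. i \<noteq> j} \<times> nb E v.
     Y i ` {1..s} \<subseteq> nb E x \<and> Y j ` {1..s} \<subseteq> nb E x}"

lemma finite_common_nbr_pairs: "finite (common_nbr_pairs v w Y)"
  unfolding common_nbr_pairs_def
  by (rule finite_subset[of _ "{1..t} \<times> nb E v"]) (auto simp: finite_nb)

lemma finite_double_nbrs: "finite (double_nbrs v Y)"
  unfolding double_nbrs_def
  by (rule finite_subset[of _ "({1..t} \<times> {1..t}) \<times> nb E v"]) (auto simp: finite_nb)

text \<open>Apart from boundedly many, every centre is adjacent to a vertex of a bounded set that
  can serve it as some \<open>q_j\<close>, or has a double neighbour. Squaring turns the first
  alternative into pairs of centres sharing a \<open>q_j\<close>.\<close>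

lemma card_centres_square:
  fixes wt :: nat
  defines "wt \<equiv> p * (t + 1) + (s * t + s')"
  assumes \<xi>: "\<xi> \<in> root_space" and inj: "inj_on (root_map \<xi>) RT"
  shows "(real (card (centres \<xi>)))\<^sup>2 \<le> 2 * real wt * real (card (centres \<xi>)) +
    (\<Sum>v\<in>centres \<xi>. \<Sum>w\<in>centres \<xi>. real (t * wt) * real (card (common_nbr_pairs v w (snd \<xi>)))
       + 2 * real (card (double_nbrs v (snd \<xi>))))"
proof -
  define X where "X = centres \<xi>"
  define Y where "Y = snd \<xi>"
  define \<rho> where "\<rho> = root_map \<xi>"
  have finX: "finite X" by (simp add: X_def finite_centres)
  obtain W where W: "finite W" "card W \<le> p * (t + 1)"
    "\<forall>f\<in>emb V E VT ET. (\<forall>r\<in>RT. f r = \<rho> r) \<longrightarrow> f ` insert Centre (Nbr ` {1..t}) \<inter> W \<noteq> {}"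
    by (rule root_cover[of \<rho>])
  define W' where "W' = W \<union> \<rho> ` RT"
  have finW': "finite W'" using W(1) finite_T by (simp add: W'_def)
  have cardW': "card W' \<le> wt"
    using card_Un_le[of W "\<rho> ` RT"] card_image_le[OF finite_T(2), of \<rho> s t s'] card_T_roots[of s t s'] W(2)
    unfolding W'_def wt_def by linarith
  \<comment> \<open>The vertices of \<open>W'\<close> that can serve as \<open>q_j\<close>, together
    with the index \<open>j\<close>; \<open>W'\<close> includes the roots so that the chosen
    \<open>q_j\<close> avoid them as well.\<close>
  define Q where "Q = {(j, x) \<in> {1..t} \<times> W'. Y j ` {1..s} \<subseteq> nb E x}"
  have finQ: "finite Q" unfolding Q_def by (rule finite_subset[of _ "{1..t} \<times> W'"]) (auto simp: finW')
  have "card Q \<le> card ({1..t} \<times> W')" unfolding Q_def using finW' by (intro card_mono) auto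
  also have "\<dots> \<le> t * wt" using cardW' by (simp add: card_cartesian_product)
  finally have cardQ: "real (card Q) \<le> real (t * wt)" by (simp only: of_nat_le_iff)
  define Xd where "Xd = {v \<in> X. double_nbrs v Y \<noteq> {}}"
  have \<rho>V: "\<rho> ` RT \<subseteq> V"
  proof -
    obtain U where xi: "\<xi> = (U, Y)" unfolding Y_def by (metis prod.collapse)
    then have U: "U \<in> {1..s'} \<rightarrow>\<^sub>E V" and Y': "Y \<in> {1..t} \<rightarrow>\<^sub>E ({1..s} \<rightarrow>\<^sub>E V)"
      using \<xi> by (auto simp: root_space_def)
    have "Y j i \<in> V" if "j \<in> {1..t}" "i \<in> {1..s}" for i j
      using PiE_mem[OF PiE_mem[OF Y' that(1)] that(2)] .
    moreover have "U i \<in> V" if "i \<in> {1..s'}" for i using PiE_mem[OF U that] .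
    ultimately show ?thesis by (auto simp: \<rho>_def xi root_map_def T_roots_def nbr_leaves_iff)
  qed
  \<comment> \<open>A centre outside all three sets admits distinct \<open>q_j\<close> away from
    \<open>W'\<close>, hence an embedding that misses the transversal \<open>W\<close>.\<close>
  have cover: "X \<subseteq> W' \<union> (\<Union>(j, x)\<in>Q. X \<inter> nb E x) \<union> Xd"
  proof
    fix v assume vX: "v \<in> X"
    show "v \<in> W' \<union> (\<Union>(j, x)\<in>Q. X \<inter> nb E x) \<union> Xd"
    proof (rule ccontr)
      assume no: "v \<notin> W' \<union> (\<Union>(j, x)\<in>Q. X \<inter> nb E x) \<union> Xd"
      have vV: "v \<in> V" and U: "fst \<xi> \<in> centre_tuples v" and Yl: "Y \<in> {1..t} \<rightarrow>\<^sub>E leaf_tuples v"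
        using vX by (auto simp: X_def centres_def Y_def)
      have "\<exists>q. j \<in> {1..t} \<longrightarrow> q \<in> nb E v \<and> Y j ` {1..s} \<subseteq> nb E q" for j
      proof (cases "j \<in> {1..t}")
        case True
        from PiE_mem[OF Yl this] have "\<exists>q\<in>nb E v. Y j ` {1..s} \<subseteq> nb E q"
          by (simp add: leaf_tuples_def)
        then show ?thesis by blast
      next
        case False
        then show ?thesis by blast
      qed
      then have "\<forall>j. \<exists>q. j \<in> {1..t} \<longrightarrow> q \<in> nb E v \<and> Y j ` {1..s} \<subseteq> nb E q" ..
      from choice[OF this] obtain q where
        q0: "\<forall>j. j \<in> {1..t} \<longrightarrow> q j \<in> nb E v \<and> Y j ` {1..s} \<subseteq> nb E (q j)" ..
      have q: "q j \<in> nb E v" "Y j ` {1..s} \<subseteq> nb E (q j)" if "j \<in> {1..t}" for j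
        using q0 that by simp_all
      have qW: "q j \<notin> W'" if j: "j \<in> {1..t}" for j
      proof
        assume "q j \<in> W'"
        then have "(j, q j) \<in> Q" using j q(2) by (simp add: Q_def)
        moreover have "v \<in> X \<inter> nb E (q j)" using vX q(1)[OF j] nb_sym[of "q j" E v] by simp
        ultimately have "v \<in> (\<Union>(j, x)\<in>Q. X \<inter> nb E x)" by (intro UN_I[of "(j, q j)"]) simp_all
        then show False using no by simp
      qed
      have qi: "inj_on q {1..t}"
      proof (rule inj_onI, rule ccontr)
        fix i j assume ij: "i \<in> {1..t}" "j \<in> {1..t}" "q i = q j" "i \<noteq> j"
        then have "((i, j), q i) \<in> double_nbrs v Y" using q by (force simp: double_nbrs_def)
        then show False using no vX by (auto simp: Xd_def)
      qed
      have ql: "\<rho> (NbrLeaf j i) \<in> nb E (q j)" if "j \<in> {1..t}" "i \<in> {1..s}" for i j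
        using q(2)[OF that(1)] that(2) by (auto simp: \<rho>_def root_map_def Y_def)
      have qc: "\<rho> (CentreLeaf i) \<in> nb E v" if "i \<in> {1..s'}" for i
        using U that by (auto simp: \<rho>_def root_map_def centre_tuples_def)
      have vr: "v \<notin> \<rho> ` RT" using no by (simp add: W'_def)
      have qr: "q j \<notin> \<rho> ` RT" if "j \<in> {1..t}" for j using qW[OF that] by (simp add: W'_def)
      have "\<exists>f\<in>emb V E VT ET. f Centre = v \<and> (\<forall>j\<in>{1..t}. f (Nbr j) = q j) \<and> (\<forall>r\<in>RT. f r = \<rho> r)"
        by (rule mk_emb[OF inj[folded \<rho>_def] \<rho>V vV vr qi q(1) qr ql qc])
      then obtain f where f: "f \<in> emb V E VT ET" "f Centre = v" "\<forall>j\<in>{1..t}. f (Nbr j) = q j"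
        "\<forall>r\<in>RT. f r = \<rho> r" by blast
      then have "f ` insert Centre (Nbr ` {1..t}) \<inter> W \<noteq> {}" using W(3) by blast
      then show False using f(2,3) no qW by (auto simp: W'_def)
    qed
  qed
  define x where "x = real (card X)"
  define a where "a = (\<Sum>(j, y)\<in>Q. real (card (X \<inter> nb E y)))"
  define \<delta> where "\<delta> = real (card Xd)"
  have finXd: "finite Xd" using finX by (simp add: Xd_def)
  have "card X \<le> card (W' \<union> (\<Union>(j, y)\<in>Q. X \<inter> nb E y) \<union> Xd)"
    using cover finW' finQ finX finXd by (intro card_mono) auto
  also have "\<dots> \<le> card W' + card (\<Union>(j, y)\<in>Q. X \<inter> nb E y) + card Xd"
    by (intro order.trans[OF card_Un_le] add_mono card_Un_le order.refl)
  also have "\<dots> \<le> wt + (\<Sum>(j, y)\<in>Q. card (X \<inter> nb E y)) + card Xd"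
    using card_UN_le[OF finQ, of "\<lambda>(j, y). X \<inter> nb E y"] cardW' by (simp add: case_prod_unfold)
  finally have "x \<le> wt + a + \<delta>"
    unfolding x_def a_def \<delta>_def by (simp add: case_prod_unfold flip: of_nat_sum)
  then have "x * x \<le> x * (wt + a + \<delta>)" by (intro mult_left_mono) (simp_all add: x_def)
  \<comment> \<open>AM-GM moves half of \<open>2 * (x * a)\<close> to the left as
    \<open>x * x\<close>, so that \<open>a\<close> enters as a square.\<close>
  moreover have "2 * (x * a) \<le> x * x + a * a"
    using sum_squares_ge_zero[of "x - a" 0] by (simp add: algebra_simps)
  ultimately have xx: "x\<^sup>2 \<le> 2 * wt * x + a\<^sup>2 + 2 * (\<delta> * x)"
    by (simp add: power2_eq_square algebra_simps)
  have cnt: "real (card (X \<inter> nb E y)) = (\<Sum>v\<in>X. of_bool (y \<in> nb E v))" for y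
  proof -
    have "X \<inter> nb E y = X \<inter> {v. y \<in> nb E v}" by (auto simp: nb_def insert_commute)
    then show ?thesis using finX by (simp add: Int_def)
  qed
  \<comment> \<open>By Cauchy-Schwarz over \<open>Q\<close>; the square of
    \<open>card (X \<inter> nb E y)\<close> counts ordered pairs of centres sharing
    \<open>y\<close>.\<close>
  have "a\<^sup>2 \<le> card Q * (\<Sum>(j, y)\<in>Q. (real (card (X \<inter> nb E y)))\<^sup>2)"
    unfolding a_def case_prod_unfold by (rule square_sum_le[OF finQ])
  also have "\<dots> \<le> (t * wt) * (\<Sum>(j, y)\<in>Q. (real (card (X \<inter> nb E y)))\<^sup>2)"
    by (intro mult_right_mono cardQ sum_nonneg) auto
  also have "(\<Sum>(j, y)\<in>Q. (real (card (X \<inter> nb E y)))\<^sup>2) =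
     (\<Sum>(j, y)\<in>Q. \<Sum>v\<in>X. \<Sum>w\<in>X. of_bool (y \<in> nb E v) * of_bool (y \<in> nb E w))"
    unfolding cnt power2_eq_square sum_product ..
  also have "\<dots> = (\<Sum>v\<in>X. \<Sum>w\<in>X. \<Sum>(j, y)\<in>Q. of_bool (y \<in> nb E v) * of_bool (y \<in> nb E w))"
    unfolding case_prod_unfold
    by (subst sum.swap) (intro sum.cong refl sum.swap)
  also have "\<dots> \<le> (\<Sum>v\<in>X. \<Sum>w\<in>X. real (card (common_nbr_pairs v w Y)))"
  proof (intro sum_mono)
    fix v w
    have "(\<Sum>(j, y)\<in>Q. of_bool (y \<in> nb E v) * of_bool (y \<in> nb E w)) =
        (\<Sum>jy\<in>Q. of_bool (snd jy \<in> nb E v \<inter> nb E w) :: real)"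
      by (intro sum.cong) auto
    also have "\<dots> = real (card (Q \<inter> {jy. snd jy \<in> nb E v \<inter> nb E w}))"
      using finQ by (simp add: Int_def)
    also have "\<dots> \<le> real (card (common_nbr_pairs v w Y))"
      using finite_common_nbr_pairs
      by (intro of_nat_mono card_mono) (auto simp: Q_def common_nbr_pairs_def)
    finally show "(\<Sum>(j, y)\<in>Q. of_bool (y \<in> nb E v) * of_bool (y \<in> nb E w)) \<le> real (card (common_nbr_pairs v w Y))" .
  qed
  finally have aa: "a\<^sup>2 \<le> (t * wt) * (\<Sum>v\<in>X. \<Sum>w\<in>X. real (card (common_nbr_pairs v w Y)))"
    by (simp add: mult_left_mono)
  have "\<delta> = (\<Sum>v\<in>X. of_bool (double_nbrs v Y \<noteq> {}))"
    unfolding \<delta>_def Xd_def using finX by (simp add: Int_def)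
  also have "\<dots> \<le> (\<Sum>v\<in>X. real (card (double_nbrs v Y)))"
  proof (rule sum_mono)
    fix v
    show "of_bool (double_nbrs v Y \<noteq> {}) \<le> real (card (double_nbrs v Y))"
      using finite_double_nbrs[of v Y] by (cases "double_nbrs v Y = {}") (auto simp: card_gt_0_iff Suc_le_eq)
  qed
  finally have "\<delta> * x \<le> (\<Sum>v\<in>X. real (card (double_nbrs v Y))) * x"
    by (intro mult_right_mono) (simp_all add: x_def)
  also have "\<dots> = (\<Sum>v\<in>X. \<Sum>w\<in>X. real (card (double_nbrs v Y)))"
    by (simp add: x_def sum_distrib_left mult.commute)
  finally have dx: "\<delta> * x \<le> (\<Sum>v\<in>X. \<Sum>w\<in>X. real (card (double_nbrs v Y)))" .
  have "x\<^sup>2 \<le> 2 * wt * x + ((t * wt) * (\<Sum>v\<in>X. \<Sum>w\<in>X. real (card (common_nbr_pairs v w Y)))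
     + 2 * (\<Sum>v\<in>X. \<Sum>w\<in>X. real (card (double_nbrs v Y))))"
    using xx aa dx by linarith
  then show ?thesis
    unfolding x_def X_def Y_def by (simp add: sum.distrib sum_distrib_left mult_ac)
qed

end

lemma sum_card_swap:
  assumes "finite S" "finite P" "\<And>\<xi>. \<xi> \<in> S \<Longrightarrow> C \<xi> = {c \<in> P. R \<xi> c}"
  shows "(\<Sum>\<xi>\<in>S. real (card (C \<xi>))) = (\<Sum>c\<in>P. real (card {\<xi> \<in> S. R \<xi> c}))"
proof -
  have "(\<Sum>\<xi>\<in>S. real (card (C \<xi>))) = (\<Sum>\<xi>\<in>S. \<Sum>c\<in>{c. c \<in> P \<and> R \<xi> c}. 1)"
    using assms(3) by (intro sum.cong) simp_all
  also have "\<dots> = (\<Sum>c\<in>P. \<Sum>\<xi>\<in>{\<xi>. \<xi> \<in> S \<and> R \<xi> c}. 1)"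
    by (rule sum.swap_restrict[OF assms(1,2)])
  finally show ?thesis by simp
qed

section \<open>Bounds for overlapping and degenerate placements\<close>

context power_free_host
begin

lemma card_nb_tuples: "x \<in> V \<Longrightarrow> real (card ({1..n} \<rightarrow>\<^sub>E nb E x)) \<le> (K * d) ^ n"
  using max_deg[of x] by (simp add: card_PiE power_mono)

lemma card_leaf_tuples_in_nb:
  assumes "x \<in> V"
  shows "real (card {y \<in> leaf_tuples v. y ` {1..s} \<subseteq> nb E x}) \<le> (K * d) ^ s"
proof -
  have "{y \<in> leaf_tuples v. y ` {1..s} \<subseteq> nb E x} \<subseteq> {1..s} \<rightarrow>\<^sub>E nb E x"
    by (auto simp: leaf_tuples_def PiE_def)
  then have "card {y \<in> leaf_tuples v. y ` {1..s} \<subseteq> nb E x} \<le> card ({1..s} \<rightarrow>\<^sub>E nb E x)"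
    using finite_nb by (intro card_mono finite_PiE) auto
  then show ?thesis using card_nb_tuples[OF assms, of s] by linarith
qed

text \<open>Choose \<open>q\<close> next to \<open>v\<close>, then the other \<open>s - 1\<close>
  leaves next to \<open>q\<close>; the fixed entry saves one factor \<open>K * d\<close>.\<close>

lemma card_leaf_tuples_at:
  assumes "v \<in> V" "l \<in> {1..s}"
  shows "real (card {y \<in> leaf_tuples v. y l = z}) \<le> (K * d) ^ s"
proof -
  let ?A = "\<lambda>q. {y \<in> {1..s} \<rightarrow>\<^sub>E nb E q. y l = z}"
  have bound: "real (card (?A q)) \<le> (K * d) ^ (s - 1)" if "q \<in> nb E v" for q
  proof -
    have "real (card {y \<in> {1..s} \<rightarrow>\<^sub>E nb E q. (\<lambda>_ u. u = z) (restrict y ({1..s} - {l})) (y l)})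
      \<le> real (card (nb E q)) ^ (card {1..s} - 1) * 1"
    proof (rule card_PiE_one_dependent)
      have "{u \<in> nb E q. u = z} \<subseteq> {z}" by auto
      from card_mono[OF _ this] show "real (card {u \<in> nb E q. u = z}) \<le> 1" by simp
    qed (use assms(2) finite_nb in auto)
    also have "\<dots> \<le> (K * d) ^ (s - 1)"
      using max_deg[of q] nb_V[OF that] by (simp add: power_mono)
    finally show ?thesis by simp
  qed
  have "card {y \<in> leaf_tuples v. y l = z} \<le> card (\<Union>q\<in>nb E v. ?A q)"
  proof (rule card_mono)
    have "finite ({1..s} \<rightarrow>\<^sub>E nb E q)" for q using finite_nb by (intro finite_PiE) auto
    then show "finite (\<Union>q\<in>nb E v. ?A q)" using finite_nb by auto
    show "{y \<in> leaf_tuples v. y l = z} \<subseteq> (\<Union>q\<in>nb E v. ?A q)"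
    proof
      fix y assume "y \<in> {y \<in> leaf_tuples v. y l = z}"
      then obtain q where "y \<in> {1..s} \<rightarrow>\<^sub>E V" "y l = z" "q \<in> nb E v" "y ` {1..s} \<subseteq> nb E q"
        by (auto simp: leaf_tuples_def)
      moreover from this have "y \<in> {1..s} \<rightarrow>\<^sub>E nb E q" by (simp add: PiE_def image_subset_iff_funcset)
      ultimately show "y \<in> (\<Union>q\<in>nb E v. ?A q)" by blast
    qed
  qed
  also have "\<dots> \<le> (\<Sum>q\<in>nb E v. card (?A q))" by (rule card_UN_le[OF finite_nb])
  finally have "real (card {y \<in> leaf_tuples v. y l = z}) \<le> (\<Sum>q\<in>nb E v. real (card (?A q)))"
    by (simp flip: of_nat_sum)
  also have "\<dots> \<le> real (card (nb E v)) * (K * d) ^ (s - 1)"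
    using sum_bounded_above[of "nb E v" "\<lambda>q. real (card (?A q))" "(K * d) ^ (s - 1)"] bound by simp
  also have "\<dots> \<le> (K * d) * (K * d) ^ (s - 1)"
    using max_deg[OF assms(1)] Kd_ge_1 by (intro mult_right_mono) auto
  also have "\<dots> = (K * d) ^ s" using assms(2) by (cases s) auto
  finally show ?thesis .
qed

text \<open>A condition on branch \<open>j\<close>, given everything else, replaces one factor
  \<open>ll v w\<close> by \<open>B\<close>. The relation sees the centre leaves and the other
  branches, so it can also express clashes.\<close>

lemma card_shared_one:
  assumes "j \<in> {1..t}" and B: "\<And>U z. real (card {y \<in> leaf_tuples v. R U z y}) \<le> B"
  shows "real (card {\<xi> \<in> shared v w. R (fst \<xi>) (restrict (snd \<xi>) ({1..t} - {j})) (snd \<xi> j)})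
    \<le> uu v w * ll v w ^ (t - 1) * B"
proof -
  let ?L = "leaf_tuples v \<inter> leaf_tuples w" and ?C = "centre_tuples v \<inter> centre_tuples w"
  let ?A = "{\<xi> \<in> shared v w. R (fst \<xi>) (restrict (snd \<xi>) ({1..t} - {j})) (snd \<xi> j)}"
  have "real (card ?A) \<le> real (card ?C) * (ll v w ^ (t - 1) * B)"
  proof (rule card_le_fibres[of ?C fst ?A])
    show "finite ?A" using finite_shared by simp
    show "finite ?C" using finite_centre_tuples by simp
    show "fst ` ?A \<subseteq> ?C" by (auto simp: shared_def)
    fix U
    let ?Y = "{Y \<in> {1..t} \<rightarrow>\<^sub>E ?L. R U (restrict Y ({1..t} - {j})) (Y j)}"
    have "card {\<xi> \<in> ?A. fst \<xi> = U} \<le> card ?Y"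
    proof (rule card_inj_on_le[of snd])
      show "inj_on snd {\<xi> \<in> ?A. fst \<xi> = U}" by (auto simp: inj_on_def)
      show "snd ` {\<xi> \<in> ?A. fst \<xi> = U} \<subseteq> ?Y" by (auto simp: shared_def simp del: restrict_apply)
      have "finite ({1..t} \<rightarrow>\<^sub>E ?L)" using finite_leaf_tuples by (intro finite_PiE) auto
      then show "finite ?Y" by simp
    qed
    also have "real (card ?Y) \<le> real (card ?L) ^ (card {1..t} - 1) * B"
    proof (rule card_PiE_one_dependent)
      fix z
      have "card {y \<in> ?L. R U z y} \<le> card {y \<in> leaf_tuples v. R U z y}"
        using finite_leaf_tuples by (intro card_mono) auto
      then show "real (card {y \<in> ?L. R U z y}) \<le> B" using B[of U z] by linarith
    qed (use assms(1) finite_leaf_tuples in auto)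
    finally show "real (card {\<xi> \<in> ?A. fst \<xi> = U}) \<le> ll v w ^ (t - 1) * B" by simp
  qed
  then show ?thesis by (simp add: mult.assoc)
qed

text \<open>Choose \<open>j\<close> and the shared vertex; the tuple of branch \<open>j\<close> must
  then lie in one neighbourhood, which has at most \<open>(K * d) ^ s\<close> tuples.\<close>

lemma sum_common_nbr_pairs:
  assumes "v \<in> V" "w \<in> V"
  shows "(\<Sum>\<xi>\<in>shared v w. real (card (common_nbr_pairs v w (snd \<xi>))))
    \<le> t * (uu v w * (ll v w ^ (t - 1) * (codeg v w * (K * d) ^ s)))"
proof -
  let ?P = "{1..t} \<times> (nb E v \<inter> nb E w)"
  have "(\<Sum>\<xi>\<in>shared v w. real (card (common_nbr_pairs v w (snd \<xi>)))) =
     (\<Sum>c\<in>?P. real (card {\<xi> \<in> shared v w. snd \<xi> (fst c) ` {1..s} \<subseteq> nb E (snd c)}))"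
    using finite_shared finite_nb
    by (intro sum_card_swap) (auto simp: common_nbr_pairs_def)
  also have "\<dots> \<le> (\<Sum>c\<in>?P. uu v w * ll v w ^ (t - 1) * (K * d) ^ s)"
  proof (rule sum_mono)
    fix c assume "c \<in> ?P"
    then have "fst c \<in> {1..t}" "snd c \<in> V" using nb_subset[of v] by auto
    then show "real (card {\<xi> \<in> shared v w. snd \<xi> (fst c) ` {1..s} \<subseteq> nb E (snd c)})
      \<le> uu v w * ll v w ^ (t - 1) * (K * d) ^ s"
      using card_leaf_tuples_in_nb
      by (intro card_shared_one[where R = "\<lambda>_ _ y. y ` {1..s} \<subseteq> nb E (snd c)"]) auto
  qed
  finally show ?thesis by (simp add: card_cartesian_product mult_ac)
qed

text \<open>The double neighbour has at most \<open>K * d\<close> choices and restricts two branches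
  to at most \<open>(K * d) ^ s\<close> tuples each.\<close>

lemma sum_double_nbrs:
  assumes "v \<in> V" "w \<in> V"
  shows "(\<Sum>\<xi>\<in>shared v w. real (card (double_nbrs v (snd \<xi>))))
    \<le> t ^ 2 * (uu v w * (ll v w ^ (t - 2) * (K * d) ^ (2 * s + 1)))"
proof -
  let ?L = "leaf_tuples v \<inter> leaf_tuples w" and ?C = "centre_tuples v \<inter> centre_tuples w"
  let ?T2 = "{(i, j) \<in> {1..t} \<times> {1..t}. i \<noteq> j}"
  let ?P = "?T2 \<times> nb E v"
  have finT2: "finite ?T2" by (rule finite_subset[of _ "{1..t} \<times> {1..t}"]) auto
  have "(\<Sum>\<xi>\<in>shared v w. real (card (double_nbrs v (snd \<xi>)))) =
     (\<Sum>c\<in>?P. real (card {\<xi> \<in> shared v w. snd \<xi> (fst (fst c)) ` {1..s} \<subseteq> nb E (snd c) \<and>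
        snd \<xi> (snd (fst c)) ` {1..s} \<subseteq> nb E (snd c)}))"
    using finite_shared finite_nb finT2
    by (intro sum_card_swap) (auto simp: double_nbrs_def)
  also have "\<dots> \<le> (\<Sum>c\<in>?P. uu v w * ll v w ^ (t - 2) * (K * d) ^ (2 * s))"
  proof (rule sum_mono)
    fix c assume "c \<in> ?P"
    then obtain i j x where c: "c = ((i, j), x)" and ij: "i \<in> {1..t}" "j \<in> {1..t}" "i \<noteq> j" and x: "x \<in> V"
      using nb_subset[of v] by auto
    let ?A = "{y \<in> ?L. y ` {1..s} \<subseteq> nb E x}"
    have finL: "finite ?L" using finite_leaf_tuples by simp
    have finA: "finite ?A" by (rule finite_subset[OF _ finL]) auto
    have "{\<xi> \<in> shared v w. snd \<xi> i ` {1..s} \<subseteq> nb E x \<and> snd \<xi> j ` {1..s} \<subseteq> nb E x}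
      \<subseteq> ?C \<times> {Y \<in> {1..t} \<rightarrow>\<^sub>E ?L. Y i \<in> ?A \<and> Y j \<in> ?A}"
      using ij by (auto simp: shared_def)
    then have "card {\<xi> \<in> shared v w. snd \<xi> i ` {1..s} \<subseteq> nb E x \<and> snd \<xi> j ` {1..s} \<subseteq> nb E x}
      \<le> card (?C \<times> {Y \<in> {1..t} \<rightarrow>\<^sub>E ?L. Y i \<in> ?A \<and> Y j \<in> ?A})"
      using finite_centre_tuples finL finite_PiE[of "{1..t}" "\<lambda>_. ?L"]
      by (intro card_mono finite_cartesian_product) auto
    also have "\<dots> \<le> card ?C * (card ?L ^ (card {1..t} - 2) * card ?A ^ 2)"
      unfolding card_cartesian_product using ij
      by (intro mult_left_mono card_PiE_two_restricted finL finA) auto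
    finally have "real (card {\<xi> \<in> shared v w. snd \<xi> i ` {1..s} \<subseteq> nb E x \<and> snd \<xi> j ` {1..s} \<subseteq> nb E x})
      \<le> real (card ?C * (card ?L ^ (card {1..t} - 2) * card ?A ^ 2))"
      by (simp only: of_nat_le_iff)
    also have "\<dots> = uu v w * (ll v w ^ (t - 2) * real (card ?A) ^ 2)" by simp
    also have "\<dots> \<le> uu v w * (ll v w ^ (t - 2) * ((K * d) ^ s) ^ 2)"
    proof -
      have "card ?A \<le> card {y \<in> leaf_tuples v. y ` {1..s} \<subseteq> nb E x}"
        using finite_leaf_tuples by (intro card_mono) auto
      then have "real (card ?A) \<le> (K * d) ^ s" using card_leaf_tuples_in_nb[OF x, of v] by linarith
      then show ?thesis by (intro mult_left_mono power_mono) auto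
    qed
    finally show "real (card {\<xi> \<in> shared v w. snd \<xi> (fst (fst c)) ` {1..s} \<subseteq> nb E (snd c) \<and>
        snd \<xi> (snd (fst c)) ` {1..s} \<subseteq> nb E (snd c)}) \<le> uu v w * ll v w ^ (t - 2) * (K * d) ^ (2 * s)"
      by (simp add: c power_mult mult.commute[of 2 s] mult.assoc)
  qed
  also have "\<dots> = real (card ?T2) * real (card (nb E v)) * (uu v w * ll v w ^ (t - 2) * (K * d) ^ (2 * s))"
    by (simp add: card_cartesian_product)
  also have "\<dots> \<le> real (t ^ 2) * (K * d) * (uu v w * ll v w ^ (t - 2) * (K * d) ^ (2 * s))"
  proof (intro mult_right_mono mult_mono)
    have "card ?T2 \<le> card ({1..t} \<times> {1..t})" by (intro card_mono) auto
    then show "real (card ?T2) \<le> real (t ^ 2)"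
      by (simp add: card_cartesian_product power2_eq_square flip: of_nat_mult)
    show "real (card (nb E v)) \<le> K * d" by (rule max_deg[OF assms(1)])
  qed (use Kd_ge_1 in auto)
  finally show ?thesis by (simp add: mult_ac)
qed

text \<open>By the injectivity built into the tuples, a clash involves a \<open>NbrLeaf\<close> and
  a root outside its branch. It therefore prescribes one entry of a leaf tuple in terms of the
  rest.\<close>

lemma card_shared_noninj:
  assumes "v \<in> V" "w \<in> V"
  shows "real (card {\<xi> \<in> shared v w. \<not> inj_on (root_map \<xi>) RT})
    \<le> (s * t + s') ^ 2 * (uu v w * (ll v w ^ (t - 1) * (K * d) ^ s))"
proof -
  let ?P = "{(a, b) \<in> RT \<times> RT. a \<noteq> b}"
  let ?B = "uu v w * (ll v w ^ (t - 1) * (K * d) ^ s)"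
  have finP: "finite ?P" by (rule finite_subset[of _ "RT \<times> RT"]) (auto simp: finite_T)
  have leaf: "real (card {\<xi> \<in> shared v w. root_map \<xi> (NbrLeaf j l) = root_map \<xi> b}) \<le> ?B"
    if j: "j \<in> {1..t}" "l \<in> {1..s}" and b: "b \<in> RT" "b \<noteq> NbrLeaf j l" for j l b
  proof -
    consider (centre) i where "i \<in> {1..s'}" "b = CentreLeaf i"
      | (same) k where "k \<in> {1..s}" "k \<noteq> l" "b = NbrLeaf j k"
      | (other) i k where "i \<in> {1..t}" "i \<noteq> j" "k \<in> {1..s}" "b = NbrLeaf i k"
    proof -
      have "(\<exists>i\<in>{1..s'}. b = CentreLeaf i) \<or> (\<exists>i\<in>{1..t}. \<exists>k\<in>{1..s}. b = NbrLeaf i k)"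
        using b(1) by (auto simp: T_roots_def nbr_leaves_iff)
      then show ?thesis using b(2) that by metis
    qed
    then show ?thesis
    proof cases
      case centre
      have "real (card {\<xi> \<in> shared v w. (\<lambda>U z y. y l = U i) (fst \<xi>) (restrict (snd \<xi>) ({1..t} - {j})) (snd \<xi> j)})
         \<le> uu v w * ll v w ^ (t - 1) * (K * d) ^ s"
        using card_leaf_tuples_at[OF assms(1) j(2)] by (intro card_shared_one j(1)) auto
      then show ?thesis by (simp add: centre root_map_def mult.assoc)
    next
      case same
      have "{\<xi> \<in> shared v w. root_map \<xi> (NbrLeaf j l) = root_map \<xi> b} = {}"
      proof -
        have "snd \<xi> j l \<noteq> snd \<xi> j k" if "\<xi> \<in> shared v w" for \<xi>
        proof -
          have "snd \<xi> \<in> {1..t} \<rightarrow>\<^sub>E (leaf_tuples v \<inter> leaf_tuples w)" using that by (auto simp: shared_def)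
          from PiE_mem[OF this j(1)] have "inj_on (snd \<xi> j) {1..s}" by (simp add: leaf_tuples_def)
          then show ?thesis using same(1,2) j(2) by (auto dest: inj_onD)
        qed
        then show ?thesis by (auto simp: same root_map_def)
      qed
      then have "real (card {\<xi> \<in> shared v w. root_map \<xi> (NbrLeaf j l) = root_map \<xi> b}) = 0"
        by (simp only: card.empty)
      then show ?thesis using Kd_ge_1 by simp
    next
      case other
      have "real (card {\<xi> \<in> shared v w. (\<lambda>U z y. y l = z i k) (fst \<xi>) (restrict (snd \<xi>) ({1..t} - {j})) (snd \<xi> j)})
         \<le> uu v w * ll v w ^ (t - 1) * (K * d) ^ s"
        using card_leaf_tuples_at[OF assms(1) j(2)]
        by (intro card_shared_one j(1)) (auto simp del: restrict_apply)
      then show ?thesis using other(1,2) by (simp add: other(4) root_map_def mult.assoc)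
    qed
  qed
  have pair: "real (card {\<xi> \<in> shared v w. root_map \<xi> a = root_map \<xi> b}) \<le> ?B" if "(a, b) \<in> ?P" for a b
  proof -
    have ab: "a \<in> RT" "b \<in> RT" "a \<noteq> b" using that by auto
    show ?thesis
    proof (cases "\<exists>j\<in>{1..t}. \<exists>l\<in>{1..s}. a = NbrLeaf j l")
      case True
      then show ?thesis using leaf ab by blast
    next
      case a: False
      show ?thesis
      proof (cases "\<exists>j\<in>{1..t}. \<exists>l\<in>{1..s}. b = NbrLeaf j l")
        case True
        then obtain j l where "j \<in> {1..t}" "l \<in> {1..s}" "b = NbrLeaf j l" by blast
        then have "real (card {\<xi> \<in> shared v w. root_map \<xi> b = root_map \<xi> a}) \<le> ?B"
          using leaf[of j l a] ab by simp
        moreover have "{\<xi> \<in> shared v w. root_map \<xi> a = root_map \<xi> b} =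
            {\<xi> \<in> shared v w. root_map \<xi> b = root_map \<xi> a}"
          by (intro Collect_cong conj_cong refl) (rule eq_commute)
        ultimately show ?thesis by simp
      next
        case False
        then have "b \<in> CentreLeaf ` {1..s'}" using ab(2) by (auto simp: T_roots_def nbr_leaves_iff)
        moreover have "a \<in> CentreLeaf ` {1..s'}" using a ab(1) by (auto simp: T_roots_def nbr_leaves_iff)
        ultimately obtain i k where ik0: "i \<in> {1..s'}" "k \<in> {1..s'}" "a = CentreLeaf i" "b = CentreLeaf k"
          by blast
        then have ik: "i \<in> {1..s'}" "k \<in> {1..s'}" "i \<noteq> k" "a = CentreLeaf i" "b = CentreLeaf k"
          using ab(3) by auto
        have "fst \<xi> i \<noteq> fst \<xi> k" if "\<xi> \<in> shared v w" for \<xi>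
        proof -
          have "inj_on (fst \<xi>) {1..s'}" using that by (auto simp: shared_def centre_tuples_def)
          then show ?thesis using ik by (auto dest: inj_onD)
        qed
        then have "{\<xi> \<in> shared v w. root_map \<xi> a = root_map \<xi> b} = {}"
          by (auto simp: ik root_map_def)
        then have "real (card {\<xi> \<in> shared v w. root_map \<xi> a = root_map \<xi> b}) = 0"
          by (simp only: card.empty)
        then show ?thesis using Kd_ge_1 by simp
      qed
    qed
  qed
  have "{\<xi> \<in> shared v w. \<not> inj_on (root_map \<xi>) RT} =
      (\<Union>ab\<in>?P. {\<xi> \<in> shared v w. root_map \<xi> (fst ab) = root_map \<xi> (snd ab)})"
    by (auto simp: inj_on_def) metis
  then have "card {\<xi> \<in> shared v w. \<not> inj_on (root_map \<xi>) RT} \<le>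
      (\<Sum>ab\<in>?P. card {\<xi> \<in> shared v w. root_map \<xi> (fst ab) = root_map \<xi> (snd ab)})"
    using card_UN_le[OF finP] by simp
  then have "real (card {\<xi> \<in> shared v w. \<not> inj_on (root_map \<xi>) RT}) \<le>
      (\<Sum>ab\<in>?P. real (card {\<xi> \<in> shared v w. root_map \<xi> (fst ab) = root_map \<xi> (snd ab)}))"
    by (simp only: flip: of_nat_sum of_nat_le_iff)
  also have "\<dots> \<le> real (card ?P) * ?B"
  proof -
    have "real (card {\<xi> \<in> shared v w. root_map \<xi> (fst ab) = root_map \<xi> (snd ab)}) \<le> ?B"
      if "ab \<in> ?P" for ab using pair[of "fst ab" "snd ab"] that by simp
    from sum_bounded_above[of ?P, OF this] show ?thesis by simp
  qed
  also have "\<dots> \<le> real ((s * t + s') ^ 2) * ?B"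
  proof (rule mult_right_mono)
    have "card ?P \<le> card (RT \<times> RT)" by (intro card_mono) (auto simp: finite_T)
    then show "real (card ?P) \<le> real ((s * t + s') ^ 2)"
      by (simp add: card_cartesian_product card_T_roots power2_eq_square flip: of_nat_mult of_nat_add)
  qed (use Kd_ge_1 in auto)
  finally show ?thesis by simp
qed

text \<open>The total number of pairs of centres with common roots. By the cover lemma it is controlled by
  the pairs that also share some \<open>q\<^sub>j\<close>; by weighted AM-GM the latter are absorbed into the former up
  to the \<open>t\<close>-th moment of the codegree, because all the \<open>t\<close> branches have the same set of leaf tuples.\<close>

lemma pairs_of_centres_le:
  fixes wt :: nat and c C1 :: real
  defines "wt \<equiv> p * (t + 1) + (s * t + s')"
  defines "c \<equiv> real (t * wt * t + 2 * t ^ 2 + (s * t + s') ^ 2) + 1"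
  defines "C1 \<equiv> c * (4 * c) ^ t"
  assumes t: "t \<ge> 4" and Nd: "N \<le> d\<^sup>2"
  shows "(\<Sum>v\<in>V. \<Sum>w\<in>V. uu v w * ll v w ^ t) \<le> 4 * wt * (\<Sum>\<xi>\<in>root_space. real (card (centres \<xi>)))
    + 2 * C1 * 2 ^ t * (K * d) ^ (s * t) * (\<Sum>v\<in>V. \<Sum>w\<in>V. uu v w * codeg v w ^ t)
    + 2 * C1 * (2 ^ t + 1) * K ^ b * (N * d ^ b)"
proof -
  define Dq where "Dq = (K * d) ^ s"
  \<comment> \<open>The square root is taken so that \<open>B^2\<close> is the factor
    \<open>(K * d) ^ (2 * s + 1)\<close> of the double neighbours, in the form that the quadratic
    absorption expects.\<close>
  define B where "B = sqrt (K * d) ^ (2 * s + 1)"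
  define S where "S = (\<Sum>v\<in>V. \<Sum>w\<in>V. uu v w * ll v w ^ t)"
  have c: "c \<ge> 1" by (simp add: c_def)
  \<comment> \<open>Each of the two absorptions then costs a quarter of \<open>x ^ t\<close>,
    leaving half of the second moment on the left.\<close>
  define \<tau> where "\<tau> = 1 / (4 * c)"
  have \<tau>: "0 < \<tau>" "\<tau> \<le> 1" using c by (simp_all add: \<tau>_def)
  have sq: "1 \<le> sqrt (K * d)" "sqrt (K * d) ^ 2 = K * d" using Kd_ge_1 by auto
  have Dq1: "1 \<le> Dq" using Kd_ge_1 by (simp add: Dq_def one_le_power)
  have B0: "0 \<le> B" using Kd_ge_1 by (simp add: B_def)
  have B2: "B\<^sup>2 = (K * d) ^ (2 * s + 1)"
    unfolding B_def by (metis sq(2) power_mult mult.commute)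
  have DB: "Dq ^ t \<le> B ^ t"
  proof (rule power_mono)
    have "Dq = sqrt (K * d) ^ (2 * s)" unfolding Dq_def by (metis sq(2) power_mult)
    also have "\<dots> \<le> B" unfolding B_def using sq(1) by (intro power_increasing) auto
    finally show "Dq \<le> B" .
  qed (use Dq1 in simp)
  have C1: "0 \<le> C1" using c by (simp add: C1_def)
  have C1_eq: "c / \<tau> ^ t = C1" by (simp add: C1_def \<tau>_def power_divide)
  have tau_pow: "1 / \<tau> ^ m \<le> 1 / \<tau> ^ t" if "m \<le> t" for m
    using \<tau> that by (intro divide_left_mono power_decreasing) auto
  have pointwise: "c * (x ^ (t - 1) * A) + c * (x ^ (t - 2) * B\<^sup>2) \<le> x ^ t / 2 + C1 * (A ^ t + B ^ t)"
    if "x \<ge> 0" "A \<ge> 0" for x A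
  proof -
    have "c * (x ^ (t - 1) * A) \<le> c * (\<tau> * x ^ t + A ^ t / \<tau> ^ (t - 1))"
      using that \<tau> t c by (intro mult_left_mono absorb_linear) auto
    also have "\<dots> = x ^ t / 4 + c * A ^ t * (1 / \<tau> ^ (t - 1))"
      using c by (simp add: \<tau>_def field_simps)
    also have "\<dots> \<le> x ^ t / 4 + c * A ^ t * (1 / \<tau> ^ t)"
      using tau_pow[of "t - 1"] that c by (intro add_left_mono mult_left_mono) auto
    finally have 1: "c * (x ^ (t - 1) * A) \<le> x ^ t / 4 + C1 * A ^ t"
      unfolding C1_eq[symmetric] by simp
    have "c * (x ^ (t - 2) * B\<^sup>2) \<le> c * (\<tau> * x ^ t + B ^ t / \<tau> ^ (t - 2))"
      using that \<tau> t c B0 by (intro mult_left_mono absorb_quadratic) auto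
    also have "\<dots> = x ^ t / 4 + c * B ^ t * (1 / \<tau> ^ (t - 2))"
      using c by (simp add: \<tau>_def field_simps)
    also have "\<dots> \<le> x ^ t / 4 + c * B ^ t * (1 / \<tau> ^ t)"
      using tau_pow[of "t - 2"] that c B0 by (intro add_left_mono mult_left_mono) auto
    finally have 2: "c * (x ^ (t - 2) * B\<^sup>2) \<le> x ^ t / 4 + C1 * B ^ t"
      unfolding C1_eq[symmetric] by simp
    show ?thesis using 1 2 by (simp add: algebra_simps)
  qed
  let ?h = "\<lambda>v w \<xi>. real (t * wt) * real (card (common_nbr_pairs v w (snd \<xi>)))
       + 2 * real (card (double_nbrs v (snd \<xi>))) + of_bool (\<not> inj_on (root_map \<xi>) RT)"
  have per_root: "(real (card (centres \<xi>)))\<^sup>2 \<le> 2 * wt * real (card (centres \<xi>))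
      + (\<Sum>v\<in>centres \<xi>. \<Sum>w\<in>centres \<xi>. ?h v w \<xi>)" if "\<xi> \<in> root_space" for \<xi>
  proof (cases "inj_on (root_map \<xi>) RT")
    case True
    then show ?thesis using card_centres_square[OF that True] by (simp add: wt_def)
  next
    case False
    have "(real (card (centres \<xi>)))\<^sup>2 = (\<Sum>v\<in>centres \<xi>. \<Sum>w\<in>centres \<xi>. 1)"
      by (simp add: power2_eq_square)
    also have "\<dots> \<le> (\<Sum>v\<in>centres \<xi>. \<Sum>w\<in>centres \<xi>. ?h v w \<xi>)"
      using False by (intro sum_mono) simp
    also have "\<dots> \<le> 2 * wt * real (card (centres \<xi>)) + (\<Sum>v\<in>centres \<xi>. \<Sum>w\<in>centres \<xi>. ?h v w \<xi>)"
      by simp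
    finally show ?thesis .
  qed
  have "S = (\<Sum>\<xi>\<in>root_space. (real (card (centres \<xi>)))\<^sup>2)"
    unfolding S_def by (rule sum_shared_eq_sum_square)
  also have "\<dots> \<le> (\<Sum>\<xi>\<in>root_space. 2 * wt * real (card (centres \<xi>))
      + (\<Sum>v\<in>centres \<xi>. \<Sum>w\<in>centres \<xi>. ?h v w \<xi>))"
    by (intro sum_mono per_root)
  also have "\<dots> = 2 * wt * (\<Sum>\<xi>\<in>root_space. real (card (centres \<xi>)))
      + (\<Sum>v\<in>V. \<Sum>w\<in>V. \<Sum>\<xi>\<in>shared v w. ?h v w \<xi>)"
    by (simp only: sum.distrib sum_distrib_left sum_centres_pairs)
  also have "(\<Sum>v\<in>V. \<Sum>w\<in>V. \<Sum>\<xi>\<in>shared v w. ?h v w \<xi>) \<le> (\<Sum>v\<in>V. \<Sum>w\<in>V. uu v w * ll v w ^ t / 2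
      + C1 * 2 ^ t * (K * d) ^ (s * t) * (uu v w * codeg v w ^ t) + C1 * (2 ^ t + 1) * ((K * d) ^ s' * B ^ t))"
  proof (intro sum_mono)
    fix v w assume vw: "v \<in> V" "w \<in> V"
    define x where "x = ll v w"
    define l where "l = codeg v w"
    define u where "u = uu v w"
    have pos: "0 \<le> x" "0 \<le> l" "0 \<le> u" by (simp_all add: x_def l_def u_def)
    have "(\<Sum>\<xi>\<in>shared v w. ?h v w \<xi>) = real (t * wt) * (\<Sum>\<xi>\<in>shared v w. real (card (common_nbr_pairs v w (snd \<xi>))))
       + 2 * (\<Sum>\<xi>\<in>shared v w. real (card (double_nbrs v (snd \<xi>))))
       + real (card {\<xi> \<in> shared v w. \<not> inj_on (root_map \<xi>) RT})"
      using finite_shared by (simp add: sum.distrib sum_distrib_left Int_def)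
    also have "\<dots> \<le> real (t * wt) * (t * (u * (x ^ (t - 1) * (l * Dq))))
       + 2 * (t ^ 2 * (u * (x ^ (t - 2) * B\<^sup>2))) + (s * t + s') ^ 2 * (u * (x ^ (t - 1) * Dq))"
      using sum_common_nbr_pairs[OF vw] sum_double_nbrs[OF vw] card_shared_noninj[OF vw]
      unfolding x_def l_def u_def Dq_def B2 by (intro add_mono mult_left_mono) auto
    \<comment> \<open>Replacing \<open>l\<close> by \<open>l + 1\<close> gives the non-injective
      term, which lacks a codegree factor, the same shape as the shared neighbours.\<close>
    also have "\<dots> \<le> real (t * wt * t) * (u * (x ^ (t - 1) * ((l + 1) * Dq)))
       + (c * (u * (x ^ (t - 2) * B\<^sup>2)) + (s * t + s') ^ 2 * (u * (x ^ (t - 1) * ((l + 1) * Dq))))"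
    proof -
      have "real (t * wt) * (t * (u * (x ^ (t - 1) * (l * Dq)))) \<le> real (t * wt * t) * (u * (x ^ (t - 1) * ((l + 1) * Dq)))"
      proof -
        have "u * (x ^ (t - 1) * (l * Dq)) \<le> u * (x ^ (t - 1) * ((l + 1) * Dq))"
          using pos Dq1 by (intro mult_left_mono mult_right_mono) auto
        from mult_left_mono[OF this, of "real (t * wt * t)"]
        have "real (t * wt * t) * (u * (x ^ (t - 1) * (l * Dq))) \<le> real (t * wt * t) * (u * (x ^ (t - 1) * ((l + 1) * Dq)))"
          by simp
        then show ?thesis by (simp only: of_nat_mult mult.assoc)
      qed
      moreover have "2 * (t ^ 2 * (u * (x ^ (t - 2) * B\<^sup>2))) \<le> c * (u * (x ^ (t - 2) * B\<^sup>2))"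
      proof -
        have "2 * real (t ^ 2) \<le> c" by (simp add: c_def)
        then have "2 * real (t ^ 2) * (u * (x ^ (t - 2) * B\<^sup>2)) \<le> c * (u * (x ^ (t - 2) * B\<^sup>2))"
          using pos by (intro mult_right_mono) auto
        then show ?thesis by (simp add: mult.assoc)
      qed
      moreover have "(s * t + s') ^ 2 * (u * (x ^ (t - 1) * Dq)) \<le> (s * t + s') ^ 2 * (u * (x ^ (t - 1) * ((l + 1) * Dq)))"
        using pos Dq1 mult_right_mono[of 1 "l + 1" Dq] by (intro mult_left_mono) auto
      ultimately show ?thesis by linarith
    qed
    also have "\<dots> \<le> c * (u * (x ^ (t - 1) * ((l + 1) * Dq))) + c * (u * (x ^ (t - 2) * B\<^sup>2))"
    proof -
      have "(real (t * wt * t) + real ((s * t + s') ^ 2)) * (u * (x ^ (t - 1) * ((l + 1) * Dq)))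
          \<le> c * (u * (x ^ (t - 1) * ((l + 1) * Dq)))"
        using pos Dq1 by (intro mult_right_mono) (auto simp: c_def)
      then show ?thesis by (simp add: distrib_right)
    qed
    also have "\<dots> = u * (c * (x ^ (t - 1) * ((l + 1) * Dq)) + c * (x ^ (t - 2) * B\<^sup>2))"
      by (simp add: algebra_simps)
    also have "\<dots> \<le> u * (x ^ t / 2 + C1 * (((l + 1) * Dq) ^ t + B ^ t))"
      using pos Dq1 by (intro mult_left_mono pointwise) auto
    also have "\<dots> \<le> u * (x ^ t / 2 + C1 * (2 ^ t * l ^ t * Dq ^ t + (2 ^ t + 1) * B ^ t))"
    proof -
      have "((l + 1) * Dq) ^ t \<le> 2 ^ t * (l ^ t + 1) * Dq ^ t"
        unfolding power_mult_distrib using add_one_power_le[OF pos(2), of t] Dq1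
        by (intro mult_right_mono) auto
      also have "\<dots> \<le> 2 ^ t * l ^ t * Dq ^ t + 2 ^ t * B ^ t"
        using DB by (simp add: algebra_simps)
      finally have "((l + 1) * Dq) ^ t + B ^ t \<le> 2 ^ t * l ^ t * Dq ^ t + (2 ^ t + 1) * B ^ t"
        by (simp add: distrib_right)
      then show ?thesis using pos C1 by (intro mult_left_mono add_left_mono) auto
    qed
    also have "\<dots> = u * x ^ t / 2 + C1 * 2 ^ t * Dq ^ t * (u * l ^ t) + C1 * (2 ^ t + 1) * (u * B ^ t)"
      by (simp add: algebra_simps)
    also have "\<dots> \<le> u * x ^ t / 2 + C1 * 2 ^ t * Dq ^ t * (u * l ^ t) + C1 * (2 ^ t + 1) * ((K * d) ^ s' * B ^ t)"
    proof -
      have "card (centre_tuples v \<inter> centre_tuples w) \<le> card ({1..s'} \<rightarrow>\<^sub>E nb E v)"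
        using finite_nb by (intro card_mono finite_PiE) (auto simp: centre_tuples_def)
      then have "u \<le> (K * d) ^ s'" using card_nb_tuples[OF vw(1), of s'] unfolding u_def by linarith
      then show ?thesis using C1 B0 by (intro add_left_mono mult_left_mono mult_right_mono) auto
    qed
    finally show "(\<Sum>\<xi>\<in>shared v w. ?h v w \<xi>) \<le> uu v w * ll v w ^ t / 2
      + C1 * 2 ^ t * (K * d) ^ (s * t) * (uu v w * codeg v w ^ t) + C1 * (2 ^ t + 1) * ((K * d) ^ s' * B ^ t)"
      by (simp add: u_def x_def l_def Dq_def power_mult)
  qed
  also have "\<dots> = S / 2 + C1 * 2 ^ t * (K * d) ^ (s * t) * (\<Sum>v\<in>V. \<Sum>w\<in>V. uu v w * codeg v w ^ t)
     + C1 * (2 ^ t + 1) * (N * N * ((K * d) ^ s' * B ^ t))"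
    by (simp add: S_def sum.distrib sum_divide_distrib sum_distrib_left mult_ac)
  also have "C1 * (2 ^ t + 1) * (N * N * ((K * d) ^ s' * B ^ t)) \<le> C1 * (2 ^ t + 1) * (N * (K * d) ^ b)"
  proof (rule mult_left_mono)
    \<comment> \<open>Here \<open>N <= d^2\<close> and \<open>t >= 4\<close> meet:
      \<open>N <= sqrt (K * d) ^ 4 <= sqrt (K * d) ^ t\<close>, and this supplies the half power
      that \<open>B ^ t\<close> lacks for \<open>(K * d) ^ ((s + 1) * t)\<close>.\<close>
    have "N \<le> (K * d)\<^sup>2"
    proof -
      have "d\<^sup>2 \<le> (K * d)\<^sup>2" using d_ge_1 K_ge_1 mult_right_mono[of 1 K d] by (intro power_mono) auto
      then show ?thesis using Nd by linarith
    qed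
    also have "(K * d)\<^sup>2 = (sqrt (K * d) ^ 2)\<^sup>2" by (simp only: sq(2))
    also have "\<dots> = sqrt (K * d) ^ 4" by (simp flip: power_mult)
    also have "\<dots> \<le> sqrt (K * d) ^ t" by (rule power_increasing[OF t sq(1)])
    finally have "N * B ^ t \<le> sqrt (K * d) ^ t * B ^ t" using B0 by (intro mult_right_mono) auto
    also have "\<dots> = (sqrt (K * d) * B) ^ t" by (simp add: power_mult_distrib)
    also have "sqrt (K * d) * B = (sqrt (K * d) ^ 2) ^ (s + 1)"
      unfolding B_def by (simp flip: power_mult power_Suc)
    also have "\<dots> = (K * d) ^ (s + 1)" by (simp only: sq(2))
    finally have "N * (N * B ^ t) * (K * d) ^ s' \<le> N * ((K * d) ^ (s + 1)) ^ t * (K * d) ^ s'"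
      using Kd_ge_1 by (intro mult_left_mono mult_right_mono) auto
    also have "\<dots> = N * ((K * d) ^ ((s + 1) * t) * (K * d) ^ s')" by (simp only: power_mult mult.assoc)
    also have "\<dots> = N * (K * d) ^ ((s + 1) * t + s')" by (simp only: power_add)
    also have "(s + 1) * t + s' = b" by simp
    finally show "N * N * ((K * d) ^ s' * B ^ t) \<le> N * (K * d) ^ b" by (simp add: mult_ac)
  qed (use C1 in simp)
  finally have "S \<le> 2 * wt * (\<Sum>\<xi>\<in>root_space. real (card (centres \<xi>))) + (S / 2
     + C1 * 2 ^ t * (K * d) ^ (s * t) * (\<Sum>v\<in>V. \<Sum>w\<in>V. uu v w * codeg v w ^ t)
     + C1 * (2 ^ t + 1) * (N * (K * d) ^ b))" by simp
  then show ?thesis unfolding S_def[symmetric] by (simp add: power_mult_distrib algebra_simps)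
qed

end

section \<open>Dependent random choice\<close>

context power_free_host
begin

text \<open>A pair of a root placement and a centre comes from at most \<open>M ^ t\<close>
  embeddings without ample \<open>nbr_star\<close>, so the first moment of the number of centres is
  large.\<close>

lemma sum_centres_lower:
  "card (nbr_good M) \<le> M ^ t * (\<Sum>\<xi>\<in>root_space. card (centres \<xi>))"
proof -
  define rt where "rt = (\<lambda>f :: tree_vertex \<Rightarrow> 'v.
     ((\<lambda>i\<in>{1..s'}. f (CentreLeaf i)), (\<lambda>j\<in>{1..t}. \<lambda>i\<in>{1..s}. f (NbrLeaf j i))))"
  let ?Z = "Sigma root_space centres"
  have fin: "finite (nbr_good M)"
    by (rule finite_subset[OF _ finite_hom[OF finite_T(1)]]) (auto simp: nbr_good_def emb_def)
  have finZ: "finite ?Z" using finite_root_space finite_centres by auto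
  have "real (card (nbr_good M)) \<le> real (card ?Z) * real (M ^ t)"
  proof (rule card_le_fibres[OF finZ _ fin, of "\<lambda>f. (rt f, f Centre)"])
    show "(\<lambda>f. (rt f, f Centre)) ` nbr_good M \<subseteq> ?Z"
    proof
      fix z assume "z \<in> (\<lambda>f. (rt f, f Centre)) ` nbr_good M"
      then obtain f where f: "f \<in> nbr_good M" and z: "z = (rt f, f Centre)" by blast
      have fh: "f \<in> VT \<rightarrow>\<^sub>E V" "\<And>j. j \<in> {1..t} \<Longrightarrow> f (Nbr j) \<in> nb E (f Centre)"
        "\<And>j i. j \<in> {1..t} \<Longrightarrow> i \<in> {1..s} \<Longrightarrow> f (NbrLeaf j i) \<in> nb E (f (Nbr j))"
        "\<And>i. i \<in> {1..s'} \<Longrightarrow> f (CentreLeaf i) \<in> nb E (f Centre)" and inj: "inj_on f VT"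
        using f by (auto simp: nbr_good_def emb_def homs_T_iff)
      have VTm: "Centre \<in> VT" "\<And>i. i \<in> {1..s'} \<Longrightarrow> CentreLeaf i \<in> VT"
        "\<And>j i. j \<in> {1..t} \<Longrightarrow> i \<in> {1..s} \<Longrightarrow> NbrLeaf j i \<in> VT"
        by (auto simp: T_vs_def nbr_leaves_iff)
      have fV: "f x \<in> V" if "x \<in> VT" for x using PiE_mem[OF fh(1) that] .
      have U: "(\<lambda>i\<in>{1..s'}. f (CentreLeaf i)) \<in> centre_tuples (f Centre)"
      proof -
        have "inj_on (\<lambda>i\<in>{1..s'}. f (CentreLeaf i)) {1..s'}"
        proof (rule inj_onI)
          fix i k assume "i \<in> {1..s'}" "k \<in> {1..s'}"
            "(\<lambda>i\<in>{1..s'}. f (CentreLeaf i)) i = (\<lambda>i\<in>{1..s'}. f (CentreLeaf i)) k"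
          then show "i = k" using inj_onD[OF inj, of "CentreLeaf i" "CentreLeaf k"] VTm by simp
        qed
        then show ?thesis using fh(4) by (simp add: centre_tuples_def)
      qed
      have Y: "(\<lambda>i\<in>{1..s}. f (NbrLeaf j i)) \<in> leaf_tuples (f Centre)" if j: "j \<in> {1..t}" for j
      proof -
        have "inj_on (\<lambda>i\<in>{1..s}. f (NbrLeaf j i)) {1..s}"
        proof (rule inj_onI)
          fix i k assume "i \<in> {1..s}" "k \<in> {1..s}"
            "(\<lambda>i\<in>{1..s}. f (NbrLeaf j i)) i = (\<lambda>i\<in>{1..s}. f (NbrLeaf j i)) k"
          then show "i = k" using inj_onD[OF inj, of "NbrLeaf j i" "NbrLeaf j k"] VTm j by simp
        qed
        moreover have "(\<lambda>i\<in>{1..s}. f (NbrLeaf j i)) ` {1..s} \<subseteq> nb E (f (Nbr j))"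
          using fh(3)[OF j] by auto
        moreover have "(\<lambda>i\<in>{1..s}. f (NbrLeaf j i)) \<in> {1..s} \<rightarrow>\<^sub>E V"
          using fV VTm(3)[OF j] by simp
        ultimately show ?thesis using fh(2)[OF j] unfolding leaf_tuples_def by blast
      qed
      have "rt f \<in> root_space"
        using fV VTm(2,3) by (simp add: rt_def root_space_def)
      moreover have "f Centre \<in> centres (rt f)"
        using U Y fV[OF VTm(1)] by (simp add: rt_def centres_def)
      ultimately show "z \<in> ?Z" by (simp add: z)
    qed
    fix z :: "((nat \<Rightarrow> 'v) \<times> (nat \<Rightarrow> nat \<Rightarrow> 'v)) \<times> 'v"
    let ?\<Phi> = "{f \<in> nbr_good M. rt f = fst z}"
    have agree: "f r = g r" if fg: "f \<in> ?\<Phi>" "g \<in> ?\<Phi>" and r: "r \<in> RT" for f g r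
    proof -
      have "rt f = rt g" using fg by simp
      then have eq: "(\<lambda>i\<in>{1..s'}. f (CentreLeaf i)) = (\<lambda>i\<in>{1..s'}. g (CentreLeaf i))"
        "(\<lambda>j\<in>{1..t}. \<lambda>i\<in>{1..s}. f (NbrLeaf j i)) = (\<lambda>j\<in>{1..t}. \<lambda>i\<in>{1..s}. g (NbrLeaf j i))"
        by (simp_all add: rt_def)
      consider i where "i \<in> {1..s'}" "r = CentreLeaf i" | j i where "j \<in> {1..t}" "i \<in> {1..s}" "r = NbrLeaf j i"
        using r by (auto simp: T_roots_def nbr_leaves_iff)
      then show ?thesis
      proof cases
        case 1
        then show ?thesis using fun_cong[OF eq(1), of i] by simp
      next
        case 2
        then show ?thesis using arg_cong[OF eq(2), of "\<lambda>h. h j i"] by simp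
      qed
    qed
    have "card {f \<in> ?\<Phi>. f Centre = snd z} \<le> M ^ t"
      using agree by (intro card_through_centre) (auto simp: nbr_good_def)
    moreover have "{f \<in> nbr_good M. (rt f, f Centre) = z} = {f \<in> ?\<Phi>. f Centre = snd z}"
      by (cases z) auto
    ultimately show "real (card {f \<in> nbr_good M. (rt f, f Centre) = z}) \<le> real (M ^ t)"
      by (simp only: of_nat_le_iff)
  qed
  also have "card ?Z = (\<Sum>\<xi>\<in>root_space. card (centres \<xi>))"
    using finite_root_space finite_centres by simp
  finally have "real (card (nbr_good M)) \<le> real ((\<Sum>\<xi>\<in>root_space. card (centres \<xi>)) * M ^ t)"
    by (simp only: of_nat_mult)
  then show ?thesis by (simp only: of_nat_le_iff mult.commute)
qed

text \<open>By Cauchy-Schwarz the second moment \<open>S\<close> is at least the mean number of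
  centres times the first moment \<open>P\<close>. Since the mean is a large constant, the error
  terms of the upper bound cannot account for \<open>S\<close>, and the codegree moment has to.
  Averaging over \<open>v\<close> localises it.\<close>

lemma large_codegree_moment:
  fixes wt :: nat and c C1 \<Gamma> G :: real
  defines "wt \<equiv> p * (t + 1) + (s * t + s')"
  defines "c \<equiv> real (t * wt * t + 2 * t ^ 2 + (s * t + s') ^ 2) + 1"
  defines "C1 \<equiv> c * (4 * c) ^ t"
  assumes t: "t \<ge> 4" and s: "s \<ge> 1" and Nd: "N \<le> d\<^sup>2" and M: "M \<ge> 1"
    and good: "3 / 4 * (N * d ^ b) \<le> card (nbr_good M)"
    and G: "G * N ^ (s * t + s' - 1) \<le> d ^ b" and \<Gamma>: "\<Gamma> \<ge> 0"
    and GM: "2 * M ^ t * (4 * wt + 2 * M ^ t * (2 * C1 * (2 ^ t + 1) * K ^ b)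
       + 2 * M ^ t * (2 * C1 * 2 ^ t * K ^ (s * t)) * \<Gamma>) \<le> G"
  shows "\<exists>v\<in>V. \<Gamma> * d ^ (t + s') \<le> (\<Sum>w\<in>V. uu v w * codeg v w ^ t)"
proof -
  define P where "P = (\<Sum>\<xi>\<in>root_space. real (card (centres \<xi>)))"
  define S where "S = (\<Sum>v\<in>V. \<Sum>w\<in>V. uu v w * ll v w ^ t)"
  define T where "T = (\<Sum>v\<in>V. \<Sum>w\<in>V. uu v w * codeg v w ^ t)"
  define Mt where "Mt = real (M ^ t)"
  define C2 where "C2 = 2 * C1 * 2 ^ t * K ^ (s * t)"
  define C3 where "C3 = 2 * C1 * (2 ^ t + 1) * K ^ b"
  define X where "X = N * d ^ b"
  have c: "c \<ge> 1" by (simp add: c_def)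
  have C1: "C1 > 0" using c by (simp add: C1_def)
  have C2: "C2 > 0" and C3: "C3 > 0" using C1 K_ge_1 by (simp_all add: C2_def C3_def add_pos_pos)
  have Mt: "Mt \<ge> 1" using M by (simp add: Mt_def)
  have X: "X > 0" using N_ge_1 d_ge_1 by (simp add: X_def)
  have up: "S \<le> 4 * wt * P + C2 * d ^ (s * t) * T + C3 * X"
    using pairs_of_centres_le[OF t Nd]
    unfolding S_def P_def T_def C2_def C3_def X_def wt_def c_def C1_def by (simp add: power_mult_distrib mult_ac)
  have XP: "X \<le> 2 * Mt * P"
  proof -
    have "real (card (nbr_good M)) \<le> real (M ^ t * (\<Sum>\<xi>\<in>root_space. card (centres \<xi>)))"
      using sum_centres_lower[of M] by (simp only: of_nat_le_iff)
    then have "real (card (nbr_good M)) \<le> Mt * P" by (simp add: Mt_def P_def)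
    then have "3 * X \<le> 4 * (Mt * P)" using good by (simp add: X_def)
    moreover have "0 \<le> Mt * P" using Mt by (simp add: P_def sum_nonneg)
    ultimately show ?thesis by linarith
  qed
  have P: "P > 0"
  proof (rule ccontr)
    assume "\<not> P > 0"
    then have "2 * Mt * P \<le> 0" using Mt by (simp add: mult_le_0_iff)
    then show False using XP X by linarith
  qed
  define R where "R = real (card root_space)"
  have st: "s * t + s' \<ge> 1" using s t by (metis One_nat_def Suc_le_eq add_gr_0 nat_0_less_mult_iff t_pos)
  have R: "R = N * N ^ (s * t + s' - 1)"
    unfolding R_def card_root_space using st by (metis One_nat_def Suc_le_eq power_eq_if less_not_refl)
  have R0: "R > 0" unfolding R using N_ge_1 by simp
  have S_sq: "S = (\<Sum>\<xi>\<in>root_space. (real (card (centres \<xi>)))\<^sup>2)"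
    unfolding S_def by (rule sum_shared_eq_sum_square)
  have PS: "P\<^sup>2 \<le> R * S"
    unfolding P_def S_sq R_def by (rule square_sum_le[OF finite_root_space])
  have GX: "G * R \<le> X"
    unfolding R X_def using mult_left_mono[OF G, of N] by (simp add: mult_ac)
  \<comment> \<open>In \<open>S >= H * P\<close> the first two summands of \<open>H\<close> cancel
    the errors \<open>4 * wt * P\<close> and \<open>C3 * X <= 2 * Mt * C3 * P\<close>; the third
    remains and must be paid by \<open>T\<close>.\<close>
  define H where "H = 4 * wt + 2 * Mt * C3 + 2 * Mt * C2 * \<Gamma>"
  have "2 * Mt * H \<le> G" using GM by (simp add: H_def Mt_def C2_def C3_def)
  then have "2 * Mt * H * R \<le> G * R" using R0 by (intro mult_right_mono) auto
  also have "\<dots> \<le> 2 * Mt * P" using GX XP by linarith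
  finally have "H * R \<le> P" using Mt by simp
  then have "H * R * P \<le> P * P" using P by (intro mult_right_mono) auto
  also have "\<dots> \<le> R * S" using PS by (simp add: power2_eq_square)
  finally have "H * P \<le> S" using R0 by (simp add: mult_ac)
  moreover have "C3 * X \<le> C3 * (2 * Mt * P)" using XP C3 by (intro mult_left_mono) auto
  ultimately have "2 * Mt * C2 * \<Gamma> * P \<le> C2 * d ^ (s * t) * T"
    using up unfolding H_def by (simp add: algebra_simps)
  moreover have "C2 * \<Gamma> * X \<le> C2 * \<Gamma> * (2 * Mt * P)" using XP C2 \<Gamma> by (intro mult_left_mono) auto
  ultimately have "C2 * (\<Gamma> * X) \<le> C2 * (d ^ (s * t) * T)" by (simp add: mult_ac)
  then have "\<Gamma> * X \<le> d ^ (s * t) * T" using C2 by simp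
  moreover have "X = d ^ (s * t) * (N * d ^ (t + s'))" by (simp add: X_def power_add mult_ac)
  ultimately have "d ^ (s * t) * (\<Gamma> * (N * d ^ (t + s'))) \<le> d ^ (s * t) * T" by (simp add: mult_ac)
  then have T: "\<Gamma> * (N * d ^ (t + s')) \<le> T" using d_ge_1 by simp
  show ?thesis
  proof (rule ccontr)
    assume "\<not> ?thesis"
    then have "(\<Sum>w\<in>V. uu v w * codeg v w ^ t) < \<Gamma> * d ^ (t + s')" if "v \<in> V" for v
      using that by (simp add: not_le)
    then have "T < (\<Sum>v\<in>V. \<Gamma> * d ^ (t + s'))"
      unfolding T_def using finite_V V_nonempty by (intro sum_strict_mono) auto
    then show False using T by (simp add: mult_ac)
  qed
qed

text \<open>Dependent random choice: for some tuple of neighbours of \<open>v\<close> the set \<open>B\<close> of their common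
  neighbours exceeds the number of its \<open>(s+1)\<close>-subsets with few common neighbours in \<open>nb E v\<close>;
  destroying the latter leaves room for all \<open>NbrLeaf\<close>s and centres of a sunflower.\<close>

lemma no_large_codegree_moment:
  fixes a h :: nat and \<Gamma> :: real
  defines "a \<equiv> p * (t + 1) + (s * t + s') + t"
  defines "h \<equiv> p * (t + 1) + s * t + 1"
  assumes v: "v \<in> V" and moment: "\<Gamma> * d ^ (t + s') \<le> (\<Sum>w\<in>V. uu v w * codeg v w ^ t)"
    and ts: "t + s' \<ge> 2 * s + 3" and d: "K ^ (2 * (s + 1)) * a ^ (t + s') \<le> d"
    and \<Gamma>: "\<Gamma> > 1 + h * K ^ (t + s')"
  shows False
proof -
  define r where "r = t + s'"
  define TT where "TT = centre_tuples v \<times> ({1..t} \<rightarrow>\<^sub>E nb E v)"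
  define B where "B = (\<lambda>\<tau>. {w \<in> V. fst \<tau> \<in> centre_tuples w \<and> snd \<tau> \<in> {1..t} \<rightarrow>\<^sub>E nb E w})"
  \<comment> \<open>Endpoints of two-step walks from \<open>v\<close>. The sets
    \<open>B \<tau>\<close> lie in \<open>Z\<close> because \<open>t >= 1\<close> gives a common
    neighbour with \<open>v\<close>.\<close>
  define Z where "Z = (\<Union>x\<in>nb E v. nb E x)"
  define Qs where "Qs = {Q. Q \<subseteq> Z \<and> card Q = s + 1 \<and> card (common_nb E Q \<inter> nb E v) < a}"
  define bad where "bad = (\<lambda>\<tau>. {Q \<in> Qs. Q \<subseteq> B \<tau>})"
  have Kd: "0 \<le> K * d" using Kd_ge_1 by simp
  have finTT: "finite TT" unfolding TT_def using finite_centre_tuples finite_nb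
    by (intro finite_cartesian_product finite_PiE) auto
  have finB: "finite (B \<tau>)" for \<tau> using finite_V by (simp add: B_def)
  have finZ: "finite Z" unfolding Z_def using finite_nb by auto
  have finQs: "finite Qs" by (rule finite_subset[of _ "Pow Z"]) (auto simp: Qs_def finZ)
  have cardZ: "real (card Z) \<le> (K * d)\<^sup>2"
  proof -
    have "card Z \<le> (\<Sum>x\<in>nb E v. card (nb E x))" unfolding Z_def by (rule card_UN_le[OF finite_nb])
    then have "real (card Z) \<le> (\<Sum>x\<in>nb E v. real (card (nb E x)))" by (simp flip: of_nat_sum)
    also have "\<dots> \<le> real (card (nb E v)) * (K * d)"
      using max_deg nb_subset[of v] sum_bounded_above[of "nb E v" "\<lambda>x. real (card (nb E x))" "K * d"] by auto
    also have "\<dots> \<le> (K * d) * (K * d)" using max_deg[OF v] Kd by (intro mult_right_mono) auto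
    finally show ?thesis by (simp add: power2_eq_square)
  qed
  have cardQs: "real (card Qs) \<le> (K * d) ^ (2 * (s + 1))"
  proof -
    have "card Qs \<le> card {Q. Q \<subseteq> Z \<and> card Q = s + 1}"
      using finZ by (intro card_mono) (auto simp: Qs_def)
    also have "\<dots> = card Z choose (s + 1)" by (rule n_subsets[OF finZ])
    also have "\<dots> \<le> card Z ^ (s + 1)"
    proof (cases "s + 1 \<le> card Z")
      case True
      then show ?thesis by (rule binomial_le_pow)
    qed (simp add: binomial_eq_0)
    finally have "real (card Qs) \<le> real (card Z) ^ (s + 1)" by (simp only: of_nat_le_iff flip: of_nat_power)
    also have "\<dots> \<le> ((K * d)\<^sup>2) ^ (s + 1)" using cardZ by (intro power_mono) auto
    finally show ?thesis by (simp only: power_mult)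
  qed
  have sumB: "(\<Sum>\<tau>\<in>TT. real (card (B \<tau>))) = (\<Sum>w\<in>V. uu v w * codeg v w ^ t)"
  proof -
    have "(\<Sum>\<tau>\<in>TT. real (card (B \<tau>))) = (\<Sum>w\<in>V. real (card {\<tau> \<in> TT. fst \<tau> \<in> centre_tuples w \<and> snd \<tau> \<in> {1..t} \<rightarrow>\<^sub>E nb E w}))"
      using finTT finite_V by (intro sum_card_swap) (auto simp: B_def)
    also have "\<dots> = (\<Sum>w\<in>V. uu v w * codeg v w ^ t)"
    proof (rule sum.cong[OF refl])
      fix w
      have "{\<tau> \<in> TT. fst \<tau> \<in> centre_tuples w \<and> snd \<tau> \<in> {1..t} \<rightarrow>\<^sub>E nb E w} =
         (centre_tuples v \<inter> centre_tuples w) \<times> (({1..t} \<rightarrow>\<^sub>E nb E v) \<inter> ({1..t} \<rightarrow>\<^sub>E nb E w))"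
        by (auto simp: TT_def)
      also have "({1..t} \<rightarrow>\<^sub>E nb E v) \<inter> ({1..t} \<rightarrow>\<^sub>E nb E w) = {1..t} \<rightarrow>\<^sub>E (nb E v \<inter> nb E w)"
        by (rule PiE_Int)
      finally show "real (card {\<tau> \<in> TT. fst \<tau> \<in> centre_tuples w \<and> snd \<tau> \<in> {1..t} \<rightarrow>\<^sub>E nb E w}) = uu v w * codeg v w ^ t"
        by (simp add: card_cartesian_product card_PiE)
    qed
    finally show ?thesis .
  qed
  \<comment> \<open>A set \<open>Q\<close> of \<open>Qs\<close> lies in \<open>B \<tau>\<close> only
    if all entries of \<open>\<tau>\<close> are among the fewer than \<open>a\<close> common
    neighbours, so for at most \<open>a ^ r\<close> tuples. There are at most
    \<open>(K * d) ^ (2 * (s + 1))\<close> sets \<open>Q\<close>; one factor \<open>d\<close>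
    absorbs the constants, and \<open>2 * s + 3 <= r\<close> gives the claim.\<close>
  have sumbad: "(\<Sum>\<tau>\<in>TT. real (card (bad \<tau>))) \<le> d ^ r"
  proof -
    have "(\<Sum>\<tau>\<in>TT. real (card (bad \<tau>))) = (\<Sum>Q\<in>Qs. real (card {\<tau> \<in> TT. Q \<subseteq> B \<tau>}))"
      using finTT finQs by (intro sum_card_swap) (auto simp: bad_def)
    also have "\<dots> \<le> (\<Sum>Q\<in>Qs. real a ^ r)"
    proof (rule sum_mono)
      fix Q assume Q: "Q \<in> Qs"
      let ?C = "common_nb E Q \<inter> nb E v"
      have sub: "{\<tau> \<in> TT. Q \<subseteq> B \<tau>} \<subseteq> ({1..s'} \<rightarrow>\<^sub>E ?C) \<times> ({1..t} \<rightarrow>\<^sub>E ?C)"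
      proof
        fix \<tau> assume "\<tau> \<in> {\<tau> \<in> TT. Q \<subseteq> B \<tau>}"
        then obtain U T where \<tau>: "\<tau> = (U, T)" and U: "U \<in> centre_tuples v" and T: "T \<in> {1..t} \<rightarrow>\<^sub>E nb E v"
          and QB: "\<And>w. w \<in> Q \<Longrightarrow> U \<in> centre_tuples w \<and> T \<in> {1..t} \<rightarrow>\<^sub>E nb E w"
          by (cases \<tau>) (auto simp: TT_def B_def)
        have "U i \<in> ?C" if "i \<in> {1..s'}" for i
        proof -
          have "U i \<in> nb E w" if "w \<in> Q" for w
            using QB[OF that] \<open>i \<in> {1..s'}\<close> by (auto simp: centre_tuples_def)
          then show ?thesis using U that by (auto simp: common_nb_def nb_def centre_tuples_def)
        qed
        moreover have "T j \<in> ?C" if "j \<in> {1..t}" for j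
        proof -
          have "T j \<in> nb E w" if "w \<in> Q" for w using QB[OF that] PiE_mem[OF _ \<open>j \<in> {1..t}\<close>] by blast
          then show ?thesis using PiE_mem[OF T that] by (auto simp: common_nb_def nb_def)
        qed
        ultimately show "\<tau> \<in> ({1..s'} \<rightarrow>\<^sub>E ?C) \<times> ({1..t} \<rightarrow>\<^sub>E ?C)"
          using U T by (auto simp: \<tau> PiE_def centre_tuples_def)
      qed
      have "card {\<tau> \<in> TT. Q \<subseteq> B \<tau>} \<le> card (({1..s'} \<rightarrow>\<^sub>E ?C) \<times> ({1..t} \<rightarrow>\<^sub>E ?C))"
        using finite_nb by (intro card_mono sub finite_cartesian_product finite_PiE) auto
      also have "\<dots> = card ?C ^ r"
        by (simp add: card_cartesian_product card_PiE r_def power_add mult.commute)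
      also have "\<dots> \<le> a ^ r" using Q by (intro power_mono) (auto simp: Qs_def)
      finally show "real (card {\<tau> \<in> TT. Q \<subseteq> B \<tau>}) \<le> real a ^ r"
        by (simp only: of_nat_le_iff flip: of_nat_power)
    qed
    also have "\<dots> = real (card Qs) * real a ^ r" by simp
    also have "\<dots> \<le> (K * d) ^ (2 * (s + 1)) * real a ^ r"
      by (intro mult_right_mono cardQs) simp
    also have "\<dots> = (K ^ (2 * (s + 1)) * a ^ r) * d ^ (2 * (s + 1))"
      by (simp only: power_mult_distrib mult_ac of_nat_power)
    also have "\<dots> \<le> d * d ^ (2 * (s + 1))"
      using d d_ge_1 unfolding r_def by (intro mult_right_mono) auto
    also have "\<dots> = d ^ (2 * s + 3)" by (simp add: eval_nat_numeral)
    also have "\<dots> \<le> d ^ r" unfolding r_def by (rule power_increasing[OF ts d_ge_1])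
    finally show ?thesis .
  qed
  have cardTT: "real (card TT) \<le> (K * d) ^ r"
  proof -
    have "card TT \<le> card (({1..s'} \<rightarrow>\<^sub>E nb E v) \<times> ({1..t} \<rightarrow>\<^sub>E nb E v))"
      unfolding TT_def using finite_nb
      by (intro card_mono finite_cartesian_product finite_PiE) (auto simp: centre_tuples_def)
    also have "\<dots> = card (nb E v) ^ r"
      by (simp add: card_cartesian_product card_PiE r_def power_add mult.commute)
    finally have "real (card TT) \<le> real (card (nb E v)) ^ r" by (simp only: of_nat_le_iff flip: of_nat_power)
    also have "\<dots> \<le> (K * d) ^ r" using max_deg[OF v] by (intro power_mono) auto
    finally show ?thesis .
  qed
  \<comment> \<open>The moment is the sum of \<open>card (B \<tau>)\<close>, and
    \<open>\<Gamma>\<close> makes it exceed the sum of \<open>card (bad \<tau>)\<close> by more than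
    \<open>h\<close> per tuple.\<close>
  have "\<exists>\<tau>\<in>TT. card (bad \<tau>) + h \<le> card (B \<tau>)"
  proof (rule ccontr)
    assume "\<not> ?thesis"
    then have "card (B \<tau>) \<le> card (bad \<tau>) + h" if "\<tau> \<in> TT" for \<tau> using that by (meson nat_le_linear)
    then have "(\<Sum>\<tau>\<in>TT. real (card (B \<tau>))) \<le> (\<Sum>\<tau>\<in>TT. real (card (bad \<tau>)) + real h)"
      by (intro sum_mono) (simp only: of_nat_le_iff flip: of_nat_add)
    also have "\<dots> = (\<Sum>\<tau>\<in>TT. real (card (bad \<tau>))) + h * real (card TT)" by (simp add: sum.distrib)
    also have "\<dots> \<le> d ^ r + h * (K * d) ^ r"
      by (intro add_mono sumbad mult_left_mono cardTT) simp
    also have "\<dots> = (1 + h * K ^ r) * d ^ r" by (simp add: power_mult_distrib algebra_simps)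
    also have "\<dots> < \<Gamma> * d ^ r"
      using \<Gamma> d_ge_1 unfolding r_def by (intro mult_strict_right_mono) auto
    finally show False using moment unfolding sumB r_def by linarith
  qed
  then obtain U T where UT: "(U, T) \<in> TT" and many: "card (bad (U, T)) + h \<le> card (B (U, T))" by auto
  define pick where "pick = (\<lambda>Q :: 'v set. SOME x. x \<in> Q)"
  have pick: "pick Q \<in> Q" if "Q \<in> Qs" for Q
  proof -
    have "Q \<noteq> {}" using that by (auto simp: Qs_def)
    then show ?thesis unfolding pick_def by (simp add: some_in_eq)
  qed
  \<comment> \<open>One vertex is deleted from each bad set. The \<open>h\<close> vertices left
    provide \<open>s * t\<close> leaves, room to avoid \<open>W\<close>, and one more vertex for the
    centre.\<close>
  define B' where "B' = B (U, T) - pick ` bad (U, T)"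
  have finbad: "finite (bad (U, T))" using finQs by (simp add: bad_def)
  have cardB': "h \<le> card B'"
    using diff_card_le_card_Diff[of "pick ` bad (U, T)" "B (U, T)"] card_image_le[OF finbad, of pick] finbad many
    by (simp add: B'_def)
  have inB': "w \<in> V" "\<And>i. i \<in> {1..s'} \<Longrightarrow> U i \<in> nb E w" "w \<in> Z" if "w \<in> B'" for w
  proof -
    have w: "w \<in> V" "U \<in> centre_tuples w" "T \<in> {1..t} \<rightarrow>\<^sub>E nb E w" using that by (auto simp: B'_def B_def)
    show "w \<in> V" by fact
    show "U i \<in> nb E w" if "i \<in> {1..s'}" for i using w(2) that by (auto simp: centre_tuples_def)
    have t1: "1 \<in> {1..t}" using t_pos by simp
    have "T 1 \<in> nb E w" using PiE_mem[OF w(3) t1] .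
    moreover have "T 1 \<in> nb E v" using UT PiE_mem[OF _ t1] by (auto simp: TT_def)
    ultimately show "w \<in> Z" using nb_sym[of "T 1" E w] unfolding Z_def by blast
  qed
  have good: "a \<le> card (common_nb E Q \<inter> nb E v)" if "Q \<subseteq> B'" "card Q = s + 1" for Q
  proof (rule ccontr)
    assume "\<not> ?thesis"
    then have "Q \<in> Qs" using that inB'(3) by (auto simp: Qs_def)
    moreover from this have "Q \<in> bad (U, T)" using that by (auto simp: bad_def B'_def)
    ultimately show False using pick[of Q] that(1) by (auto simp: B'_def)
  qed
  have "s * t \<le> card B'" using cardB' by (simp add: h_def)
  then obtain Y0 where Y0: "Y0 \<subseteq> B'" "card Y0 = s * t" "finite Y0"
    using obtain_subset_with_card_n by metis
  obtain g where g: "bij_betw g (nbr_leaves s t) Y0"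
    using finite_same_card_bij[OF card_nbr_leaves(1) Y0(3)] Y0(2) card_nbr_leaves(2) by metis
  then have gi: "inj_on g (nbr_leaves s t)" and gY: "g ` nbr_leaves s t = Y0" by (auto simp: bij_betw_def)
  \<comment> \<open>\<open>U\<close> doubles as the images of the \<open>CentreLeaf\<close>s, being
    adjacent to all of \<open>B'\<close>, from which both the \<open>NbrLeaf\<close>s and the
    centres are taken.\<close>
  define \<rho> where "\<rho> = (\<lambda>x. case x of CentreLeaf i \<Rightarrow> U i | _ \<Rightarrow> g x)"
  have \<rho>l: "\<rho> x = g x" if "x \<in> nbr_leaves s t" for x using that by (auto simp: \<rho>_def nbr_leaves_iff)
  have \<rho>c: "\<rho> (CentreLeaf i) = U i" for i by (simp add: \<rho>_def)
  have UC: "U \<in> centre_tuples v" using UT by (simp add: TT_def)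
  have \<rho>lY: "\<rho> ` nbr_leaves s t = Y0" using gY \<rho>l by (simp cong: image_cong)
  \<comment> \<open>\<open>U i\<close> is adjacent to every member of \<open>B'\<close>, and there
    are no loops.\<close>
  have UB: "U i \<notin> B'" if "i \<in> {1..s'}" for i
    using inB'(2)[of "U i" i] that nb_V[of "U i" "U i"] by blast
  have \<rho>inj: "inj_on \<rho> RT"
    unfolding T_roots_def
  proof (rule inj_on_Un[THEN iffD2], intro conjI)
    show "inj_on \<rho> (nbr_leaves s t)" using gi \<rho>l by (simp cong: inj_on_cong)
    have Ui: "inj_on U {1..s'}" using UC by (simp add: centre_tuples_def)
    show "inj_on \<rho> (CentreLeaf ` {1..s'})"
    proof (rule inj_onI)
      fix x y assume "x \<in> CentreLeaf ` {1..s'}" "y \<in> CentreLeaf ` {1..s'}" "\<rho> x = \<rho> y"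
      then obtain i k where "i \<in> {1..s'}" "k \<in> {1..s'}" "x = CentreLeaf i" "y = CentreLeaf k" "U i = U k"
        using \<rho>c by auto
      then show "x = y" using inj_onD[OF Ui, of i k] by simp
    qed
    have "\<rho> ` nbr_leaves s t \<inter> \<rho> ` (CentreLeaf ` {1..s'}) = {}"
      using \<rho>lY Y0(1) UB \<rho>c by auto
    then show "\<rho> ` (nbr_leaves s t - CentreLeaf ` {1..s'}) \<inter> \<rho> ` (CentreLeaf ` {1..s'} - nbr_leaves s t) = {}"
      by blast
  qed
  have \<rho>V: "\<rho> ` RT \<subseteq> V"
  proof -
    have "U i \<in> V" if "i \<in> {1..s'}" for i using UC that nb_subset[of v] by (auto simp: centre_tuples_def)
    moreover have "Y0 \<subseteq> V" using Y0(1) inB'(1) by blast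
    ultimately show ?thesis unfolding T_roots_def image_Un \<rho>lY by (auto simp: \<rho>c)
  qed
  show False
  proof (rule sunflower_contra[of \<rho>])
    fix W :: "'v set" assume W: "finite W" "card W \<le> p * (t + 1)"
    have "card (W \<union> Y0) < card B'"
      using card_Un_le[of W Y0] W(2) Y0(2) cardB' by (simp add: h_def)
    then have "\<not> B' \<subseteq> W \<union> Y0" using card_mono[of "W \<union> Y0" B'] W(1) Y0(3) by auto
    then obtain w where w: "w \<in> B'" "w \<notin> W" "w \<notin> Y0" by blast
    have wU: "w \<noteq> U i" if "i \<in> {1..s'}" for i using UB[OF that] w(1) by blast
    have w\<rho>: "w \<notin> \<rho> ` RT"
    proof -
      have "\<rho> ` CentreLeaf ` {1..s'} = U ` {1..s'}" by (simp add: image_image \<rho>c)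
      moreover have "w \<notin> U ` {1..s'}" using wU by blast
      ultimately show ?thesis unfolding T_roots_def image_Un \<rho>lY using w(3) by blast
    qed
    let ?Q = "\<lambda>j. insert w ((\<lambda>i. \<rho> (NbrLeaf j i)) ` {1..s})"
    show "\<exists>f\<in>emb V E VT ET. (\<forall>r\<in>RT. f r = \<rho> r) \<and> f ` insert Centre (Nbr ` {1..t}) \<inter> W = {}"
    proof (rule exists_emb_avoiding[OF \<rho>inj \<rho>V inB'(1)[OF w(1)] w\<rho> w(2) W(1), of "\<lambda>j. common_nb E (?Q j) \<inter> nb E v"])
      show "\<rho> (CentreLeaf i) \<in> nb E w" if "i \<in> {1..s'}" for i using inB'(2)[OF w(1) that] by (simp add: \<rho>c)
      fix j assume j: "j \<in> {1..t}"
      have leaf: "NbrLeaf j i \<in> nbr_leaves s t" if "i \<in> {1..s}" for i using that j by (auto simp: nbr_leaves_iff)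
      have sub: "(\<lambda>i. \<rho> (NbrLeaf j i)) ` {1..s} \<subseteq> Y0" using leaf \<rho>lY by blast
      have "inj_on (\<lambda>i. \<rho> (NbrLeaf j i)) {1..s}"
      proof (rule inj_onI)
        fix i k assume ik: "i \<in> {1..s}" "k \<in> {1..s}" "\<rho> (NbrLeaf j i) = \<rho> (NbrLeaf j k)"
        then have "g (NbrLeaf j i) = g (NbrLeaf j k)" using \<rho>l[OF leaf] by simp
        from inj_onD[OF gi this leaf[OF ik(1)] leaf[OF ik(2)]] show "i = k" by simp
      qed
      then have "card ((\<lambda>i. \<rho> (NbrLeaf j i)) ` {1..s}) = s" by (simp add: card_image)
      moreover have "w \<notin> (\<lambda>i. \<rho> (NbrLeaf j i)) ` {1..s}" using sub w(3) by blast
      ultimately have "card (?Q j) = s + 1" by (subst card_insert_disjoint) auto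
      moreover have "?Q j \<subseteq> B'" using sub Y0(1) w(1) by blast
      ultimately have "a \<le> card (common_nb E (?Q j) \<inter> nb E v)" using good by blast
      then show "card W + (s * t + s') + t \<le> card (common_nb E (?Q j) \<inter> nb E v)"
        using W(2) by (simp add: a_def)
    qed blast
  qed
qed

end

section \<open>Regularisation and the bound on the extremal number\<close>

lemma card_nb_eq_degree:
  assumes "\<And>e. e \<in> E \<Longrightarrow> card e = 2"
  shows "card (nb E x) = card {e \<in> E. x \<in> e}"
proof -
  have "bij_betw (\<lambda>y. {x, y}) (nb E x) {e \<in> E. x \<in> e}"
  proof (rule bij_betw_imageI)
    show "inj_on (\<lambda>y. {x, y}) (nb E x)" by (auto simp: inj_on_def doubleton_eq_iff)
    show "(\<lambda>y. {x, y}) ` nb E x = {e \<in> E. x \<in> e}"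
    proof
      show "{e \<in> E. x \<in> e} \<subseteq> (\<lambda>y. {x, y}) ` nb E x"
      proof
        fix e assume e: "e \<in> {e \<in> E. x \<in> e}"
        then obtain u w where "e = {u, w}" using assms[of e] by (auto simp: card_2_iff)
        then have "\<exists>y. e = {x, y}" using e by auto
        then show "e \<in> (\<lambda>y. {x, y}) ` nb E x" using e by (auto simp: nb_def)
      qed
    qed (auto simp: nb_def)
  qed
  then show ?thesis by (rule bij_betw_same_card)
qed

lemma exists_top_subset:
  fixes f :: "'a \<Rightarrow> nat"
  assumes "finite A" "k \<le> card A"
  shows "\<exists>B\<subseteq>A. card B = k \<and> (\<forall>x\<in>B. \<forall>y\<in>A - B. f y \<le> f x)"
  using assms(2)
proof (induction k)
  case (Suc k)
  then obtain B where B: "B \<subseteq> A" "card B = k" "\<forall>x\<in>B. \<forall>y\<in>A - B. f y \<le> f x" by auto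
  have fin: "finite B" "finite (A - B)" using B(1) assms(1) finite_subset by auto
  have "A - B \<noteq> {}" using B(2) Suc.prems assms(1) fin by (metis Diff_eq_empty_iff card_mono not_less_eq_eq)
  then have "Max (f ` (A - B)) \<in> f ` (A - B)" using fin by (intro Max_in) auto
  then obtain z where z: "z \<in> A - B" "f z = Max (f ` (A - B))" by auto
  have "f y \<le> f z" if "y \<in> A - B" for y using that z(2) fin by simp
  then show ?case using B z fin by (intro exI[of _ "insert z B"]) auto
qed (auto intro: exI[of _ "{}"])

text \<open>The average over the elements of largest value is at least the average over all, stated
  without division.\<close>

lemma top_subset_average:
  fixes f :: "'a \<Rightarrow> nat"
  assumes "finite A" "B \<subseteq> A" "\<forall>x\<in>B. \<forall>y\<in>A - B. f y \<le> f x"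
  shows "card B * (\<Sum>x\<in>A. f x) \<le> card A * (\<Sum>x\<in>B. f x)"
proof -
  have fin: "finite B" by (rule finite_subset[OF assms(2,1)])
  have "(\<Sum>x\<in>B. \<Sum>y\<in>A - B. f y) \<le> (\<Sum>x\<in>B. \<Sum>y\<in>A - B. f x)"
    using assms(3) by (intro sum_mono) auto
  then have "card B * (\<Sum>y\<in>A - B. f y) \<le> card (A - B) * (\<Sum>x\<in>B. f x)"
    by (simp add: sum_distrib_left)
  moreover have "(\<Sum>x\<in>A. f x) = (\<Sum>x\<in>A - B. f x) + (\<Sum>x\<in>B. f x)"
    by (rule sum.subset_diff[OF assms(2,1)])
  moreover have "card A = card (A - B) + card B"
    using assms fin by (simp add: card_Diff_subset card_mono)
  ultimately show ?thesis by (simp add: algebra_simps)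
qed

lemma sum_degrees_le:
  assumes "finite B" "finite E" "\<And>e. e \<in> E \<Longrightarrow> card e = 2"
  shows "(\<Sum>x\<in>B. card {e \<in> E. x \<in> e}) \<le> 2 * card E"
proof -
  have "(\<Sum>x\<in>B. real (card {e \<in> E. x \<in> e})) = (\<Sum>e\<in>E. real (card {x \<in> B. x \<in> e}))"
    using assms by (intro sum_card_swap) auto
  also have "\<dots> \<le> (\<Sum>e\<in>E. 2)"
  proof (rule sum_mono)
    fix e assume e: "e \<in> E"
    have "finite e" using assms(3)[OF e] card.infinite by fastforce
    then have "card {x \<in> B. x \<in> e} \<le> card e" by (intro card_mono) auto
    then show "real (card {x \<in> B. x \<in> e}) \<le> 2" using assms(3)[OF e] by simp
  qed
  finally have "real (\<Sum>x\<in>B. card {e \<in> E. x \<in> e}) \<le> real (2 * card E)" by simp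
  then show ?thesis by (simp only: of_nat_le_iff)
qed

lemma finite_argmax:
  fixes f :: "'a \<Rightarrow> real"
  assumes "finite A" "A \<noteq> {}"
  obtains a where "a \<in> A" "\<And>b. b \<in> A \<Longrightarrow> f b \<le> f a"
proof -
  have "Max (f ` A) \<in> f ` A" using assms by (intro Max_in) auto
  then obtain a where "a \<in> A" "f a = Max (f ` A)" by auto
  then show thesis using that[of a] assms by simp
qed

text \<open>Regularisation (Erdos and Simonovits): among the vertex subsets \<open>A\<close> maximise the ratio of the
  number of edges inside \<open>A\<close> to \<open>card A powr (1 + \<alpha>)\<close>. By maximality a small proportion of vertices of
  highest degree meets at most half of the edges, so deleting these vertices bounds the maximum degree.\<close>

lemma exists_almost_regular:
  fixes \<alpha> C :: real and V :: "'v set"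
  defines "\<beta> \<equiv> (1 / 8) powr (1 / \<alpha>) / 2"
  assumes \<alpha>: "0 < \<alpha>" "\<alpha> \<le> 1" and C: "C \<ge> 1"
    and fin: "finite V" and V: "V \<noteq> {}" and E: "\<And>e. e \<in> E \<Longrightarrow> e \<subseteq> V \<and> card e = 2"
    and many: "(4 * C + 1 / \<beta>) * real (card V) powr (1 + \<alpha>) \<le> card E"
  shows "\<exists>V' E' d. V' \<subseteq> V \<and> E' \<subseteq> E \<and> almost_regular V' E' (16 / \<beta>) d \<and> C * real (card V') powr \<alpha> \<le> d"
proof -
  define In where "In = (\<lambda>A. {e \<in> E. e \<subseteq> A})"
  define ee where "ee = (\<lambda>A. real (card (In A)))"
  have finE: "finite E" by (rule finite_subset[of _ "Pow V"]) (use E fin in auto)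
  have finIn: "finite (In A)" for A using finE by (simp add: In_def)
  have \<beta>: "0 < \<beta>" "\<beta> \<le> 1 / 2"
    using \<alpha> powr_le_one_le by (auto simp: \<beta>_def powr_le1)
  then have \<beta>i: "1 / \<beta> > 0" by simp
  define rat where "rat = (\<lambda>A :: 'v set. ee A / real (card A) powr (1 + \<alpha>))"
  obtain A where A: "A \<in> Pow V - {{}}" "\<And>B. B \<in> Pow V - {{}} \<Longrightarrow> rat B \<le> rat A"
    by (rule finite_argmax[of "Pow V - {{}}" rat]) (use fin V in auto)
  have AV: "A \<subseteq> V" "A \<noteq> {}" and finA: "finite A" using A(1) fin finite_subset by auto
  define m where "m = real (card A)"
  have m: "m \<ge> 1" using finA AV by (simp add: m_def Suc_le_eq card_gt_0_iff)
  define c where "c = rat A"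
  have eA: "ee A = c * m powr (1 + \<alpha>)" using m by (simp add: c_def rat_def m_def)
  have cC: "4 * C + 1 / \<beta> \<le> c"
  proof -
    have cardV: "real (card V) > 0" using V fin by (simp add: card_gt_0_iff)
    have "In V = E" using E by (auto simp: In_def)
    then have "4 * C + 1 / \<beta> \<le> rat V" using many cardV by (simp add: rat_def ee_def field_simps)
    also have "\<dots> \<le> c" unfolding c_def using V by (intro A(2)) auto
    finally show ?thesis .
  qed
  have c0: "c > 0" using cC C \<beta>i by linarith
  have eB: "ee B \<le> c * real (card B) powr (1 + \<alpha>)" if "B \<subseteq> V" for B
  proof (cases "B = {}")
    case True
    have "In {} = {}" using E by (fastforce simp: In_def)
    then show ?thesis using True by (simp add: ee_def)
  next
    case False
    then have "rat B \<le> c" using that A(2) by (auto simp: c_def)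
    moreover have "real (card B) > 0" using False that fin finite_subset by (auto simp: card_gt_0_iff)
    ultimately show ?thesis by (simp add: rat_def field_simps)
  qed
  \<comment> \<open>The trivial bound \<open>m ^ 2\<close> on the number of edges caps
    \<open>c\<close> by \<open>m\<close>. As \<open>c >= 1 / \<beta>\<close>, this gives
    \<open>\<beta> * m >= 1\<close>, so that at least one vertex is deleted.\<close>
  have cm: "c \<le> m"
  proof -
    have "In A \<subseteq> {e. e \<subseteq> A \<and> card e = 2}" using E by (auto simp: In_def)
    then have "card (In A) \<le> card {e. e \<subseteq> A \<and> card e = 2}" using finA by (intro card_mono) auto
    also have "\<dots> = card A choose 2" by (rule n_subsets[OF finA])
    also have "\<dots> \<le> card A ^ 2"
    proof (cases "2 \<le> card A")
      case True
      then show ?thesis by (rule binomial_le_pow)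
    qed (simp add: binomial_eq_0)
    finally have "ee A \<le> m ^ 2" unfolding ee_def m_def by (simp only: of_nat_le_iff flip: of_nat_power)
    then have "c * m powr (1 + \<alpha>) \<le> m powr 2" using m by (simp add: eA)
    also have "m powr 2 \<le> m * m powr (1 + \<alpha>)"
    proof -
      have "m powr 2 \<le> m powr (2 + \<alpha>)" using m \<alpha> by (intro powr_mono) auto
      also have "\<dots> = m powr (1 + (1 + \<alpha>))" by (simp add: add.assoc[symmetric])
      also have "\<dots> = m powr 1 * m powr (1 + \<alpha>)" by (rule powr_add)
      finally show ?thesis using m by simp
    qed
    finally show ?thesis using m by simp
  qed
  define k where "k = nat \<lfloor>\<beta> * m\<rfloor>"
  have bm: "\<beta> * m \<ge> 1"
  proof -
    have "1 / \<beta> \<le> m" using cC cm C by linarith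
    then show ?thesis using \<beta> by (simp add: field_simps)
  qed
  have k: "k \<ge> 1" "real k \<le> \<beta> * m" "\<beta> * m \<le> 2 * real k"
  proof -
    have fl: "\<lfloor>\<beta> * m\<rfloor> \<ge> 1" using bm by simp
    then show "k \<ge> 1" using nat_mono[OF fl] by (simp only: k_def nat_one_as_int)
    have rk: "real k = of_int \<lfloor>\<beta> * m\<rfloor>" using fl by (simp add: k_def)
    show "real k \<le> \<beta> * m" unfolding rk by simp
    have "\<beta> * m < of_int \<lfloor>\<beta> * m\<rfloor> + 1" by linarith
    then show "\<beta> * m \<le> 2 * real k" using fl unfolding rk by linarith
  qed
  have km: "2 * real k \<le> m"
  proof -
    have "\<beta> * m \<le> 1 / 2 * m" using \<beta>(2) m by (intro mult_right_mono) auto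
    then show ?thesis using k(2) by linarith
  qed
  then have kA: "2 * k \<le> card A" unfolding m_def by linarith
  define deg where "deg = (\<lambda>x. card {e \<in> In A. x \<in> e})"
  obtain B where B: "B \<subseteq> A" "card B = k" "\<forall>x\<in>B. \<forall>y\<in>A - B. deg y \<le> deg x"
    using exists_top_subset[OF finA, of k deg] kA by auto
  have finB: "finite B" using B(1) finA finite_subset by auto
  define EB where "EB = {e \<in> In A. e \<inter> B \<noteq> {}}"
  have finEB: "finite EB" using finIn by (simp add: EB_def)
  \<comment> \<open>Otherwise add to \<open>B\<close> the \<open>k\<close> vertices outside it that
    meet most edges of \<open>EB\<close>. The \<open>2 * k\<close> vertices then span at least a
    proportion \<open>k / m\<close> of \<open>EB\<close>, more than the maximality of
    \<open>rat A\<close> permits.\<close>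
  have EB_half: "real (card EB) \<le> ee A / 2"
  proof (rule ccontr)
    assume "\<not> ?thesis"
    then have big: "ee A / 2 < real (card EB)" by simp
    define w where "w = (\<lambda>z. card {e \<in> EB. z \<in> e})"
    have cardAB: "card (A - B) = card A - k" using B finB by (simp add: card_Diff_subset)
    have "k \<le> card (A - B)" using kA cardAB by linarith
    then obtain D where D: "D \<subseteq> A - B" "card D = k" "\<forall>x\<in>D. \<forall>y\<in>(A - B) - D. w y \<le> w x"
      using exists_top_subset[of "A - B" k w] finA by auto
    have finD: "finite D" using D(1) finA finite_subset by auto
    have avg: "k * (\<Sum>z\<in>A - B. w z) \<le> card (A - B) * (\<Sum>z\<in>D. w z)"
      using top_subset_average[of "A - B" D w] finA D by simp
    have EB_sub: "EB \<subseteq> In B \<union> (\<Union>z\<in>A - B. {e \<in> EB. z \<in> e})"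
      by (auto simp: EB_def In_def)
    have "card EB \<le> card (In B \<union> (\<Union>z\<in>A - B. {e \<in> EB. z \<in> e}))"
      using finIn finA finEB EB_sub by (intro card_mono) auto
    also have "\<dots> \<le> card (In B) + (\<Sum>z\<in>A - B. w z)"
      unfolding w_def using finA by (intro order.trans[OF card_Un_le] add_mono order.refl card_UN_le) auto
    finally have up: "card EB \<le> card (In B) + (\<Sum>z\<in>A - B. w z)" .
    \<comment> \<open>An edge meeting \<open>B\<close> has at most one end outside, so the edge sets
      counted by \<open>w\<close> at different vertices are disjoint.\<close>
    have one_out: "z = z'" if ez: "e \<in> EB" "z \<in> e" "z' \<in> e" "z \<notin> B" "z' \<notin> B" for e z z'
    proof (rule ccontr)
      assume zz: "z \<noteq> z'"
      obtain y where y: "y \<in> e" "y \<in> B" using ez(1) by (auto simp: EB_def)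
      have e2: "card e = 2" using ez(1) E by (auto simp: EB_def In_def)
      have "y \<noteq> z" "y \<noteq> z'" using y ez by auto
      then have "card {y, z, z'} = 3" using zz by simp
      moreover have "finite e" using e2 card.infinite by fastforce
      then have "card {y, z, z'} \<le> card e" using y ez by (intro card_mono) auto
      ultimately show False using e2 by simp
    qed
    have low: "card (In B) + (\<Sum>z\<in>D. w z) \<le> card (In (B \<union> D))"
    proof -
      have "(\<Sum>z\<in>D. w z) = card (\<Union>z\<in>D. {e \<in> EB. z \<in> e})"
      proof -
        have "card (\<Union>z\<in>D. {e \<in> EB. z \<in> e}) = (\<Sum>z\<in>D. card {e \<in> EB. z \<in> e})"
        proof (rule card_UN_disjoint[OF finD])
          show "\<forall>i\<in>D. finite {e \<in> EB. i \<in> e}" using finEB by simp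
          show "\<forall>i\<in>D. \<forall>j\<in>D. i \<noteq> j \<longrightarrow> {e \<in> EB. i \<in> e} \<inter> {e \<in> EB. j \<in> e} = {}"
            using one_out D(1) by blast
        qed
        then show ?thesis by (simp add: w_def)
      qed
      moreover have "card (In B \<union> (\<Union>z\<in>D. {e \<in> EB. z \<in> e})) = card (In B) + card (\<Union>z\<in>D. {e \<in> EB. z \<in> e})"
      proof (rule card_Un_disjoint)
        show "In B \<inter> (\<Union>z\<in>D. {e \<in> EB. z \<in> e}) = {}" using D(1) by (auto simp: In_def)
      qed (use finIn finD finEB in auto)
      moreover have "In B \<union> (\<Union>z\<in>D. {e \<in> EB. z \<in> e}) \<subseteq> In (B \<union> D)"
      proof -
        have "e \<subseteq> B \<union> D" if e: "e \<in> EB" "z \<in> e" "z \<in> D" for e z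
        proof
          fix y assume "y \<in> e"
          then show "y \<in> B \<union> D" using one_out[OF e(1,2), of y] e(3) D(1) by (cases "y \<in> B") auto
        qed
        then show ?thesis by (auto simp: In_def EB_def)
      qed
      then have "card (In B \<union> (\<Union>z\<in>D. {e \<in> EB. z \<in> e})) \<le> card (In (B \<union> D))"
        by (intro card_mono finIn)
      ultimately show ?thesis by simp
    qed
    have "k * card EB \<le> k * card (In B) + k * (\<Sum>z\<in>A - B. w z)"
      using mult_le_mono2[OF up, of k] by (simp add: distrib_left)
    also have "\<dots> \<le> card A * card (In B) + card A * (\<Sum>z\<in>D. w z)"
    proof (rule add_mono)
      show "k * card (In B) \<le> card A * card (In B)" using kA by (intro mult_le_mono1) simp
      have "card (A - B) * (\<Sum>z\<in>D. w z) \<le> card A * (\<Sum>z\<in>D. w z)" using cardAB by (intro mult_le_mono1) simp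
      then show "k * (\<Sum>z\<in>A - B. w z) \<le> card A * (\<Sum>z\<in>D. w z)" using avg by linarith
    qed
    also have "\<dots> = card A * (card (In B) + (\<Sum>z\<in>D. w z))" by (simp add: distrib_left)
    also have "\<dots> \<le> card A * card (In (B \<union> D))" by (rule mult_le_mono2[OF low])
    finally have "real k * real (card EB) \<le> m * ee (B \<union> D)"
      unfolding m_def ee_def by (simp only: of_nat_le_iff flip: of_nat_mult)
    also have "\<dots> \<le> m * (c * (2 * real k) powr (1 + \<alpha>))"
    proof -
      have "card (B \<union> D) = 2 * k" using B D finB finD by (subst card_Un_disjoint) auto
      moreover have "B \<union> D \<subseteq> V" using B(1) D(1) AV by auto
      ultimately have "ee (B \<union> D) \<le> c * (2 * real k) powr (1 + \<alpha>)" using eB[of "B \<union> D"] by simp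
      then show ?thesis using m by (intro mult_left_mono) auto
    qed
    also have "\<dots> = real k * (c * m * (2 * (2 * real k) powr \<alpha>))"
      using k(1) by (simp add: powr_add)
    finally have "real (card EB) \<le> c * m * (2 * (2 * real k) powr \<alpha>)" using k(1) by simp
    \<comment> \<open>The origin of \<open>\<beta>\<close>:
      \<open>2 * k <= 2 * \<beta> * m = (1 / 8) powr (1 / \<alpha>) * m\<close>.\<close>
    moreover have "(2 * real k) powr \<alpha> \<le> m powr \<alpha> / 8"
    proof -
      have "(2 * real k) powr \<alpha> \<le> ((1 / 8) powr (1 / \<alpha>) * m) powr \<alpha>"
        using k \<alpha> by (intro powr_mono2) (auto simp: \<beta>_def)
      also have "\<dots> = (1 / 8) powr (1 / \<alpha> * \<alpha>) * m powr \<alpha>"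
        using m by (subst powr_mult) (auto simp: powr_powr)
      finally show ?thesis using \<alpha> by simp
    qed
    then have "c * m * (2 * (2 * real k) powr \<alpha>) \<le> c * m * (2 * (m powr \<alpha> / 8))"
      using c0 m by (intro mult_left_mono) auto
    moreover have "c * m * (2 * (m powr \<alpha> / 8)) = ee A / 4" using m by (simp add: eA powr_add)
    moreover have "0 < ee A" using c0 m by (simp add: eA)
    ultimately show False using big by linarith
  qed
  define H where "H = A - B"
  have HV: "H \<subseteq> V" "H \<subseteq> A" using AV by (auto simp: H_def)
  have finH: "finite H" using finA by (simp add: H_def)
  have eH: "ee A / 2 \<le> ee H"
  proof -
    have "In A \<subseteq> EB \<union> In H" by (auto simp: EB_def In_def H_def)
    then have "card (In A) \<le> card (EB \<union> In H)" using finEB finIn by (intro card_mono) auto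
    also have "\<dots> \<le> card EB + card (In H)" by (rule card_Un_le)
    finally have "ee A \<le> real (card EB) + ee H" by (simp add: ee_def)
    then show ?thesis using EB_half by linarith
  qed
  \<comment> \<open>Then \<open>ee A = 4 * \<delta> * m\<close>; \<open>H\<close> keeps half of
    these edges, still more than \<open>\<delta>\<close> per vertex. Since
    \<open>c >= 4 * C\<close>, \<open>\<delta>\<close> is also at least
    \<open>C * m powr \<alpha>\<close>.\<close>
  define \<delta> where "\<delta> = c * m powr \<alpha> / 4"
  have \<delta>0: "\<delta> > 0" using c0 m by (simp add: \<delta>_def)
  have eA\<delta>: "ee A = 4 * \<delta> * m" using m by (simp add: eA \<delta>_def powr_add)
  have maxdeg: "real (deg x) \<le> 16 / \<beta> * \<delta>" if "x \<in> H" for x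
  proof -
    have "k * deg x = (\<Sum>y\<in>B. deg x)" using B(2) by simp
    also have "\<dots> \<le> (\<Sum>y\<in>B. deg y)" using B(3) that by (intro sum_mono) (auto simp: H_def)
    also have "\<dots> \<le> 2 * card (In A)"
      unfolding deg_def using E by (intro sum_degrees_le finB finIn) (auto simp: In_def)
    finally have "real k * real (deg x) \<le> 2 * ee A"
      unfolding ee_def by (metis of_nat_le_iff of_nat_mult of_nat_numeral)
    then have "2 * real k * real (deg x) \<le> 16 * \<delta> * m" unfolding eA\<delta> by simp
    moreover have "\<beta> * m * real (deg x) \<le> 2 * real k * real (deg x)" using k(3) by (intro mult_right_mono) auto
    ultimately have "m * (\<beta> * real (deg x)) \<le> m * (16 * \<delta>)" by (simp add: mult_ac)
    then have "\<beta> * real (deg x) \<le> 16 * \<delta>" using m by simp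
    then show ?thesis using \<beta> by (simp add: field_simps)
  qed
  \<comment> \<open>Maximising \<open>g\<close> replaces the repeated deletion of low-degree
    vertices: removing one vertex from a maximiser cannot gain, so it must lose at least
    \<open>\<delta>\<close> edges.\<close>
  define g where "g = (\<lambda>S. ee S - \<delta> * real (card S))"
  obtain S where S: "S \<in> Pow H" "\<And>B. B \<in> Pow H \<Longrightarrow> g B \<le> g S"
    by (rule finite_argmax[of "Pow H" g]) (use finH in auto)
  have SH: "S \<subseteq> H" and finS: "finite S" using S(1) finH finite_subset by auto
  have "g H > 0"
  proof -
    have "real (card H) \<le> m" using HV(2) finA by (simp add: m_def card_mono)
    then have "\<delta> * real (card H) \<le> \<delta> * m" using \<delta>0 by simp
    moreover have "0 < \<delta> * m" using \<delta>0 m by simp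
    ultimately show ?thesis using eH unfolding g_def eA\<delta> by linarith
  qed
  then have "g S > 0" using S(2)[of H] by simp
  moreover have "g {} = 0"
  proof -
    have "In {} = {}" using E by (fastforce simp: In_def)
    then show ?thesis by (simp add: g_def ee_def)
  qed
  ultimately have Sne: "S \<noteq> {}" by auto
  have nbdeg: "card (nb (In S) x) = card {e \<in> In S. x \<in> e}" for x
    using E by (intro card_nb_eq_degree) (auto simp: In_def)
  have ar: "almost_regular S (In S) (16 / \<beta>) \<delta>"
  proof
    show "finite S" "S \<noteq> {}" using finS Sne by auto
    show "e \<subseteq> S \<and> card e = 2" if "e \<in> In S" for e using that E by (auto simp: In_def)
    show "1 \<le> 16 / \<beta>" using \<beta> by (simp add: field_simps)
    show "1 \<le> \<delta>"
    proof -
      have "4 \<le> c" using cC C \<beta>i by linarith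
      moreover have "1 \<le> m powr \<alpha>" using m \<alpha> by (simp add: ge_one_powr_ge_zero)
      ultimately have "4 * 1 \<le> c * m powr \<alpha>" by (intro mult_mono) auto
      then show ?thesis by (simp add: \<delta>_def)
    qed
    fix x assume x: "x \<in> S"
    show "real (card (nb (In S) x)) \<le> 16 / \<beta> * \<delta>"
    proof -
      have "card {e \<in> In S. x \<in> e} \<le> deg x"
      proof -
        have "finite {e \<in> In A. x \<in> e}" using finIn by simp
        moreover have "{e \<in> In S. x \<in> e} \<subseteq> {e \<in> In A. x \<in> e}" using SH HV(2) by (auto simp: In_def)
        ultimately show ?thesis unfolding deg_def by (rule card_mono)
      qed
      then show ?thesis using maxdeg[of x] x SH unfolding nbdeg by force
    qed
    show "\<delta> \<le> real (card (nb (In S) x))"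
    proof -
      have "In S = In (S - {x}) \<union> {e \<in> In S. x \<in> e}" by (auto simp: In_def)
      then have "card (In S) = card (In (S - {x}) \<union> {e \<in> In S. x \<in> e})" by (rule arg_cong)
      also have "\<dots> \<le> card (In (S - {x})) + card {e \<in> In S. x \<in> e}" by (rule card_Un_le)
      finally have "card (In S) \<le> card (In (S - {x})) + card {e \<in> In S. x \<in> e}" .
      then have "ee S \<le> ee (S - {x}) + real (card {e \<in> In S. x \<in> e})" by (simp add: ee_def)
      moreover have "g (S - {x}) \<le> g S" using SH by (intro S(2)) auto
      moreover have "real (card (S - {x})) = real (card S) - 1"
        using card.remove[OF finS x] by simp
      ultimately show ?thesis unfolding nbdeg g_def by (simp add: algebra_simps)
    qed
  qed
  have "C * real (card S) powr \<alpha> \<le> \<delta>"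
  proof -
    have "real (card S) \<le> m" using SH HV(2) finA unfolding m_def by (simp add: card_mono)
    then have "real (card S) powr \<alpha> \<le> m powr \<alpha>" using \<alpha> by (intro powr_mono2) auto
    then have "C * real (card S) powr \<alpha> \<le> C * m powr \<alpha>" using C by (intro mult_left_mono) auto
    also have "\<dots> \<le> (c / 4) * m powr \<alpha>"
    proof (rule mult_right_mono)
      show "C \<le> c / 4" using cC \<beta>i by linarith
    qed simp
    finally show ?thesis by (simp add: \<delta>_def)
  qed
  moreover have "S \<subseteq> V" "In S \<subseteq> E" using SH HV by (auto simp: In_def)
  ultimately show ?thesis using ar by blast
qed

section \<open>Choice of constants and the bound on the extremal number\<close>

lemma scaled_bound:
  fixes x y C \<kappa> n :: real
  assumes "x < \<kappa> * C" "C * n \<le> y" "n > 0" "\<kappa> > 0"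
  shows "x * n < \<kappa> * y"
proof -
  have "x * n < \<kappa> * C * n" using assms by (intro mult_strict_right_mono)
  also have "\<dots> \<le> \<kappa> * y" using assms mult_left_mono[of "C * n" y \<kappa>] by (simp add: mult.assoc)
  finally show ?thesis .
qed

text \<open>A single \<open>C\<close>, fixed before the host, dominates all thresholds. The density
  conditions say that ample stars are rare, that shared \<open>q_j\<close> are rare, and that root
  placements have many extensions on average.\<close>

lemma dense_no_host:
  fixes s t s' p :: nat and K :: real
  assumes K: "K \<ge> 1" and s: "s \<ge> 1" and t: "t \<ge> 1"
    and cases: "s \<le> s' + 1 \<or> t \<ge> 4 \<and> t + s' \<ge> 2 * s + 3"
  shows "\<exists>C\<ge>1. \<forall>(V :: 'v set) E d. power_free_host V E K d s t s' p \<longrightarrow> C \<le> d \<longrightarrow>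
     C * real (card V) ^ (max 1 s' - 1) \<le> d ^ max 1 s' \<longrightarrow>
     C * real (card V) ^ (s - 1) \<le> d ^ s \<longrightarrow>
     C * real (card V) ^ (s * t + s' - 1) \<le> d ^ (s * t + t + s') \<longrightarrow>
     (s \<le> s' + 1 \<or> real (card V) \<le> d\<^sup>2) \<longrightarrow> False"
proof -
  define b where "b = s * t + t + s'"
  define \<sigma> where "\<sigma> = max 1 s'"
  define M where "M = p * (t + 1) + (1 + \<sigma> + s * t) + t"
  \<comment> \<open>All ample stars and all sunflowers through some \<open>Nbr j\<close> together
    then cost at most one eighth of \<open>N * d ^ b\<close>.\<close>
  define \<epsilon> where "\<epsilon> = 1 / (8 * (real t + 2 ^ (t + s')) * K ^ b)"
  define \<kappa> where "\<kappa> = (\<epsilon> / (2 * K)) ^ t * K"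
  define M1 where "M1 = p * (t + 1) + 2"
  define cA where "cA = p * (t + 1) * (M ^ t + t * (M ^ (t + 1) + M1 * t * (M ^ t + t * M ^ (t + 1))))"
  define a where "a = p * (t + 1) + (s * t + s') + t"
  define h where "h = p * (t + 1) + s * t + 1"
  define \<Gamma> where "\<Gamma> = 2 + real h * K ^ (t + s')"
  define wt where "wt = p * (t + 1) + (s * t + s')"
  define c where "c = real (t * wt * t + 2 * t ^ 2 + (s * t + s') ^ 2) + 1"
  define C1 where "C1 = c * (4 * c) ^ t"
  define G where "G = 2 * M ^ t * (4 * wt + 2 * M ^ t * (2 * C1 * (2 ^ t + 1) * K ^ b)
       + 2 * M ^ t * (2 * C1 * 2 ^ t * K ^ (s * t)) * \<Gamma>)"
  have Kb: "K ^ b > 0" using K by simp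
  have pos: "8 * (real t + 2 ^ (t + s')) * K ^ b > 0" using Kb by (intro mult_pos_pos) (auto intro: add_nonneg_pos)
  have \<epsilon>: "\<epsilon> > 0" unfolding \<epsilon>_def using pos by simp
  have \<kappa>: "\<kappa> > 0" unfolding \<kappa>_def using \<epsilon> K by simp
  have \<epsilon>1: "8 * (t + 2 ^ (t + s')) * (\<epsilon> * K ^ b) = 1"
    using pos by (simp add: \<epsilon>_def field_simps)
  have c1: "c \<ge> 1" by (simp add: c_def)
  have G0: "G \<ge> 0" unfolding G_def C1_def \<Gamma>_def using c1 K by (intro mult_nonneg_nonneg add_nonneg_nonneg) auto
  define x1 where "x1 = real (2 * (1 + \<sigma> + s * t)^2) * K ^ (\<sigma> + s * t)"
  define x2 where "x2 = real (2 * (p * (t + 1))) * K ^ (s * t)"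
  define x3 where "x3 = real (8 * (b + 1)^2) * K ^ b"
  define x4 where "x4 = real (p * (t + 1)) * K ^ b"
  define x5 where "x5 = 4 * real cA"
  define x6 where "x6 = K ^ (2 * (s + 1)) * real (a ^ (t + s'))"
  \<comment> \<open>The sum of all thresholds; the summand 1 provides both \<open>C >= 1\<close> and
    the strict inequalities.\<close>
  define C where "C = 1 + x1 / \<kappa> + x2 / \<kappa> + x3 + x4 / \<epsilon> + x5 + x6 + G"
  have nn: "0 \<le> x1 / \<kappa>" "0 \<le> x2 / \<kappa>" "0 \<le> x3" "0 \<le> x4 / \<epsilon>" "0 \<le> x5" "0 \<le> x6"
    using K \<kappa> \<epsilon> by (simp_all add: x1_def x2_def x3_def x4_def x5_def x6_def)
  have C1': "C \<ge> 1" and Cx3: "x3 \<le> C" and Cx5: "x5 < C" and Cx6: "x6 \<le> C" and CG: "G \<le> C"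
    using nn G0 by (simp_all add: C_def)
  have "x1 / \<kappa> < C" "x2 / \<kappa> < C" "x4 / \<epsilon> < C" using nn G0 by (simp_all add: C_def)
  then have Cx1: "x1 < \<kappa> * C" and Cx2: "x2 < \<kappa> * C" and Cx4: "x4 < \<epsilon> * C"
    using \<kappa> \<epsilon> by (simp_all add: field_simps)
  show ?thesis
  proof (intro exI[of _ C] conjI allI impI)
    show "1 \<le> C" by (rule C1')
    fix V :: "'v set" and E d
    assume host: "power_free_host V E K d s t s' p" and Cd: "C \<le> d"
      and dense1: "C * real (card V) ^ (max 1 s' - 1) \<le> d ^ max 1 s'"
      and dense2: "C * real (card V) ^ (s - 1) \<le> d ^ s"
      and dense3: "C * real (card V) ^ (s * t + s' - 1) \<le> d ^ (s * t + t + s')"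
      and Nd: "s \<le> s' + 1 \<or> real (card V) \<le> d\<^sup>2"
    interpret power_free_host V E K d s t s' p by (rule host)
    have Npos: "N ^ n > 0" for n using N_ge_1 by simp
    have few: "(\<Sum>(u, v)\<in>{(u, v). v \<in> nb E u}. real (card (ample_leaves M u v))) \<le> \<epsilon> * N * d ^ (s + 1)"
    proof (rule few_ample_leaves[OF \<epsilon>], fold \<sigma>_def, fold \<kappa>_def)
      show "p * (t + 1) + (1 + \<sigma> + s * t) + t \<le> M" by (simp add: M_def)
      have "x1 \<le> \<kappa> * d" using Cx1 Cd \<kappa> mult_left_mono[of C d \<kappa>] by linarith
      then show "real (2 * (1 + \<sigma> + s * t)\<^sup>2) * K ^ (\<sigma> + s * t) \<le> \<kappa> * d" by (simp only: x1_def)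
      show "real (2 * (p * (t + 1))) * K ^ (s * t) * N ^ (\<sigma> - 1) < \<kappa> * d ^ \<sigma>"
        unfolding x2_def[symmetric] by (rule scaled_bound[OF Cx2 _ Npos \<kappa>]) (use dense1 \<sigma>_def in simp)
    qed
    have d0: "real (8 * (b + 1)^2) * K ^ b \<le> d" using Cx3 Cd by (simp only: x3_def)
    show False
    proof (cases "s \<le> s' + 1")
      case True
      show False
      proof (rule no_host_if_many_centre_leaves[OF s True few \<epsilon>, where ?M1.0 = M1])
        show "8 * (t + 2 ^ (t + s')) * (\<epsilon> * K ^ (s * t + t + s')) \<le> 1"
          using \<epsilon>1 by (simp add: b_def)
        show "p * (t + 1) + 1 < M1" by (simp add: M1_def)
        show "real (8 * (s * t + t + s' + 1)\<^sup>2) * K ^ (s * t + t + s') \<le> d" using d0 by (simp only: b_def)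
        show "real (p * (t + 1)) * K ^ (s * t + t + s') * N ^ (s - 1) < \<epsilon> * d ^ s"
          using scaled_bound[OF Cx4 dense2 Npos \<epsilon>] by (simp only: x4_def b_def)
        have "x5 * N ^ (s * t + s' - 1) < 1 * d ^ (s * t + t + s')"
          using scaled_bound[OF _ dense3 Npos, of x5 1] Cx5 by simp
        then show "4 * real (p * (t + 1) * (M ^ t + t * (M ^ (t + 1) + M1 * t * (M ^ t + t * M ^ (t + 1)))))
            * N ^ (s * t + s' - 1) < d ^ (s * t + t + s')"
          by (simp only: x5_def cA_def mult_1)
      qed
    next
      case False
      then have tt: "t \<ge> 4" "t + s' \<ge> 2 * s + 3" and Nd': "N \<le> d\<^sup>2" using cases Nd by auto
      have \<epsilon>2: "8 * real t * (\<epsilon> * K ^ (s * t + t + s')) \<le> 1"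
      proof -
        have "8 * real t * (\<epsilon> * K ^ b) \<le> 8 * (t + 2 ^ (t + s')) * (\<epsilon> * K ^ b)"
          using \<epsilon> Kb by (intro mult_right_mono) auto
        then show ?thesis using \<epsilon>1 by (simp only: b_def)
      qed
      have good: "3 / 4 * (N * d ^ (s * t + t + s')) \<le> card (nbr_good M)"
      proof (rule card_homs_minus_nbr_good[OF few])
        show "real (8 * (s * t + t + s' + 1)\<^sup>2) * K ^ (s * t + t + s') \<le> d" using d0 by (simp only: b_def)
        show "real (8 * t) * (\<epsilon> * K ^ (s * t + t + s')) \<le> 1" using \<epsilon>2 by simp
      qed
      have "G * N ^ (s * t + s' - 1) \<le> C * N ^ (s * t + s' - 1)"
        using CG Npos[of "s * t + s' - 1"] by (intro mult_right_mono) auto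
      then have G: "G * N ^ (s * t + s' - 1) \<le> d ^ (s * t + t + s')" using dense3 by linarith
      have M0: "M \<ge> 1" by (simp add: M_def)
      have \<Gamma>0: "\<Gamma> \<ge> 0" using K by (simp add: \<Gamma>_def)
      have "\<exists>v\<in>V. \<Gamma> * d ^ (t + s') \<le> (\<Sum>w\<in>V. uu v w * codeg v w ^ t)"
        by (rule large_codegree_moment[OF tt(1) s Nd' M0 good G \<Gamma>0])
          (simp add: G_def C1_def c_def wt_def b_def)
      then obtain v where v: "v \<in> V" "\<Gamma> * d ^ (t + s') \<le> (\<Sum>w\<in>V. uu v w * codeg v w ^ t)"
        by blast
      show False
      proof (rule no_large_codegree_moment[OF v tt(2)])
        show "K ^ (2 * (s + 1)) * real ((p * (t + 1) + (s * t + s') + t) ^ (t + s')) \<le> d"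
          using Cx6 Cd by (simp only: x6_def a_def)
        show "1 + real (p * (t + 1) + s * t + 1) * K ^ (t + s') < \<Gamma>" by (simp add: \<Gamma>_def h_def)
      qed
    qed
  qed
qed

text \<open>Raise the density bound to the power \<open>x\<close>; as \<open>x >= 1\<close> and
  \<open>C >= 1\<close>, one factor \<open>C\<close> can be kept.\<close>

lemma power_bound_of_powr:
  fixes C N d \<alpha> :: real
  assumes "C \<ge> 1" "N \<ge> 1" "C * N powr \<alpha> \<le> d" "x \<ge> 1" "real y \<le> \<alpha> * real x"
  shows "C * N ^ y \<le> d ^ x"
proof -
  have "N ^ y = N powr real y" using assms(2) by (simp add: powr_realpow)
  also have "\<dots> \<le> N powr (\<alpha> * real x)" using assms by (intro powr_mono) auto
  also have "\<dots> = (N powr \<alpha>) ^ x" using assms(2) by (simp add: powr_powr[symmetric] powr_realpow)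
  finally have N: "N ^ y \<le> (N powr \<alpha>) ^ x" .
  have "C ^ 1 \<le> C ^ x" using assms by (intro power_increasing) auto
  then have "C * N ^ y \<le> C ^ x * (N powr \<alpha>) ^ x" using N assms by (intro mult_mono) auto
  also have "\<dots> = (C * N powr \<alpha>) ^ x" by (simp add: power_mult_distrib)
  also have "\<dots> \<le> d ^ x" using assms by (intro power_mono) auto
  finally show ?thesis .
qed

lemma T_tree_density:
  "rooted_density (T_tree s t s') = (real s * real t + real t + real s') / (real t + 1)"
proof -
  have "real (card (T_vs s t s')) - real (card (T_roots s t s')) = real t + 1"
    by (simp add: card_T_vs card_T_roots)
  then show ?thesis
    unfolding rooted_density_def T_tree_simps card_T_edges by simp
qed

text \<open>Balance is tested on two singletons: \<open>{Centre}\<close> gives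
  \<open>\<rho> <= t + s'\<close> and \<open>{Nbr 1}\<close> gives
  \<open>\<rho> <= s + 1\<close>.\<close>

lemma balanced_T_tree_bounds:
  assumes "t \<ge> 1" "balanced_rooted (T_tree s t s')"
  shows "s \<le> t + s'" "s' \<le> s + 1"
proof -
  define \<rho> where "\<rho> = rooted_density (T_tree s t s')"
  have \<rho>: "\<rho> * (real t + 1) = real s * real t + real t + real s'"
    unfolding \<rho>_def T_tree_density by (simp add: field_simps)
  have bal: "\<rho> * card S \<le> real (card {e \<in> att_edges (T_vs s t s'). e \<inter> S \<noteq> {}})"
    if "S \<subseteq> T_vs s t s' - T_roots s t s'" for S
    using assms(2) that unfolding balanced_rooted_def T_tree_simps \<rho>_def by auto
  have c: "card {e \<in> att_edges (T_vs s t s'). e \<inter> {Centre} \<noteq> {}} \<le> t + s'"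
  proof -
    let ?X = "Nbr ` {1..t} \<union> CentreLeaf ` {1..s'}"
    have "{e \<in> att_edges (T_vs s t s'). e \<inter> {Centre} \<noteq> {}} \<subseteq> (\<lambda>x. {x, att x}) ` ?X"
      by (auto simp: att_edges_def T_vs_def nbr_leaves_iff)
    then have "card {e \<in> att_edges (T_vs s t s'). e \<inter> {Centre} \<noteq> {}} \<le> card ((\<lambda>x. {x, att x}) ` ?X)"
      by (intro card_mono) auto
    also have "\<dots> \<le> card ?X" by (intro card_image_le) auto
    also have "\<dots> \<le> card (Nbr ` {1..t}) + card (CentreLeaf ` {1..s'})" by (rule card_Un_le)
    also have "\<dots> \<le> t + s'" by (simp add: card_image inj_on_def)
    finally show ?thesis .
  qed
  have "\<rho> * card {Centre} \<le> real (card {e \<in> att_edges (T_vs s t s'). e \<inter> {Centre} \<noteq> {}})"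
    by (rule bal) (simp add: T_nonroots)
  then have "\<rho> \<le> real (t + s')" using c by simp
  then have "real s * real t + real t + real s' \<le> real (t + s') * (real t + 1)"
    unfolding \<rho>[symmetric] by (intro mult_right_mono) auto
  then have "real t * real s \<le> real t * real (t + s')" by (simp add: algebra_simps)
  then show "s \<le> t + s'" using assms(1) by (simp del: of_nat_add)
  have n: "card {e \<in> att_edges (T_vs s t s'). e \<inter> {Nbr 1} \<noteq> {}} \<le> s + 1"
  proof -
    let ?X = "insert (Nbr 1) (NbrLeaf 1 ` {1..s})"
    have "{e \<in> att_edges (T_vs s t s'). e \<inter> {Nbr 1} \<noteq> {}} \<subseteq> (\<lambda>x. {x, att x}) ` ?X"
    proof
      fix e assume "e \<in> {e \<in> att_edges (T_vs s t s'). e \<inter> {Nbr 1} \<noteq> {}}"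
      then obtain x where x: "x \<in> T_vs s t s'" "x \<noteq> Centre" "e = {x, att x}" "Nbr 1 \<in> {x, att x}"
        by (auto simp: att_edges_def)
      then have "x \<in> ?X" by (cases x) (auto simp: T_vs_def nbr_leaves_iff)
      then show "e \<in> (\<lambda>x. {x, att x}) ` ?X" unfolding x(3) by (rule imageI)
    qed
    then have "card {e \<in> att_edges (T_vs s t s'). e \<inter> {Nbr 1} \<noteq> {}} \<le> card ((\<lambda>x. {x, att x}) ` ?X)"
      by (intro card_mono) auto
    also have "\<dots> \<le> card ?X" by (intro card_image_le) auto
    also have "\<dots> \<le> s + 1" by (simp add: card_insert_if card_image inj_on_def)
    finally show ?thesis .
  qed
  have "\<rho> * card {Nbr 1} \<le> real (card {e \<in> att_edges (T_vs s t s'). e \<inter> {Nbr 1} \<noteq> {}})"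
    using assms(1) by (intro bal) (simp add: T_nonroots)
  then have "\<rho> \<le> real (s + 1)" using n by simp
  then have "real s * real t + real t + real s' \<le> real (s + 1) * (real t + 1)"
    unfolding \<rho>[symmetric] by (intro mult_right_mono) auto
  then have "real s' \<le> real (s + 1)" by (simp add: algebra_simps)
  then show "s' \<le> s + 1" by linarith
qed

theorem theorem8:
  fixes s t s' :: nat
  assumes "s \<ge> 1" and "t \<ge> 1"
    and "int s - int s' \<ge> 2 \<Longrightarrow> int t \<ge> int s ^ 3 - 1"
    and "balanced_rooted (T_tree s t s')"
  shows "rooted_density (T_tree s t s') = (real s * real t + real t + real s') / (real t + 1) \<and>
    (\<forall>p\<ge>1. (\<lambda>n. real (extremal_number n (rooted_power (T_tree s t s') p)))
              \<in> O(\<lambda>n. real n powr (2 - 1 / rooted_density (T_tree s t s'))))"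
proof (intro conjI allI impI)
  show "rooted_density (T_tree s t s') = (real s * real t + real t + real s') / (real t + 1)"
    by (rule T_tree_density)
  fix p :: nat assume p: "p \<ge> 1"
  define \<rho> where "\<rho> = rooted_density (T_tree s t s')"
  define \<alpha> where "\<alpha> = 1 - 1 / \<rho>"
  define b where "b = s * t + t + s'"
  let ?H = "rooted_power (T_tree s t s') p"
  have bounds: "s \<le> t + s'" "s' \<le> s + 1" by (rule balanced_T_tree_bounds[OF assms(2,4)])+
  have \<rho>1: "\<rho> > 1" using assms(4) by (simp add: \<rho>_def balanced_rooted_def)
  have \<rho>b: "\<rho> * (real t + 1) = real b"
    unfolding \<rho>_def T_tree_density by (simp add: b_def field_simps)
  have \<alpha>: "0 < \<alpha>" "\<alpha> \<le> 1" using \<rho>1 by (simp_all add: \<alpha>_def field_simps)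
  \<comment> \<open>For \<open>\<alpha> = 1 - 1/\<rho>\<close> the inequality is a restatement of
    \<open>x <= \<rho>\<close>.\<close>
  have \<alpha>_int: "real (x - 1) \<le> \<alpha> * real x" if "x \<ge> 1" "real x \<le> \<rho>" for x :: nat
    using that \<rho>1 by (simp add: \<alpha>_def field_simps of_nat_diff)
  have \<rho>s: "real s \<le> \<rho>"
  proof -
    have "s * (t + 1) \<le> b" using bounds(1) by (simp add: b_def)
    then have "real s * (real t + 1) \<le> \<rho> * (real t + 1)"
      unfolding \<rho>b by (metis of_nat_1 of_nat_add of_nat_le_iff of_nat_mult)
    then show ?thesis by simp
  qed
  have \<rho>s': "real (max 1 s') \<le> \<rho>"
  proof -
    have "s' * t \<le> (s + 1) * t" using bounds(2) by (intro mult_le_mono1)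
    then have "s' * (t + 1) \<le> b" by (simp add: b_def)
    then have "real s' * (real t + 1) \<le> \<rho> * (real t + 1)"
      unfolding \<rho>b by (metis of_nat_1 of_nat_add of_nat_le_iff of_nat_mult)
    then show ?thesis using \<rho>1 by (simp add: max_def)
  qed
  \<comment> \<open>An equality in fact: \<open>b / \<rho> = t + 1\<close>. This is the point at
    which the exponent \<open>2 - 1/\<rho>\<close> is dictated.\<close>
  have \<alpha>b: "real (s * t + s' - 1) \<le> \<alpha> * real b"
  proof -
    have "1 \<le> s * t + s'" using mult_le_mono[OF assms(1,2)] by linarith
    then have "real (s * t + s' - 1) = real (s * t + s') - 1" by (simp only: of_nat_diff of_nat_1)
    also have "\<dots> = real b - (real t + 1)" by (simp add: b_def)
    also have "\<dots> = \<alpha> * real b" using \<rho>1 \<rho>b[symmetric] by (simp add: \<alpha>_def field_simps)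
    finally show ?thesis by simp
  qed
  \<comment> \<open>From \<open>s >= 2\<close> one gets \<open>4 * s <= s ^ 3 <= t + 1\<close>, so
    \<open>t >= 4 * s - 1 >= 2 * s + 3\<close>.\<close>
  have long: "s \<ge> 2 \<and> t \<ge> 4 \<and> t + s' \<ge> 2 * s + 3" if "\<not> s \<le> s' + 1"
  proof -
    have s2: "s \<ge> 2" using that by simp
    have "int t \<ge> int s ^ 3 - 1" using that by (intro assms(3)) simp
    then have t3: "s ^ 3 \<le> t + 1" by (metis of_nat_1 of_nat_add of_nat_le_iff of_nat_power diff_le_eq)
    have "4 * s \<le> s ^ 3"
    proof -
      have "2 * 2 * s \<le> s * s * s" using s2 by (intro mult_le_mono) auto
      then show ?thesis by (simp add: power3_eq_cube)
    qed
    then show ?thesis using t3 s2 by auto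
  qed
  define \<beta> where "\<beta> = (1 / 8) powr (1 / \<alpha>) / (2 :: real)"
  define K where "K = 16 / \<beta>"
  have \<beta>: "0 < \<beta>" "\<beta> \<le> 1 / 2" using \<alpha> by (simp_all add: \<beta>_def powr_le1)
  then have K1: "K \<ge> 1" by (simp add: K_def field_simps)
  have cases: "s \<le> s' + 1 \<or> t \<ge> 4 \<and> t + s' \<ge> 2 * s + 3" using long by blast
  obtain C where C1: "C \<ge> 1" and C: "\<And>(V :: nat set) E d. power_free_host V E K d s t s' p \<Longrightarrow> C \<le> d \<Longrightarrow>
     C * real (card V) ^ (max 1 s' - 1) \<le> d ^ max 1 s' \<Longrightarrow>
     C * real (card V) ^ (s - 1) \<le> d ^ s \<Longrightarrow>
     C * real (card V) ^ (s * t + s' - 1) \<le> d ^ (s * t + t + s') \<Longrightarrow>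
     (s \<le> s' + 1 \<or> real (card V) \<le> d\<^sup>2) \<Longrightarrow> False"
    using dense_no_host[OF K1 assms(1,2) cases, of p, where ?'v = nat] by metis
  define C' where "C' = 4 * C + 1 / \<beta>"
  have ex_le: "real (card (edges G)) \<le> C' * real n powr (1 + \<alpha>)"
    if G: "simple_graph G" "card (vertices G) = n" "\<not> contains_copy G ?H" and n: "n \<ge> 1"
    for G :: "nat graph" and n
  proof (rule ccontr)
    assume "\<not> ?thesis"
    then have many: "C' * real (card (vertices G)) powr (1 + \<alpha>) \<le> real (card (edges G))" using G(2) by simp
    have "finite (vertices G)" "vertices G \<noteq> {}" using G(1,2) n by (auto simp: simple_graph_def)
    moreover have E: "e \<subseteq> vertices G \<and> card e = 2" if "e \<in> edges G" for e
      using G(1) that by (simp add: simple_graph_def)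
    ultimately obtain V' E' d where sub: "V' \<subseteq> vertices G" "E' \<subseteq> edges G"
      and ar: "almost_regular V' E' K d" and dense: "C * real (card V') powr \<alpha> \<le> d"
      using exists_almost_regular[OF \<alpha> C1, of "vertices G" "edges G"] many
      unfolding C'_def \<beta>_def K_def by blast
    interpret almost_regular V' E' K d by (rule ar)
    have "power_free_host V' E' K d s t s' p"
    proof
      show "1 \<le> t" by fact
      show "\<not> sunflower_at V' E' (T_vs s t s') (att_edges (T_vs s t s')) (T_roots s t s') p \<xi>" for \<xi>
      proof
        assume sf: "sunflower_at V' E' (T_vs s t s') (att_edges (T_vs s t s')) (T_roots s t s') p \<xi>"
        have "emb V' E' (T_vs s t s') (att_edges (T_vs s t s')) \<subseteq>
            emb (vertices G) (edges G) (T_vs s t s') (att_edges (T_vs s t s'))"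
          using sub by (fastforce simp: emb_def homs_def)
        then have "sunflower_at (vertices G) (edges G) (T_vs s t s') (att_edges (T_vs s t s')) (T_roots s t s') p \<xi>"
          using sf unfolding sunflower_at_def
          by (elim exE conjE, intro exI conjI) (assumption | erule subset_trans)+
        then have "contains_copy G ?H"
          using G(1) p simple_T_tree T_roots_subset
          by (intro contains_rooted_power_if_sunflower[where \<xi> = \<xi>]) (auto simp: T_tree_simps)
        then show False using G(3) by blast
      qed
    qed
    moreover have "C \<le> d"
      using power_bound_of_powr[OF C1 N_ge_1 dense, of 1 0] \<alpha> by simp
    moreover have "C * N ^ (max 1 s' - 1) \<le> d ^ max 1 s'"
      using \<alpha>_int[of "max 1 s'"] \<rho>s' by (intro power_bound_of_powr[OF C1 N_ge_1 dense]) auto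
    moreover have "C * N ^ (s - 1) \<le> d ^ s"
      using \<alpha>_int[of s] \<rho>s assms(1) by (intro power_bound_of_powr[OF C1 N_ge_1 dense]) auto
    moreover have "C * N ^ (s * t + s' - 1) \<le> d ^ (s * t + t + s')"
      using \<alpha>b assms(2) by (intro power_bound_of_powr[OF C1 N_ge_1 dense]) (auto simp: b_def)
    \<comment> \<open>In the second case \<open>\<rho> >= s >= 2\<close>, so the exponent pair
      \<open>(1, 2)\<close> is available and gives \<open>C * N <= d^2\<close>.\<close>
    moreover have "s \<le> s' + 1 \<or> N \<le> d\<^sup>2"
    proof (cases "s \<le> s' + 1")
      case False
      then have "real 2 \<le> \<rho>" using long \<rho>s by linarith
      then have "real (2 - 1) \<le> \<alpha> * real 2" by (intro \<alpha>_int) auto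
      then have "C * N ^ 1 \<le> d ^ 2" by (intro power_bound_of_powr[OF C1 N_ge_1 dense]) auto
      moreover have "N \<le> C * N" using C1 N_ge_1 mult_right_mono[of 1 C N] by simp
      ultimately show ?thesis by simp
    qed simp
    ultimately show False by (rule C)
  qed
  have edges_ne: "edges ?H \<noteq> {}"
  proof -
    have "Nbr 1 \<in> T_vs s t s' - {Centre}" using assms(2) by (auto simp: T_vs_def)
    then have "edges (T_tree s t s') \<noteq> {}" by (auto simp: T_tree_simps att_edges_def)
    then obtain e where e: "e \<in> edges (T_tree s t s')" by blast
    have "0 \<in> {..<p}" using p by simp
    then have "copy_vertex (T_tree s t s') 0 ` e \<in> edges ?H"
      using e unfolding rooted_power_def by auto
    then show ?thesis by blast
  qed
  have "real (extremal_number n ?H) \<le> C' * real n powr (1 + \<alpha>)" if n: "n \<ge> 1" for n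
  proof -
    let ?S = "{card (edges G) | G :: nat graph. simple_graph G \<and> card (vertices G) = n \<and> \<not> contains_copy G ?H}"
    have "extremal_number n ?H \<in> ?S"
      unfolding extremal_number_def
      by (rule Max_in[OF finite_extremal_set extremal_set_nonempty[OF edges_ne]])
    then obtain G :: "nat graph" where "extremal_number n ?H = card (edges G)" "simple_graph G"
      "card (vertices G) = n" "\<not> contains_copy G ?H" by blast
    then show ?thesis using ex_le n by metis
  qed
  then have "\<forall>n\<ge>1. norm (real (extremal_number n ?H)) \<le> C' * norm (real n powr (1 + \<alpha>))" by simp
  then have "(\<lambda>n. real (extremal_number n ?H)) \<in> O(\<lambda>n. real n powr (1 + \<alpha>))"
    by (intro bigoI[of _ C']) (auto simp: eventually_at_top_linorder)
  moreover have "1 + \<alpha> = 2 - 1 / \<rho>" by (simp add: \<alpha>_def)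
  ultimately show "(\<lambda>n. real (extremal_number n ?H)) \<in> O(\<lambda>n. real n powr (2 - 1 / rooted_density (T_tree s t s')))"
    by (simp add: \<rho>_def)
qed

end
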